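(* For every prime power $q=p^n$, the group $G=\mathrm{GL}_2(\mathbb{F}_q)$ has $\hat{\mathrm{C}}(G)=\{1\}$.
   Context: For a finite group $G$: $\mathrm{Char}_{\mathbb{Q}}(G)$ is the ring of $\mathbb{Q}$-valued virtual complex characters of $G$; $\mathrm{Perm}(G)\subseteq \mathrm{Char}_{\mathbb{Q}}(G)$ is the ring of characters of virtual permutation representations, i.e. the $\mathbb{Z}$-span of the characters of $\mathbb{Q}[G/H]$ for $H\le G$; and $\hat{\mathrm{C}}(G)=\mathrm{Char}_{\mathbb{Q}}(G)/\mathrm{Perm}(G)$. Here $\{1\}$ denotes the trivial group. *)

theory Defs
  imports
    "HOL-Algebra.AbelCoset"
    "HOL-Algebra.Elementary_Groups"
    "HOL-Algebra.Left_Coset"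
    "HOL-Library.Cardinality"
    "HOL-Computational_Algebra.Primes"
    "Jordan_Normal_Form.Matrix"
begin

definition GL :: "'a::field itself \<Rightarrow> nat \<Rightarrow> 'a mat monoid" where
  "GL ty n = units_of (ring_mat ty n ())"

definition is_representation :: "('g, 'm) monoid_scheme \<Rightarrow> nat \<Rightarrow> ('g \<Rightarrow> complex mat) \<Rightarrow> bool" where
  "is_representation G n \<rho> \<longleftrightarrow> \<rho> \<in> hom G (GL TYPE(complex) n)"

definition mat_trace :: "'a::comm_monoid_add mat \<Rightarrow> 'a" where
  "mat_trace A = (\<Sum>i<dim_row A. A $$ (i, i))"

definition character :: "('g, 'm) monoid_scheme \<Rightarrow> ('g \<Rightarrow> complex mat) \<Rightarrow> 'g \<Rightarrow> complex" where
  "character G \<rho> = (\<lambda>g\<in>carrier G. mat_trace (\<rho> g))"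

definition characters :: "('g, 'm) monoid_scheme \<Rightarrow> ('g \<Rightarrow> complex) set" where
  "characters G = {character G \<rho> | n \<rho>. is_representation G n \<rho>}"

text \<open>
  Functions on \<open>G\<close> are represented extensionally (they are \<open>undefined\<close> off the carrier), so that
  equality in the following ring is equality of functions on \<open>G\<close>.
\<close>

definition fun_ring :: "('g, 'm) monoid_scheme \<Rightarrow> ('g \<Rightarrow> complex) ring" where
  "fun_ring G = \<lparr>
     carrier = carrier G \<rightarrow>\<^sub>E UNIV,
     monoid.mult = (\<lambda>\<phi> \<psi>. \<lambda>g\<in>carrier G. \<phi> g * \<psi> g),
     monoid.one = (\<lambda>g\<in>carrier G. 1),
     ring.zero = (\<lambda>g\<in>carrier G. 0),
     ring.add = (\<lambda>\<phi> \<psi>. \<lambda>g\<in>carrier G. \<phi> g + \<psi> g)\<rparr>"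

definition int_span :: "('g, 'm) monoid_scheme \<Rightarrow> ('g \<Rightarrow> complex) set \<Rightarrow> ('g \<Rightarrow> complex) set" where
  "int_span G S = generate (add_monoid (fun_ring G)) S"

definition Char_Q :: "('g, 'm) monoid_scheme \<Rightarrow> ('g \<Rightarrow> complex) ring" where
  "Char_Q G = (fun_ring G)
     \<lparr>carrier := {\<chi> \<in> int_span G (characters G). \<forall>g\<in>carrier G. \<chi> g \<in> \<rat>}\<rparr>"

text \<open>
  The matrices of the left translation action of \<open>G\<close> on \<open>\<rat>[G/H]\<close> with respect to its basis of left
  cosets, ordered as \<open>e 0, \<dots>, e (k - 1)\<close>, where \<open>k = [G : H]\<close>.
  The group \<open>G\<close> is meant to be finite.
\<close>

definition coset_rep ::
    "('g, 'm) monoid_scheme \<Rightarrow> 'g set \<Rightarrow> (nat \<Rightarrow> 'g set) \<Rightarrow> 'g \<Rightarrow> rat mat" where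
  "coset_rep G H e g =
     (let k = card (lcosets\<^bsub>G\<^esub> H)
      in mat k k (\<lambda>(i, j). if g <#\<^bsub>G\<^esub> e j = e i then 1 else 0))"

definition perm_characters :: "('g, 'm) monoid_scheme \<Rightarrow> ('g \<Rightarrow> complex) set" where
  "perm_characters G =
     {character G (\<lambda>g. map_mat of_rat (coset_rep G H e g)) | H e.
        subgroup H G \<and> bij_betw e {..<card (lcosets\<^bsub>G\<^esub> H)} (lcosets\<^bsub>G\<^esub> H)}"

definition Perm :: "('g, 'm) monoid_scheme \<Rightarrow> ('g \<Rightarrow> complex) set" where
  "Perm G = int_span G (perm_characters G)"

text \<open>
  \<open>Perm G\<close> is a subring containing the constant 1, hence not an ideal of \<open>Char_Q G\<close> unless
  the two are equal; the quotient is therefore one of additive groups.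
\<close>

definition C_hat :: "('g, 'm) monoid_scheme \<Rightarrow> ('g \<Rightarrow> complex) set monoid" where
  "C_hat G = Char_Q G A_Mod Perm G"

lemma fun_ring_cring: "cring (fun_ring G)"
proof (rule cringI)
  show "abelian_group (fun_ring G)"
  proof (rule abelian_groupI)
    fix x assume "x \<in> carrier (fun_ring G)"
    then show "\<exists>y\<in>carrier (fun_ring G). y \<oplus>\<^bsub>fun_ring G\<^esub> x = \<zero>\<^bsub>fun_ring G\<^esub>"
      by (intro bexI[of _ "\<lambda>g\<in>carrier G. - x g"]) (auto simp: fun_ring_def)
  qed (auto simp: fun_ring_def fun_eq_iff PiE_def extensional_def restrict_def)
  show "Group.comm_monoid (fun_ring G)"
    by (rule comm_monoidI)
      (auto simp: fun_ring_def fun_eq_iff PiE_def extensional_def restrict_def)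
qed (auto simp: fun_ring_def fun_eq_iff restrict_def algebra_simps)

lemma GL_group: "group (GL TYPE('a::field) n)"
proof -
  interpret semiring "ring_mat TYPE('a) n ()" by (rule semiring_mat)
  show ?thesis unfolding GL_def by (rule units_group)
qed

lemma GL_carrier: "carrier (GL TYPE('a::field) n) =
   {A \<in> carrier_mat n n. \<exists>B \<in> carrier_mat n n. B * A = 1\<^sub>m n \<and> A * B = 1\<^sub>m n}"
  by (auto simp: GL_def units_of_def Units_def ring_mat_simps)

lemma coset_rep_mult:
  assumes G: "group G" and H: "subgroup H G" and e: "bij_betw e {..<card (lcosets\<^bsub>G\<^esub> H)} (lcosets\<^bsub>G\<^esub> H)"
    and g: "g \<in> carrier G" and h: "h \<in> carrier G"
  shows "coset_rep G H e (g \<otimes>\<^bsub>G\<^esub> h) = coset_rep G H e g * coset_rep G H e h"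
proof -
  interpret group G by fact
  let ?k = "card (lcosets\<^bsub>G\<^esub> H)"
  have HG: "H \<subseteq> carrier G" using H by (rule subgroup.subset)
  have sub: "C \<subseteq> carrier G" if "C \<in> lcosets\<^bsub>G\<^esub> H" for C
    using that lcosets_subset_PowG[OF H] by auto
  have ej: "e j \<in> lcosets\<^bsub>G\<^esub> H" if "j < ?k" for j using e that by (auto simp: bij_betw_def)
  have act: "h <#\<^bsub>G\<^esub> C \<in> lcosets\<^bsub>G\<^esub> H" if "C \<in> lcosets\<^bsub>G\<^esub> H" for C
  proof -
    obtain a where a: "a \<in> carrier G" "C = a <#\<^bsub>G\<^esub> H" using \<open>C \<in> _\<close> by (auto simp: LCOSETS_def)
    have "h <#\<^bsub>G\<^esub> C = (h \<otimes>\<^bsub>G\<^esub> a) <#\<^bsub>G\<^esub> H" using a h HG by (simp add: lcos_m_assoc)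
    then show ?thesis using a h by (auto simp: LCOSETS_def)
  qed
  show ?thesis
  proof (rule eq_matI)
    fix i j assume ij: "i < dim_row (coset_rep G H e g * coset_rep G H e h)" "j < dim_col (coset_rep G H e g * coset_rep G H e h)"
    then have i: "i < ?k" and j: "j < ?k" by (auto simp: coset_rep_def Let_def)
    obtain l where l: "l < ?k" "e l = h <#\<^bsub>G\<^esub> e j"
      using act[OF ej[OF j]] e by (metis (no_types, lifting) bij_betw_def imageE lessThan_iff)
    have eq: "h <#\<^bsub>G\<^esub> e j = e m \<longleftrightarrow> m = l" if "m < ?k" for m
      using l e that by (metis bij_betw_def inj_on_def lessThan_iff)
    have "(coset_rep G H e g * coset_rep G H e h) $$ (i,j)
       = (\<Sum>m<?k. (if g <#\<^bsub>G\<^esub> e m = e i then 1 else 0) * (if h <#\<^bsub>G\<^esub> e j = e m then 1 else 0))"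
      using i j by (simp add: coset_rep_def Let_def scalar_prod_def atLeast0LessThan)
    also have "\<dots> = (\<Sum>m<?k. if m = l then (if g <#\<^bsub>G\<^esub> e m = e i then 1 else 0) else 0)"
      by (rule sum.cong) (auto simp: eq)
    also have "\<dots> = (if g <#\<^bsub>G\<^esub> e l = e i then 1 else 0)" using l by (simp add: sum.delta)
    also have "\<dots> = coset_rep G H e (g \<otimes>\<^bsub>G\<^esub> h) $$ (i,j)"
      using i j l g h sub[OF ej[OF j]] by (simp add: coset_rep_def Let_def lcos_m_assoc)
    finally show "coset_rep G H e (g \<otimes>\<^bsub>G\<^esub> h) $$ (i,j) = (coset_rep G H e g * coset_rep G H e h) $$ (i,j)" by simp
  qed (auto simp: coset_rep_def Let_def)
qed

lemma coset_rep_is_representation: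
  assumes G: "group G" and H: "subgroup H G"
    and e: "bij_betw e {..<card (lcosets\<^bsub>G\<^esub> H)} (lcosets\<^bsub>G\<^esub> H)"
  shows "is_representation G (card (lcosets\<^bsub>G\<^esub> H)) (\<lambda>g. map_mat of_rat (coset_rep G H e g))"
proof -
  interpret group G by fact
  let ?k = "card (lcosets\<^bsub>G\<^esub> H)"
  let ?r = "\<lambda>g. map_mat of_rat (coset_rep G H e g) :: complex mat"
  have cr: "coset_rep G H e g \<in> carrier_mat ?k ?k" for g by (simp add: coset_rep_def Let_def)
  have c: "?r g \<in> carrier_mat ?k ?k" for g using cr by simp
  have sub: "C \<subseteq> carrier G" if "C \<in> lcosets\<^bsub>G\<^esub> H" for C
    using that lcosets_subset_PowG[OF H] by auto
  have ej: "e j \<subseteq> carrier G" if "j < ?k" for j using e that sub by (auto simp: bij_betw_def)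
  have one: "coset_rep G H e \<one>\<^bsub>G\<^esub> = 1\<^sub>m ?k"
  proof (rule eq_matI)
    fix i j assume "i < dim_row (1\<^sub>m ?k :: rat mat)" "j < dim_col (1\<^sub>m ?k :: rat mat)"
    then have ij: "i < ?k" "j < ?k" by auto
    have "\<one>\<^bsub>G\<^esub> <#\<^bsub>G\<^esub> e j = e i \<longleftrightarrow> i = j"
      using ij e ej[OF ij(2)] by (simp add: lcos_mult_one) (metis bij_betw_def inj_on_def lessThan_iff)
    then show "coset_rep G H e \<one>\<^bsub>G\<^esub> $$ (i,j) = (1\<^sub>m ?k :: rat mat) $$ (i,j)"
      using ij by (simp add: coset_rep_def Let_def)
  qed (auto simp: coset_rep_def Let_def)
  have mult: "?r (g \<otimes>\<^bsub>G\<^esub> h) = ?r g * ?r h" if "g \<in> carrier G" "h \<in> carrier G" for g h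
  proof -
    have "?r (g \<otimes>\<^bsub>G\<^esub> h) = map_mat of_rat (coset_rep G H e g * coset_rep G H e h)"
      using coset_rep_mult[OF G H e that] by simp
    also have "\<dots> = ?r g * ?r h"
      using cr[of g] cr[of h]
      by (intro eq_matI) (auto simp: scalar_prod_def of_rat_sum of_rat_mult)
    finally show ?thesis .
  qed
  have r1: "?r \<one>\<^bsub>G\<^esub> = 1\<^sub>m ?k" by (auto simp: one)
  have "?r g \<in> carrier (GL TYPE(complex) ?k)" if g: "g \<in> carrier G" for g
    unfolding GL_carrier using c mult[of g "inv\<^bsub>G\<^esub> g"] mult[of "inv\<^bsub>G\<^esub> g" g] g r1
    by (auto intro!: bexI[of _ "?r (inv\<^bsub>G\<^esub> g)"])
  then show ?thesis
    unfolding is_representation_def hom_def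
    using mult by (auto simp: GL_def units_of_def ring_mat_simps)
qed

lemma C_hat_group:
  assumes G: "group G"
  shows "additive_subgroup (Perm G) (Char_Q G)" "comm_group (C_hat G)"
proof -
  interpret F: cring "fun_ring G" by (rule fun_ring_cring)
  let ?A = "add_monoid (fun_ring G)"
  let ?R = "{\<phi> \<in> carrier (fun_ring G). \<forall>g\<in>carrier G. \<phi> g \<in> \<rat>}"
  have minus: "\<ominus>\<^bsub>fun_ring G\<^esub> \<phi> = (\<lambda>g\<in>carrier G. - \<phi> g)" if "\<phi> \<in> carrier (fun_ring G)" for \<phi>
    using that by (intro F.minus_equality) (auto simp: fun_ring_def)
  have subR: "subgroup ?R ?A"
  proof (rule F.add.subgroupI)
    show "?R \<noteq> {}"
      by (auto simp: fun_ring_def intro!: exI[of _ "\<lambda>g\<in>carrier G. 0"])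
  qed (auto simp: minus, auto simp: fun_ring_def)
  have ch: "characters G \<subseteq> carrier (fun_ring G)" by (auto simp: characters_def character_def fun_ring_def)
  have pc: "perm_characters G \<subseteq> characters G"
    using coset_rep_is_representation[OF G] by (fastforce simp: perm_characters_def characters_def)
  have pr: "perm_characters G \<subseteq> ?R"
    by (auto simp: perm_characters_def character_def fun_ring_def mat_trace_def coset_rep_def Let_def intro!: Rats_sum)
  have sV: "subgroup (int_span G (characters G)) ?A"
    unfolding int_span_def by (rule F.add.generate_is_subgroup[OF ch])
  have sP: "subgroup (Perm G) ?A"
    unfolding Perm_def int_span_def by (rule F.add.generate_is_subgroup) (use pc ch in blast)
  have cQ: "carrier (Char_Q G) = int_span G (characters G) \<inter> ?R"
    using subgroup.subset[OF sV] by (auto simp: Char_Q_def)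
  have sC: "subgroup (carrier (Char_Q G)) ?A"
    unfolding cQ by (rule F.add.subgroups_Inter_pair[OF sV subR])
  have PV: "Perm G \<subseteq> int_span G (characters G)"
    unfolding Perm_def int_span_def by (rule F.add.mono_generate[OF pc])
  have PR: "Perm G \<subseteq> ?R"
    unfolding Perm_def int_span_def by (rule F.add.generate_subgroup_incl[OF pr subR])
  have eq: "add_monoid (Char_Q G) = ?A\<lparr>carrier := carrier (Char_Q G)\<rparr>"
    by (simp add: Char_Q_def)
  have sub: "subgroup (Perm G) (add_monoid (Char_Q G))"
    unfolding eq by (rule F.add.subgroup_incl[OF sP sC]) (use PV PR cQ in auto)
  then show as: "additive_subgroup (Perm G) (Char_Q G)" by (rule additive_subgroup.intro)
  have cg: "comm_group (add_monoid (Char_Q G))"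
    unfolding eq
    by (rule group.group_comm_groupI[OF F.add.subgroup_imp_group[OF sC]])
      (use subgroup.subset[OF sC] F.a_comm in auto)
  show "comm_group (C_hat G)"
    unfolding C_hat_def A_FactGroup_def by (rule comm_group.abelian_FactGroup[OF cg sub])
qed

end

theory Submission
  imports
    Defs
    "HOL-Algebra.Multiplicative_Group"
    "HOL-Number_Theory.Residues"
    "Jordan_Normal_Form.Schur_Decomposition"
begin

text \<open>
  Let \<open>f\<close> be a rational-valued virtual character of \<open>G = GL\<^sub>2(\<bbbF>\<^sub>q)\<close>, let \<open>T\<close> and \<open>T'\<close> be a split and a nonsplit
  torus, and \<open>Z\<close> the centre. A comparison of values on conjugacy classes gives
  \<open>f = 1/2 Ind\<^sub>T f + 1/2 Ind\<^sub>T\<^sub>' f - R\<close>, where the correction \<open>R\<close> only depends on the values of \<open>f\<close> at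
  \<open>z\<close> and \<open>z u\<close> for \<open>z \<in> Z\<close> and \<open>u\<close> unipotent. Since \<open>f(x\<^sup>k) = f(x)\<close> for \<open>k\<close> prime to the order of \<open>G\<close>, the
  restriction of \<open>f\<close> to an abelian subgroup is an integral combination of permutation characters;
  in particular \<open>R\<close> is one of \<open>G\<close>. The halves are dealt with by the involution \<open>w\<close> that
  normalises the torus: subgroups of the torus that \<open>w\<close> moves occur in pairs, and for a \<open>w\<close>-stable
  subgroup \<open>K\<close> half of the character of \<open>G/K\<close> differs from that of \<open>G/(K \<union> K w)\<close> by the contribution
  of \<open>K w\<close>. All elements \<open>k w\<close> have trace zero and determinant \<open>- det k\<close>, so the total error \<open>Y\<close> is
  given by a function of the determinant. As \<open>Y\<close> is a virtual character, pairing it with the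
  characters \<open>\<alpha> \<circ> det\<close> shows that this function is integral on the dual of the multiplicative group,
  and then \<open>Y\<close> is again a virtual permutation character.
\<close>

section \<open>Spans of characters and multiplicities\<close>

text \<open>The halves are unavoidable: up to conjugacy a noncentral semisimple element lies in
  exactly one of the two tori, and there the induced trivial character takes the value 2, coming
  from the torus and from its coset by the involution. So each induction counts \<open>f\<close>
  twice. A half is a virtual permutation character only up to a defect that is not visibly integral.
  What saves the argument is that the two defects add up to \<open>Y\<close>, that
  \<open>f + Y\<close> is a virtual permutation character, and that \<open>Y\<close> is therefore a
  difference of two virtual characters. Its integrality is thus drawn from \<open>f\<close> itself,
  and linear characters suffice to see it because \<open>Y\<close> lives on nonscalar trace zero
  elements, which form one class per determinant. Everything is arranged to be uniform in odd and
  even characteristic: classes are compared through trace and determinant, without eigenvalues in an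
  extension field, and the nonsplit torus is built from an arbitrary quadratic without roots.
  Invariance of \<open>f\<close> under prime-to-order powers comes from congruences modulo large
  primes instead of the Galois theory of cyclotomic fields.\<close>

locale fin_group = group G for G (structure) +
  assumes fin: "finite (carrier G)"

text \<open>Restricting first lets any total function stand for a function on \<open>G\<close>, so
  that sums and products can be written as plain lambda terms whatever they do off the
  carrier.\<close>

definition spanned :: "('g, 'm) monoid_scheme \<Rightarrow> ('g \<Rightarrow> complex) set \<Rightarrow> ('g \<Rightarrow> complex) \<Rightarrow> bool" where
  "spanned G S f \<longleftrightarrow> restrict f (carrier G) \<in> int_span G S"

abbreviation virt :: "('g, 'm) monoid_scheme \<Rightarrow> ('g \<Rightarrow> complex) \<Rightarrow> bool" where
  "virt G \<equiv> spanned G (characters G)"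

abbreviation perm :: "('g, 'm) monoid_scheme \<Rightarrow> ('g \<Rightarrow> complex) \<Rightarrow> bool" where
  "perm G \<equiv> spanned G (perm_characters G)"

lemma spanned_cong:
  assumes "spanned G S f" and "\<And>x. x \<in> carrier G \<Longrightarrow> f x = g x"
  shows "spanned G S g"
  using assms unfolding spanned_def by (metis (no_types, lifting) restrict_ext)

lemma spanned_0: "spanned G S (\<lambda>x. 0)"
proof -
  have "\<one>\<^bsub>add_monoid (fun_ring G)\<^esub> \<in> generate (add_monoid (fun_ring G)) S"
    by (rule generate.one)
  then show ?thesis by (simp add: spanned_def int_span_def fun_ring_def)
qed

lemma spanned_add:
  assumes "spanned G S f" "spanned G S g"
  shows "spanned G S (\<lambda>x. f x + g x)"
proof -
  have "restrict f (carrier G) \<otimes>\<^bsub>add_monoid (fun_ring G)\<^esub> restrict g (carrier G)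
      \<in> generate (add_monoid (fun_ring G)) S"
    using assms unfolding spanned_def int_span_def by (rule generate.eng)
  also have "restrict f (carrier G) \<otimes>\<^bsub>add_monoid (fun_ring G)\<^esub> restrict g (carrier G)
      = restrict (\<lambda>x. f x + g x) (carrier G)"
    by (auto simp: fun_ring_def fun_eq_iff)
  finally show ?thesis unfolding spanned_def int_span_def .
qed

lemma fun_ring_minus:
  assumes "\<phi> \<in> carrier (fun_ring G)"
  shows "\<ominus>\<^bsub>fun_ring G\<^esub> \<phi> = (\<lambda>g\<in>carrier G. - \<phi> g)"
proof -
  interpret F: cring "fun_ring G" by (rule fun_ring_cring)
  show ?thesis using assms by (intro F.minus_equality) (auto simp: fun_ring_def)
qed

lemma spanned_uminus:
  assumes "S \<subseteq> carrier (fun_ring G)" "spanned G S f"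
  shows "spanned G S (\<lambda>x. - f x)"
proof -
  interpret F: cring "fun_ring G" by (rule fun_ring_cring)
  have "inv\<^bsub>add_monoid (fun_ring G)\<^esub> (restrict f (carrier G)) \<in> generate (add_monoid (fun_ring G)) S"
    by (rule group.generate_m_inv_closed[OF F.a_group]) (use assms in \<open>simp_all add: spanned_def int_span_def\<close>)
  also have "inv\<^bsub>add_monoid (fun_ring G)\<^esub> (restrict f (carrier G)) = \<ominus>\<^bsub>fun_ring G\<^esub> (restrict f (carrier G))"
    by (simp add: a_inv_def)
  also have "\<dots> = restrict (\<lambda>x. - f x) (carrier G)"
    by (subst fun_ring_minus) (auto simp: fun_ring_def fun_eq_iff)
  finally show ?thesis unfolding spanned_def int_span_def .
qed

lemma spanned_diff:
  assumes "S \<subseteq> carrier (fun_ring G)" "spanned G S f" "spanned G S g"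
  shows "spanned G S (\<lambda>x. f x - g x)"
  using spanned_add[OF assms(2) spanned_uminus[OF assms(1,3)]] by simp

lemma spanned_sum:
  assumes "\<And>i. i \<in> I \<Longrightarrow> spanned G S (f i)"
  shows "spanned G S (\<lambda>x. \<Sum>i\<in>I. f i x)"
  using assms by (induction I rule: infinite_finite_induct) (auto intro: spanned_0 spanned_add)

lemma spanned_int_mult:
  assumes "S \<subseteq> carrier (fun_ring G)" "spanned G S f"
  shows "spanned G S (\<lambda>x. of_int c * f x)"
proof -
  have nat: "spanned G S (\<lambda>x. of_nat m * f x)" for m
    using spanned_sum[of "{..<m}" G S "\<lambda>_. f"] assms(2) by simp
  show ?thesis
  proof (cases c rule: int_cases2)
    case (nonneg m)
    then show ?thesis using nat[of m] by simp
  next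
    case (nonpos m)
    then show ?thesis using spanned_uminus[OF assms(1) nat[of m]] by simp
  qed
qed

lemma spanned_mono:
  assumes "S \<subseteq> T" "spanned G S f"
  shows "spanned G T f"
proof -
  interpret F: cring "fun_ring G" by (rule fun_ring_cring)
  show ?thesis using assms F.add.mono_generate[of S T] by (auto simp: spanned_def int_span_def)
qed

text \<open>An additive functional that is integral on generators is integral on their span.
  Multiplicities of linear characters and the conjugation invariance of virtual characters both come
  through here, with the functional given by weights \<open>c\<close>.\<close>

lemma spanned_functional_Ints:
  assumes S: "S \<subseteq> carrier (fun_ring G)" and H: "H \<subseteq> carrier G"
    and gen: "\<And>s. s \<in> S \<Longrightarrow> (\<Sum>x\<in>H. s x * c x) \<in> \<int>"
    and f: "spanned G S f"
  shows "(\<Sum>x\<in>H. f x * c x) \<in> \<int>"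
proof -
  have "(\<Sum>x\<in>H. g x * c x) \<in> \<int>" if "g \<in> generate (add_monoid (fun_ring G)) S" for g
    using that
  proof induction
    case one
    then show ?case using H by (simp add: fun_ring_def subset_iff sum.neutral)
  next
    case (incl h)
    then show ?case by (rule gen)
  next
    case (inv h)
    then have "inv\<^bsub>add_monoid (fun_ring G)\<^esub> h = (\<lambda>g\<in>carrier G. - h g)"
      using S fun_ring_minus[of h G] by (auto simp: a_inv_def)
    then have "(\<Sum>x\<in>H. (inv\<^bsub>add_monoid (fun_ring G)\<^esub> h) x * c x) = - (\<Sum>x\<in>H. h x * c x)"
      using H by (simp add: sum_negf[symmetric] subset_iff)
    then show ?case using gen[OF inv] by simp
  next
    case (eng h1 h2)
    have "(\<Sum>x\<in>H. (h1 \<otimes>\<^bsub>add_monoid (fun_ring G)\<^esub> h2) x * c x)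
        = (\<Sum>x\<in>H. h1 x * c x) + (\<Sum>x\<in>H. h2 x * c x)"
      unfolding sum.distrib[symmetric]
      by (rule sum.cong) (use H in \<open>auto simp: fun_ring_def algebra_simps\<close>)
    then show ?case using eng by simp
  qed
  from this[of "restrict f (carrier G)"] f have "(\<Sum>x\<in>H. restrict f (carrier G) x * c x) \<in> \<int>"
    by (simp add: spanned_def int_span_def)
  also have "(\<Sum>x\<in>H. restrict f (carrier G) x * c x) = (\<Sum>x\<in>H. f x * c x)"
    using H by (intro sum.cong) auto
  finally show ?thesis .
qed

lemma characters_carrier: "characters G \<subseteq> carrier (fun_ring G)"
  by (auto simp: characters_def character_def fun_ring_def)

lemma perm_characters_characters:
  "group G \<Longrightarrow> perm_characters G \<subseteq> characters G"
  using coset_rep_is_representation by (fastforce simp: perm_characters_def characters_def)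

lemma perm_characters_carrier:
  "perm_characters G \<subseteq> carrier (fun_ring G)"
  by (auto simp: perm_characters_def character_def fun_ring_def)

lemma Char_Q_iff: "f \<in> carrier (Char_Q G) \<longleftrightarrow> f \<in> int_span G (characters G) \<and> (\<forall>g\<in>carrier G. f g \<in> \<rat>)"
  by (simp add: Char_Q_def)

text \<open>\<open>Perm G\<close> already lies in \<open>Char_Q G\<close>, so the reverse inclusion
  leaves a single coset. From here on the goal concerns functions and no quotient.\<close>

lemma trivial_C_hatI:
  assumes G: "group G"
    and perm: "\<And>f. virt G f \<Longrightarrow> (\<And>x. x \<in> carrier G \<Longrightarrow> f x \<in> \<rat>) \<Longrightarrow> perm G f"
  shows "trivial_group (C_hat G)"
proof -
  interpret F: cring "fun_ring G" by (rule fun_ring_cring)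
  interpret A: additive_subgroup "Perm G" "Char_Q G" by (rule C_hat_group(1)[OF G])
  interpret C: comm_group "C_hat G" by (rule C_hat_group(2)[OF G])
  have span: "int_span G (characters G) \<subseteq> carrier (fun_ring G)"
    using F.add.generate_incl[OF characters_carrier] by (simp add: int_span_def)
  have sub: "carrier (Char_Q G) \<subseteq> Perm G"
  proof
    fix f assume f: "f \<in> carrier (Char_Q G)"
    then have "f \<in> carrier (fun_ring G)" using span by (auto simp: Char_Q_iff)
    then have r: "restrict f (carrier G) = f" by (auto simp: fun_ring_def PiE_restrict)
    have "perm G f" using f r by (intro perm) (auto simp: spanned_def Char_Q_iff)
    then show "f \<in> Perm G" by (simp add: spanned_def Perm_def r)
  qed
  have eq: "Perm G = carrier (Char_Q G)" using sub A.a_subset by blast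
  have g: "group (add_monoid (Char_Q G))"
  proof -
    have "add_monoid (Char_Q G) = (add_monoid (fun_ring G))\<lparr>carrier := Perm G\<rparr>"
      by (simp add: Char_Q_def eq)
    moreover have "subgroup (Perm G) (add_monoid (fun_ring G))"
      unfolding Perm_def int_span_def by (rule F.add.generate_is_subgroup[OF perm_characters_carrier])
    ultimately show ?thesis using F.add.subgroup_imp_group by metis
  qed
  have "carrier (C_hat G) = {carrier (Char_Q G)}"
  proof -
    interpret g: group "add_monoid (Char_Q G)" by (rule g)
    have "carrier (C_hat G) = (\<Union>a\<in>carrier (Char_Q G). {Perm G #>\<^bsub>add_monoid (Char_Q G)\<^esub> a})"
      by (simp add: C_hat_def A_FactGroup_def FactGroup_def RCOSETS_def)
    moreover have "Perm G #>\<^bsub>add_monoid (Char_Q G)\<^esub> a = carrier (Char_Q G)" if "a \<in> carrier (Char_Q G)" for a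
      using g.coset_join2[of a "Perm G"] that A.a_subgroup eq by auto
    moreover have "carrier (Char_Q G) \<noteq> {}" using eq A.zero_closed by auto
    ultimately show ?thesis by auto
  qed
  then show ?thesis using C.trivial_group by auto
qed

section \<open>Integrality of multiplicities by traces of idempotents\<close>

lemma mat_trace_comm:
  assumes "X \<in> carrier_mat n n" "Y \<in> carrier_mat n n"
  shows "mat_trace (X * Y) = mat_trace (Y * X :: 'a :: comm_ring_1 mat)"
proof -
  have "mat_trace (X * Y) = (\<Sum>i<n. \<Sum>j<n. X $$ (i,j) * Y $$ (j,i))"
    using assms by (simp add: mat_trace_def scalar_prod_def atLeast0LessThan)
  also have "\<dots> = (\<Sum>i<n. \<Sum>j<n. Y $$ (i,j) * X $$ (j,i))"
    by (subst sum.swap) (simp add: mult.commute)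
  also have "\<dots> = mat_trace (Y * X)"
    using assms by (simp add: mat_trace_def scalar_prod_def atLeast0LessThan)
  finally show ?thesis .
qed

lemma similar_mat_trace:
  assumes "similar_mat_wit A B P Q"
  shows "mat_trace A = mat_trace (B :: 'a :: comm_ring_1 mat)"
proof -
  note w = similar_mat_witD[OF refl assms]
  have "mat_trace A = mat_trace (P * B * Q)" using w(3) by (rule arg_cong)
  also have "\<dots> = mat_trace (Q * (P * B))" by (rule mat_trace_comm[OF mult_carrier_mat[OF w(6) w(5)] w(7)])
  also have "Q * (P * B) = (Q * P) * B"
    by (rule assoc_mult_mat[symmetric, OF w(7) w(6) w(5)])
  also have "\<dots> = B" unfolding w(2) by (rule left_mult_one_mat[OF w(5)])
  finally show ?thesis .
qed

text \<open>After a Schur triangularisation every diagonal entry of an idempotent is itself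
  idempotent, hence 0 or 1, and the trace counts the ones.\<close>

lemma idempotent_mat_trace_Ints:
  fixes A :: "complex mat"
  assumes A: "A \<in> carrier_mat n n" and idem: "A * A = A"
  shows "mat_trace A \<in> \<int>"
proof -
  obtain as where as: "char_poly A = (\<Prod>a\<leftarrow>as. [:- a, 1:])" using char_poly_factorized[OF A] by auto
  obtain B where B: "B \<in> carrier_mat n n" "upper_triangular B" "similar_mat A B"
    using schur_decomposition_exists[OF A as] by auto
  then obtain P Q where w: "similar_mat_wit A B P Q" by (auto simp: similar_mat_def)
  note w' = similar_mat_witD2[OF B(1) similar_mat_wit_sym[OF w]]
  have BB: "B * B = B"
  proof -
    have "B * B = (Q * A * P) * (Q * A * P)" using w'(3) by simp
    also have "\<dots> = Q * A * (P * (Q * A * P))"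
      using w'(4-7) by (intro assoc_mult_mat[of _ n n _ n _ n]) auto
    also have "P * (Q * A * P) = P * (Q * (A * P))"
      using assoc_mult_mat[OF w'(6) w'(5) w'(7)] by simp
    also have "\<dots> = (P * Q) * (A * P)"
      using w'(4-7) by (intro assoc_mult_mat[of _ n n _ n _ n, symmetric]) auto
    also have "\<dots> = A * P" unfolding w'(2) using w'(4-7) by (intro left_mult_one_mat[of _ n n]) auto
    also have "Q * A * (A * P) = (Q * A * A) * P"
      using w'(4-7) by (intro assoc_mult_mat[of _ n n _ n _ n, symmetric]) auto
    also have "Q * A * A = Q * (A * A)"
      by (rule assoc_mult_mat[OF w'(6) w'(5) w'(5)])
    finally show ?thesis by (simp only: idem flip: w'(3))
  qed
  have diag: "B $$ (i, i) \<in> \<int>" if i: "i < n" for i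
  proof -
    have "B $$ (i, i) = (B * B) $$ (i, i)" using BB by simp
    also have "\<dots> = (\<Sum>j<n. B $$ (i, j) * B $$ (j, i))"
      using B(1) i by (simp add: scalar_prod_def atLeast0LessThan)
    \<comment> \<open>In a triangular \<open>B\<close> one of the entries at \<open>(i, j)\<close>
      and \<open>(j, i)\<close> vanishes unless \<open>j = i\<close>.\<close>
    also have "\<dots> = (\<Sum>j<n. if j = i then B $$ (i, i) * B $$ (i, i) else 0)"
    proof (rule sum.cong)
      fix j assume "j \<in> {..<n}"
      then show "B $$ (i, j) * B $$ (j, i) = (if j = i then B $$ (i, i) * B $$ (i, i) else 0)"
        using B(1,2) i upper_triangularD[OF B(2)] by (cases j i rule: linorder_cases) auto
    qed simp
    also have "\<dots> = B $$ (i, i) * B $$ (i, i)" using i by simp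
    finally have "B $$ (i, i) * (B $$ (i, i) - 1) = 0" by (simp add: algebra_simps)
    then have "B $$ (i, i) = 0 \<or> B $$ (i, i) = 1" by simp
    then show ?thesis by auto
  qed
  have "mat_trace B \<in> \<int>" using diag B(1) by (auto simp: mat_trace_def)
  then show ?thesis using similar_mat_trace[OF w] by simp
qed

lemma is_representationD:
  assumes "is_representation G n \<rho>" "x \<in> carrier G"
  shows "\<rho> x \<in> carrier_mat n n" "y \<in> carrier G \<Longrightarrow> \<rho> (x \<otimes>\<^bsub>G\<^esub> y) = \<rho> x * \<rho> y"
  using assms by (auto simp: is_representation_def hom_def Pi_def GL_carrier)
    (auto simp: GL_def units_of_def ring_mat_simps)

text \<open>The value 0 off the carrier makes equality of characters an equality of functions and
  keeps the set finite for a finite group.\<close>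

definition lchars :: "('x, 'm) monoid_scheme \<Rightarrow> ('x \<Rightarrow> complex) set" where
  "lchars X = {\<theta>. (\<forall>x. x \<notin> carrier X \<longrightarrow> \<theta> x = 0) \<and> \<theta> \<one>\<^bsub>X\<^esub> = 1
     \<and> (\<forall>x\<in>carrier X. \<forall>y\<in>carrier X. \<theta> (x \<otimes>\<^bsub>X\<^esub> y) = \<theta> x * \<theta> y)}"

context fin_group
begin

text \<open>The multiplicity of \<theta> in the restriction of \<rho> to \<open>H\<close> is the
  rank of a projection, hence the integral trace of an idempotent matrix.\<close>

lemma character_multiplicity_Ints:
  assumes H: "subgroup H G" and \<rho>: "is_representation G n \<rho>"
    and one: "\<theta> \<one> = 1" and mult: "\<And>x y. x \<in> H \<Longrightarrow> y \<in> H \<Longrightarrow> \<theta> (x \<otimes> y) = \<theta> x * \<theta> y"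
  shows "(\<Sum>x\<in>H. character G \<rho> x * \<theta> (inv x)) / of_nat (card H) \<in> \<int>"
proof -
  interpret H: subgroup H G by fact
  have HG: "x \<in> carrier G" if "x \<in> H" for x using that by (rule H.mem_carrier)
  have finH: "finite H" using finite_subset[OF H.subset fin] .
  have Hpos: "of_nat (card H) \<noteq> (0::complex)"
    using finH H.one_closed by (metis card_0_eq empty_iff of_nat_eq_0_iff)
  note rc = is_representationD(1)[OF \<rho> HG] and rm = is_representationD(2)[OF \<rho> HG HG]
  \<comment> \<open>Averaging over \<open>H\<close> with weights \<open>\<theta> (inv x)\<close>
    projects onto the subspace on which \<open>H\<close> acts through \<theta>.\<close>
  define P where "P = mat n n (\<lambda>(i,j). (\<Sum>x\<in>H. \<theta> (inv x) * \<rho> x $$ (i,j)) / of_nat (card H))"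
  have P: "P \<in> carrier_mat n n" by (simp add: P_def)
  have entry: "(\<Sum>l<n. \<rho> x $$ (i,l) * \<rho> y $$ (l,j)) = \<rho> (x \<otimes> y) $$ (i,j)"
    if "x \<in> H" "y \<in> H" "i < n" "j < n" for x y i j
    using that rm[OF that(1,2)] rc[OF that(1)] rc[OF that(2)]
    by (simp add: scalar_prod_def atLeast0LessThan)
  have idem: "P * P = P"
  proof (rule eq_matI)
    fix i j assume "i < dim_row P" "j < dim_col P"
    then have i: "i < n" and j: "j < n" using P by auto
    let ?c = "of_nat (card H) :: complex"
    have "(P * P) $$ (i,j) = (\<Sum>l<n. (\<Sum>x\<in>H. \<theta> (inv x) * \<rho> x $$ (i,l)) / ?c * ((\<Sum>y\<in>H. \<theta> (inv y) * \<rho> y $$ (l,j)) / ?c))"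
      using i j by (simp add: P_def scalar_prod_def atLeast0LessThan)
    also have "\<dots> = (\<Sum>l<n. (\<Sum>x\<in>H. \<theta> (inv x) * \<rho> x $$ (i,l)) * (\<Sum>y\<in>H. \<theta> (inv y) * \<rho> y $$ (l,j)) / ?c / ?c)"
      by simp
    also have "\<dots> = (\<Sum>l<n. (\<Sum>x\<in>H. \<theta> (inv x) * \<rho> x $$ (i,l)) * (\<Sum>y\<in>H. \<theta> (inv y) * \<rho> y $$ (l,j))) / ?c / ?c"
      by (simp only: sum_divide_distrib)
    also have "\<dots> = (\<Sum>l<n. \<Sum>x\<in>H. \<Sum>y\<in>H. \<theta> (inv x) * \<theta> (inv y) * (\<rho> x $$ (i,l) * \<rho> y $$ (l,j))) / ?c / ?c"
      unfolding sum_product by (simp add: mult.assoc mult.left_commute)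
    also have "(\<Sum>l<n. \<Sum>x\<in>H. \<Sum>y\<in>H. \<theta> (inv x) * \<theta> (inv y) * (\<rho> x $$ (i,l) * \<rho> y $$ (l,j)))
       = (\<Sum>x\<in>H. \<Sum>y\<in>H. \<theta> (inv x) * \<theta> (inv y) * (\<Sum>l<n. \<rho> x $$ (i,l) * \<rho> y $$ (l,j)))"
      by (subst sum.swap, rule sum.cong[OF refl], subst sum.swap) (simp add: sum_distrib_left)
    also have "\<dots> = (\<Sum>x\<in>H. \<Sum>y\<in>H. \<theta> (inv (x \<otimes> y)) * \<rho> (x \<otimes> y) $$ (i,j))"
    proof (intro sum.cong refl)
      fix x y assume xy: "x \<in> H" "y \<in> H"
      then have "\<theta> (inv (x \<otimes> y)) = \<theta> (inv y) * \<theta> (inv x)"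
        using HG by (simp add: inv_mult_group mult)
      then show "\<theta> (inv x) * \<theta> (inv y) * (\<Sum>l<n. \<rho> x $$ (i,l) * \<rho> y $$ (l,j)) = \<theta> (inv (x \<otimes> y)) * \<rho> (x \<otimes> y) $$ (i,j)"
        using entry[OF xy i j] by simp
    qed
    \<comment> \<open>Left translation by \<open>x\<close> permutes \<open>H\<close>, so the inner
      sum is the same for every \<open>x\<close>; the outer sum then supplies the factor
      \<open>card H\<close> that cancels one denominator.\<close>
    also have "\<dots> = (\<Sum>x\<in>H. \<Sum>y\<in>H. \<theta> (inv y) * \<rho> y $$ (i,j))"
    proof (rule sum.cong[OF refl])
      fix x assume x: "x \<in> H"
      show "(\<Sum>y\<in>H. \<theta> (inv (x \<otimes> y)) * \<rho> (x \<otimes> y) $$ (i,j)) = (\<Sum>y\<in>H. \<theta> (inv y) * \<rho> y $$ (i,j))"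
        by (rule sum.reindex_bij_witness[where i = "\<lambda>y. inv x \<otimes> y" and j = "\<lambda>y. x \<otimes> y"])
          (use x HG in \<open>auto simp: m_assoc[symmetric]\<close>)
    qed
    also have "\<dots> / ?c / ?c = P $$ (i,j)" using i j Hpos by (simp add: P_def)
    finally show "(P * P) $$ (i,j) = P $$ (i,j)" .
  qed (use P in auto)
  have "mat_trace P \<in> \<int>" by (rule idempotent_mat_trace_Ints[OF P idem])
  also have "mat_trace P = (\<Sum>i<n. \<Sum>x\<in>H. \<theta> (inv x) * \<rho> x $$ (i,i)) / of_nat (card H)"
    by (simp add: mat_trace_def P_def sum_divide_distrib)
  also have "(\<Sum>i<n. \<Sum>x\<in>H. \<theta> (inv x) * \<rho> x $$ (i,i)) = (\<Sum>x\<in>H. character G \<rho> x * \<theta> (inv x))"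
  proof (subst sum.swap, rule sum.cong[OF refl])
    fix x assume x: "x \<in> H"
    then show "(\<Sum>i<n. \<theta> (inv x) * \<rho> x $$ (i,i)) = character G \<rho> x * \<theta> (inv x)"
      using rc[OF x] HG[OF x] by (simp add: character_def mat_trace_def sum_distrib_left mult.commute)
  qed
  finally show ?thesis .
qed

lemma virt_multiplicity_Ints:
  assumes f: "virt G f" and H: "subgroup H G"
    and one: "\<theta> \<one> = 1" and mult: "\<And>x y. x \<in> H \<Longrightarrow> y \<in> H \<Longrightarrow> \<theta> (x \<otimes> y) = \<theta> x * \<theta> y"
  shows "(\<Sum>x\<in>H. f x * \<theta> (inv x)) / of_nat (card H) \<in> \<int>"
proof -
  have "(\<Sum>x\<in>H. f x * (\<theta> (inv x) / of_nat (card H))) \<in> \<int>"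
  proof (rule spanned_functional_Ints[OF characters_carrier _ _ f])
    show "H \<subseteq> carrier G" using H by (rule subgroup.subset)
    fix s assume "s \<in> characters G"
    then obtain n \<rho> where "s = character G \<rho>" "is_representation G n \<rho>" by (auto simp: characters_def)
    then show "(\<Sum>x\<in>H. s x * (\<theta> (inv x) / of_nat (card H))) \<in> \<int>"
      using character_multiplicity_Ints[OF H _ one mult] by (simp add: sum_divide_distrib)
  qed
  then show ?thesis by (simp add: sum_divide_distrib)
qed

lemma virt_conj:
  assumes f: "virt G f" and x: "x \<in> carrier G" and g: "g \<in> carrier G"
  shows "f (inv g \<otimes> x \<otimes> g) = f x"
proof -
  \<comment> \<open>Weights that write the difference of the two values as a sum over the carrier,
    the form in which integrality passes from characters to their span.\<close>
  define c where "c y = (if y = inv g \<otimes> x \<otimes> g then 1 else 0) - (if y = x then 1 else (0::complex))" for y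
  have ev: "(\<Sum>y\<in>carrier G. h y * c y) = h (inv g \<otimes> x \<otimes> g) - h x" for h
    proof -
    have "(\<Sum>y\<in>carrier G. h y * (if y = z then 1 else 0)) = h z" if "z \<in> carrier G" for z
      using that fin by (simp add: if_distrib cong: if_cong)
    from this[OF x] this[of "inv g \<otimes> x \<otimes> g"] show ?thesis
      using x g by (simp add: c_def right_diff_distrib sum_subtractf)
  qed
  have zero: "(\<Sum>y\<in>carrier G. s y * c y) = 0" if mem: "s \<in> characters G" for s
  proof -
    obtain n \<rho> where s: "s = character G \<rho>" "is_representation G n \<rho>"
      using mem unfolding characters_def by blast
    note rc = is_representationD(1)[OF s(2)] and rm = is_representationD(2)[OF s(2)]
    have r1: "\<rho> \<one> = 1\<^sub>m n"
    proof -
      interpret GLg: group "GL TYPE(complex) n" by (rule GL_group)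
      interpret group_hom G "GL TYPE(complex) n" \<rho>
        using s(2) is_group GLg.is_group by (auto simp: group_hom_def group_hom_axioms_def is_representation_def)
      show ?thesis using hom_one by (simp add: GL_def units_of_def ring_mat_simps)
    qed
    have "similar_mat_wit (\<rho> (inv g \<otimes> x \<otimes> g)) (\<rho> x) (\<rho> (inv g)) (\<rho> g)"
      using x g by (intro similar_mat_witI[of _ _ n] rc) (simp_all flip: rm r1)
    then show ?thesis unfolding ev s(1)
      using similar_mat_trace[of "\<rho> (inv g \<otimes> x \<otimes> g)" "\<rho> x"] x g by (simp add: character_def)
  qed
  txt \<open>An additive functional that is integral for every complex multiple vanishes.\<close>
  have half: "(\<Sum>y\<in>carrier G. f y * (t * c y)) \<in> \<int>" for t
    by (rule spanned_functional_Ints[OF characters_carrier order_refl _ f])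
      (use zero in \<open>simp add: mult.left_commute[of _ t] sum_distrib_left[symmetric]\<close>)
  have "t * (\<Sum>y\<in>carrier G. f y * c y) \<in> \<int>" for t
    using half[of t] by (simp add: mult.left_commute[of _ t] sum_distrib_left[symmetric])
  then have *: "t * (f (inv g \<otimes> x \<otimes> g) - f x) \<in> \<int>" for t using ev[of f] by simp
  show ?thesis
  proof (rule ccontr)
    assume "f (inv g \<otimes> x \<otimes> g) \<noteq> f x"
    \<comment> \<open>A nonzero difference could be scaled to 1/2, which is not an integer.\<close>
    then have "(1 / 2 / d * d :: complex) = 1 / 2" if "d = f (inv g \<otimes> x \<otimes> g) - f x" for d
      using that by simp
    then have "(1/2 :: complex) \<in> \<int>" using *[of "1 / 2 / (f (inv g \<otimes> x \<otimes> g) - f x)"] by metis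
    then obtain k :: int where "1/2 = (of_int k :: complex)" by (elim Ints_cases)
    then have "(of_int 1 :: complex) = of_int (2 * k)" by (simp add: field_simps)
    then have "1 = 2 * k" by (simp only: of_int_eq_iff)
    then show False by presburger
  qed
qed

text \<open>The coset of \<open>g\<close> is fixed by \<open>x\<close> exactly when
  \<open>inv g \<otimes> x \<otimes> g\<close> lies in \<open>H\<close>, and each fixed coset
  accounts for \<open>card H\<close> elements \<open>g\<close>.\<close>

lemma card_conj_fixed_cosets:
  assumes H: "subgroup H G" and x: "x \<in> carrier G"
  shows "card {g \<in> carrier G. inv g \<otimes> x \<otimes> g \<in> H} = card H * card {C \<in> lcosets H. x <# C = C}"
proof -
  interpret H: subgroup H G by fact
  have finH: "finite H" using finite_subset[OF H.subset fin] .
  let ?F = "{C \<in> lcosets H. x <# C = C}"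
  have fixed: "x <# (g <# H) = g <# H \<longleftrightarrow> inv g \<otimes> x \<otimes> g \<in> H" if g: "g \<in> carrier G" for g
  proof -
    have "x <# (g <# H) = (x \<otimes> g) <# H" using x g H.subset by (simp add: lcos_m_assoc)
    also have "(x \<otimes> g) <# H = g <# H \<longleftrightarrow> x \<otimes> g \<in> g <# H"
      using x g H lcos_self[of "x \<otimes> g" H] l_repr_independence[of "x \<otimes> g" g H] by auto
    also have "\<dots> \<longleftrightarrow> inv g \<otimes> x \<otimes> g \<in> H"
    proof
      assume "x \<otimes> g \<in> g <# H"
      then obtain h where h: "h \<in> H" "x \<otimes> g = g \<otimes> h" by (auto simp: l_coset_def)
      then have "inv g \<otimes> (x \<otimes> g) = h" using g by (simp add: inv_solve_left' m_assoc[symmetric])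
      then show "inv g \<otimes> x \<otimes> g \<in> H" using h x g by (simp add: m_assoc)
    next
      assume a: "inv g \<otimes> x \<otimes> g \<in> H"
      have "x \<otimes> g = g \<otimes> (inv g \<otimes> x \<otimes> g)" using x g by (simp add: m_assoc[symmetric])
      then show "x \<otimes> g \<in> g <# H" using a by (auto simp: l_coset_def)
    qed
    finally show ?thesis .
  qed
  have "{g \<in> carrier G. inv g \<otimes> x \<otimes> g \<in> H} = \<Union>?F"
  proof (intro equalityI subsetI)
    fix g assume g: "g \<in> {g \<in> carrier G. inv g \<otimes> x \<otimes> g \<in> H}"
    then have "g <# H \<in> ?F" using fixed[of g] by (auto simp: LCOSETS_def)
    moreover have "g \<in> g <# H" using g H by (simp add: lcos_self)
    ultimately show "g \<in> \<Union>?F" by blast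
  next
    fix g assume "g \<in> \<Union>?F"
    then obtain a where a: "a \<in> carrier G" "g \<in> a <# H" "x <# (a <# H) = a <# H"
      by (auto simp: LCOSETS_def)
    have gc: "g \<in> carrier G" using a l_coset_subset_G[OF H.subset] by auto
    have "a <# H = g <# H" using l_repr_independence[OF a(2) a(1) H] .
    then show "g \<in> {g \<in> carrier G. inv g \<otimes> x \<otimes> g \<in> H}" using fixed[OF gc] a gc by auto
  qed
  moreover have "card (\<Union>?F) = (\<Sum>C\<in>?F. card C)"
  proof (rule card_Union_disjoint)
    show "pairwise disjnt ?F"
      unfolding pairwise_def disjnt_def
    proof (intro ballI impI)
      fix C D assume "C \<in> ?F" "D \<in> ?F" "C \<noteq> D"
      then show "C \<inter> D = {}" using lcos_disjoint[OF H] by (auto simp: pairwise_def disjnt_def)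
    qed
    fix A assume "A \<in> ?F"
    then show "finite A" using l_coset_subset_G[OF H.subset] fin by (auto simp: LCOSETS_def intro: finite_subset)
  qed
  moreover have "card C = card H" if "C \<in> ?F" for C
    using that H.subset fin l_card_cosets_equal[of C H] by auto
  ultimately show ?thesis by simp
qed

text \<open>The trivial character of \<open>H\<close> induced to \<open>G\<close>, in averaged form.
  It frees the rest of the proof from enumerations \<open>e\<close> of cosets.\<close>

definition perm_char :: "'a set \<Rightarrow> 'a \<Rightarrow> complex" where
  "perm_char H x = of_nat (card {g \<in> carrier G. inv g \<otimes> x \<otimes> g \<in> H}) / of_nat (card H)"

lemma perm_perm_char:
  assumes H: "subgroup H G"
  shows "perm G (perm_char H)"
proof -
  interpret H: subgroup H G by fact
  have finH: "finite H" using finite_subset[OF H.subset fin] .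
  have Hpos: "card H \<noteq> 0" using finH H.one_closed by (metis card_0_eq empty_iff)
  let ?k = "card (lcosets H)"
  have finL: "finite (lcosets H)" using fin by (auto simp: LCOSETS_def)
  then obtain e where e: "bij_betw e {..<?k} (lcosets H)"
    using ex_bij_betw_nat_finite[OF finL] by (auto simp: atLeast0LessThan)
  define \<chi> where "\<chi> = character G (\<lambda>g. map_mat of_rat (coset_rep G H e g))"
  have mem: "\<chi> \<in> perm_characters G" using H e unfolding \<chi>_def perm_characters_def by blast
  have val: "\<chi> x = perm_char H x" if x: "x \<in> carrier G" for x
  proof -
    have "\<chi> x = (\<Sum>i<?k. if x <# e i = e i then 1 else 0)"
      using x by (simp add: \<chi>_def character_def mat_trace_def coset_rep_def Let_def if_distrib cong: if_cong)
    also have "\<dots> = (\<Sum>C\<in>lcosets H. if x <# C = C then 1 else 0)"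
      by (rule sum.reindex_bij_betw[OF e])
    also have "\<dots> = of_nat (card {C \<in> lcosets H. x <# C = C})"
      using finL by (simp add: sum.If_cases Int_def)
    also have "\<dots> = perm_char H x"
      using card_conj_fixed_cosets[OF H x] Hpos by (simp add: perm_char_def)
    finally show ?thesis .
  qed
  have "\<chi> \<in> int_span G (perm_characters G)" using mem unfolding int_span_def by (rule generate.incl)
  moreover have "restrict (perm_char H) (carrier G) = \<chi>"
    using val by (auto simp: \<chi>_def character_def fun_eq_iff restrict_def)
  ultimately show ?thesis by (simp add: spanned_def)
qed

lemma virt_perm_char: "subgroup H G \<Longrightarrow> virt G (perm_char H)"
  using perm_perm_char spanned_mono[OF perm_characters_characters[OF is_group]] by blast

end

section \<open>Characters of finite abelian groups\<close>

text \<open>With \<open>t\<close> the product of the primes of \<open>N\<close> that do not divide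
  \<open>k\<close>, each prime of \<open>N\<close> divides exactly one of \<open>k\<close> and
  \<open>D * t\<close>. This shift stands in for Dirichlet's theorem whenever an exponent has to be
  moved within its residue class.\<close>

lemma coprime_add_mult_exists:
  fixes k D N :: nat
  assumes "coprime k D" "N > 0"
  obtains t where "coprime (k + D * t) N"
proof -
  define t where "t = \<Prod>{l \<in> prime_factors N. \<not> l dvd k}"
  have fin: "finite {l \<in> prime_factors N. \<not> l dvd k}" by simp
  have "coprime (k + D * t) N"
  proof (rule ccontr)
    assume "\<not> coprime (k + D * t) N"
    then have "gcd (k + D * t) N \<noteq> 1" by (simp only: coprime_iff_gcd_eq_1 not_False_eq_True)
    then obtain l where "prime l" "l dvd gcd (k + D * t) N" using prime_factor_nat by blast
    then have l: "prime l" "l dvd k + D * t" "l dvd N" by auto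
    show False
    proof (cases "l dvd k")
      case True
      then have "l dvd D * t" using l(2) by (simp add: dvd_add_right_iff)
      moreover have "\<not> l dvd D" using True assms(1) l(1) by (metis coprime_common_divisor not_prime_unit)
      ultimately have "l dvd t" using l(1) by (simp add: prime_dvd_mult_iff)
      then obtain l' where l': "l' \<in> {l \<in> prime_factors N. \<not> l dvd k}" "l dvd l'"
        using prime_dvd_prod_iff[OF fin l(1), of id] by (auto simp: t_def)
      then have "l = l'" using l(1) by (auto intro: primes_dvd_imp_eq)
      then show False using l' True by auto
    next
      case False
      then have "l \<in> {l \<in> prime_factors N. \<not> l dvd k}"
        using l assms(2) by (auto simp: prime_factors_dvd)
      then have "l dvd t" unfolding t_def using fin by (auto intro: dvd_prodI[of _ _ id, simplified])
      then have "l dvd k" using l(2) by (metis dvd_add_left_iff dvd_mult)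
      then show False using False by simp
    qed
  qed
  then show ?thesis by (rule that)
qed

text \<open>Moebius inversion along inclusion that keeps integrality and avoids the Moebius
  function: a maximal member \<open>M\<close> enters the sum of no other member, so its value can be
  adjusted last.\<close>

lemma down_sums_exist:
  fixes A :: "'a set \<Rightarrow> complex"
  assumes "finite \<K>" "\<And>L. L \<in> \<K> \<Longrightarrow> A L \<in> \<int>"
  shows "\<exists>b. \<forall>L\<in>\<K>. b L \<in> \<int> \<and> A L = (\<Sum>K\<in>{K\<in>\<K>. K \<subseteq> L}. b K)"
  using assms
proof (induction "card \<K>" arbitrary: \<K>)
  case 0
  then show ?case by auto
next
  case (Suc n)
  then have "\<K> \<noteq> {}" by auto
  then obtain M where M: "M \<in> \<K>" "\<And>K. K \<in> \<K> \<Longrightarrow> M \<subseteq> K \<Longrightarrow> M = K"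
    using finite_has_maximal[OF Suc.prems(1)] by blast
  have "\<exists>b. \<forall>L\<in>\<K> - {M}. b L \<in> \<int> \<and> A L = (\<Sum>K\<in>{K\<in>\<K> - {M}. K \<subseteq> L}. b K)"
    using Suc M by (intro Suc.hyps(1)) auto
  then obtain b where b: "\<And>L. L \<in> \<K> - {M} \<Longrightarrow> b L \<in> \<int> \<and> A L = (\<Sum>K\<in>{K\<in>\<K> - {M}. K \<subseteq> L}. b K)"
    by blast
  define s where "s = (\<Sum>K\<in>{K\<in>\<K> - {M}. K \<subseteq> M}. b K)"
  have sZ: "s \<in> \<int>" unfolding s_def using b by (intro Ints_sum) auto
  let ?b = "b(M := A M - s)"
  have old: "(\<Sum>K\<in>{K\<in>\<K> - {M}. K \<subseteq> L}. ?b K) = (\<Sum>K\<in>{K\<in>\<K> - {M}. K \<subseteq> L}. b K)" for L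
    by (rule sum.cong) auto
  have "?b L \<in> \<int> \<and> A L = (\<Sum>K\<in>{K\<in>\<K>. K \<subseteq> L}. ?b K)" if L: "L \<in> \<K>" for L
  proof (cases "L = M")
    case True
    have "{K\<in>\<K>. K \<subseteq> M} = insert M {K\<in>\<K> - {M}. K \<subseteq> M}" using M by auto
    then have "(\<Sum>K\<in>{K\<in>\<K>. K \<subseteq> M}. ?b K) = (A M - s) + (\<Sum>K\<in>{K\<in>\<K> - {M}. K \<subseteq> M}. ?b K)"
      using Suc.prems(1) by simp
    then show ?thesis using True old[of M] sZ Suc.prems(2)[OF M(1)] by (simp add: s_def)
  next
    case False
    then have "{K\<in>\<K>. K \<subseteq> L} = {K\<in>\<K> - {M}. K \<subseteq> L}" using M L by auto
    then show ?thesis using b[of L] L False old[of L] by simp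
  qed
  then show ?case by blast
qed

text \<open>The values at strict subsets of \<open>L\<close> determine the rest of the sum.
  Uniqueness later carries a symmetry of the sums over to the summands.\<close>

lemma down_sums_unique:
  fixes b :: "'a set \<Rightarrow> complex"
  assumes "finite \<K>" and fins: "\<And>K. K \<in> \<K> \<Longrightarrow> finite K"
    and eq: "\<And>L. L \<in> \<K> \<Longrightarrow> (\<Sum>K\<in>{K\<in>\<K>. K \<subseteq> L}. b K) = (\<Sum>K\<in>{K\<in>\<K>. K \<subseteq> L}. c K)"
    and "L \<in> \<K>"
  shows "b L = c L"
  using \<open>L \<in> \<K>\<close>
proof (induction "card L" arbitrary: L rule: less_induct)
  case less
  have split: "{K\<in>\<K>. K \<subseteq> L} = insert L {K\<in>\<K>. K \<subset> L}" using less.prems by auto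
  have "(\<Sum>K\<in>{K\<in>\<K>. K \<subset> L}. b K) = (\<Sum>K\<in>{K\<in>\<K>. K \<subset> L}. c K)"
    using less fins by (intro sum.cong) (auto intro!: less.hyps psubset_card_mono)
  then show ?case using eq[OF less.prems] assms(1) unfolding split by simp
qed

context fin_group
begin

lemma order_pos: "Coset.order G > 0"
  using fin by (simp add: order_gt_0_iff_finite)

text \<open>In a finite group an inverse is a power, with exponent one less than the group
  order.\<close>

lemma submonoid_imp_subgroup:
  assumes H: "H \<subseteq> carrier G" "\<one> \<in> H" and mult: "\<And>x y. x \<in> H \<Longrightarrow> y \<in> H \<Longrightarrow> x \<otimes> y \<in> H"
  shows "subgroup H G"
proof (rule subgroupI[OF H(1)])
  fix a assume a: "a \<in> H"
  then have ac: "a \<in> carrier G" using H by auto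
  have pow: "a [^] (k::nat) \<in> H" for k using a H mult by (induction k) auto
  have "a [^] (Coset.order G - 1) \<otimes> a = \<one>"
    using ac order_pos pow_order_eq_1[OF ac] by (metis Suc_diff_1 nat_pow_Suc)
  then have "inv a = a [^] (Coset.order G - 1)" using ac by (intro inv_equality) auto
  then show "inv a \<in> H" using pow by simp
qed (use H mult in auto)

end

section \<open>Linear characters: extension, separation of points, Fourier inversion\<close>

locale fin_comm_group = fin_group G + comm_group G for G (structure)
begin

lemma lcharD:
  assumes "\<theta> \<in> lchars G"
  shows "\<theta> \<one> = 1" "x \<in> carrier G \<Longrightarrow> y \<in> carrier G \<Longrightarrow> \<theta> (x \<otimes> y) = \<theta> x * \<theta> y"
    "x \<notin> carrier G \<Longrightarrow> \<theta> x = 0"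
  using assms by (auto simp: lchars_def)

lemma lchar_pow: "\<theta> \<in> lchars G \<Longrightarrow> x \<in> carrier G \<Longrightarrow> \<theta> (x [^] (k::nat)) = \<theta> x ^ k"
  by (induction k) (auto simp: lcharD)

lemma lchar_order: "\<theta> \<in> lchars G \<Longrightarrow> x \<in> carrier G \<Longrightarrow> \<theta> x ^ Coset.order G = 1"
  using lchar_pow[of \<theta> x "Coset.order G"] by (simp add: pow_order_eq_1 lcharD)

lemma lchar_nonzero: "\<theta> \<in> lchars G \<Longrightarrow> x \<in> carrier G \<Longrightarrow> \<theta> x \<noteq> 0"
  using lchar_order[of \<theta> x] order_pos by (metis power_0_left not_gr_zero zero_neq_one)

lemma lchar_inv: "\<theta> \<in> lchars G \<Longrightarrow> x \<in> carrier G \<Longrightarrow> \<theta> (inv x) = inverse (\<theta> x)"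
  using lcharD(2)[of \<theta> x "inv x"] lcharD(1)[of \<theta>] by (simp add: inverse_unique)

lemma finite_lchars: "finite (lchars G)"
proof (rule finite_subset)
  show "lchars G \<subseteq> {\<theta>. \<forall>x. (x \<in> carrier G \<longrightarrow> \<theta> x \<in> {z. z ^ Coset.order G = 1}) \<and> (x \<notin> carrier G \<longrightarrow> \<theta> x = 0)}"
    using lchar_order by (auto simp: lcharD)
  show "finite {\<theta>. \<forall>x. (x \<in> carrier G \<longrightarrow> \<theta> x \<in> {z::complex. z ^ Coset.order G = 1}) \<and> (x \<notin> carrier G \<longrightarrow> \<theta> x = 0)}"
    using order_pos fin by (intro finite_set_of_finite_funs finite_roots_unity) auto
qed

lemma lchar_mult:
  "\<theta> \<in> lchars G \<Longrightarrow> \<mu> \<in> lchars G \<Longrightarrow> (\<lambda>x. \<theta> x * \<mu> x) \<in> lchars G"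
  by (auto simp: lchars_def)

lemma lchar_inverse: "\<theta> \<in> lchars G \<Longrightarrow> (\<lambda>x. inverse (\<theta> x)) \<in> lchars G"
  by (auto simp: lchars_def)

text \<open>The element \<open>g\<close> is adjoined with prescribed value \<open>c\<close>. As
  \<open>r\<close> is the least positive exponent with \<open>g [^] r \<in> H\<close>, every
  \<open>n\<close> with \<open>g [^] n \<in> H\<close> is a multiple of \<open>r\<close>; so the
  equation for \<open>c ^ r\<close> is the only constraint.\<close>

lemma extend_lchar_step:
  assumes H: "subgroup H G" and one: "\<theta> \<one> = 1"
    and mult: "\<And>x y. x \<in> H \<Longrightarrow> y \<in> H \<Longrightarrow> \<theta> (x \<otimes> y) = \<theta> x * \<theta> y"
    and g: "g \<in> carrier G" and r: "r > 0" "g [^] r \<in> H" "\<And>s. s < r \<Longrightarrow> g [^] s \<in> H \<Longrightarrow> s = 0"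
    and c: "c ^ r = \<theta> (g [^] (r::nat))"
  shows "\<exists>H' \<theta>'. subgroup H' G \<and> H \<subseteq> H' \<and> g \<in> H' \<and> (\<forall>x\<in>H. \<theta>' x = \<theta> x) \<and> \<theta>' g = (c::complex) \<and>
    (\<forall>x\<in>H'. \<forall>y\<in>H'. \<theta>' (x \<otimes> y) = \<theta>' x * \<theta>' y)"
proof -
  interpret H: subgroup H G by fact
  note HG = H.mem_carrier
  have gk: "g [^] (k::nat) \<in> carrier G" for k using g by simp
  have pow: "\<theta> (x [^] (q::nat)) = \<theta> x ^ q" if x: "x \<in> H" for x q
  proof (induction q)
    case (Suc q)
    have "x [^] q \<in> H" using x H.subgroup_axioms by (induction q) auto
    then show ?case using Suc x by (simp add: mult)
  qed (simp add: one)
  have key: "\<theta> (g [^] (n::nat)) = c ^ n" if "g [^] n \<in> H" for n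
  proof -
    define q s where "q = n div r" and "s = n mod r"
    have n: "n = r * q + s" by (simp add: q_def s_def)
    have rq: "(g [^] r) [^] q \<in> H" using r(2) by (induction q) auto
    have e: "g [^] n = (g [^] r) [^] q \<otimes> g [^] s"
      using g by (simp add: n nat_pow_mult[symmetric] nat_pow_pow)
    then have "g [^] s = inv ((g [^] r) [^] q) \<otimes> g [^] n"
      using gk rq HG by (simp add: inv_solve_left m_assoc[symmetric])
    then have "g [^] s \<in> H" using rq that by simp
    then have "s = 0" using r(1,3) by (simp add: s_def)
    then have "\<theta> (g [^] n) = \<theta> (g [^] r) ^ q" using e rq HG r(2) by (simp add: pow)
    then show ?thesis using c \<open>s = 0\<close> n by (simp add: power_mult)
  qed
  have wd1: "\<theta> h * c ^ i = \<theta> h' * c ^ j"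
    if h: "h \<in> H" "h' \<in> H" and eq: "h \<otimes> g [^] i = h' \<otimes> g [^] j" and ij: "i \<le> j" for h h' and i j :: nat
  proof -
    have "h' \<otimes> g [^] j = h' \<otimes> g [^] (j - i) \<otimes> g [^] i"
      using h HG gk g ij by (simp add: m_assoc nat_pow_mult)
    then have "h = h' \<otimes> g [^] (j - i)"
      using eq h HG gk by (metis m_closed right_cancel)
    moreover from this have "inv h' \<otimes> h = g [^] (j - i)"
      using h HG gk by (metis inv_solve_left)
    moreover have "inv h' \<otimes> h \<in> H" using h by simp
    ultimately have "\<theta> h = \<theta> h' * c ^ (j - i)" using h key by (metis mult)
    then show ?thesis using ij by (simp add: mult.assoc flip: power_add)
  qed
  have wd: "\<theta> h * c ^ i = \<theta> h' * c ^ j"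
    if "h \<in> H" "h' \<in> H" "h \<otimes> g [^] i = h' \<otimes> g [^] j" for h h' and i j :: nat
    using wd1[of h h' i j] wd1[of h' h j i] that by (cases "i \<le> j") auto
  define H' where "H' = {h \<otimes> g [^] (i::nat) |h i. h \<in> H}"
  \<comment> \<open>The value is read off from some way of writing \<open>y\<close> as
    \<open>h \<otimes> g [^] i\<close>, and \<open>wd\<close> makes all ways agree. Natural
    exponents suffice because the group is finite.\<close>
  define \<theta>' where "\<theta>' y = (SOME v. \<exists>h (i::nat). h \<in> H \<and> y = h \<otimes> g [^] i \<and> v = \<theta> h * c ^ i)" for y
  have val: "\<theta>' (h \<otimes> g [^] i) = \<theta> h * c ^ i" if "h \<in> H" for h and i :: nat
    unfolding \<theta>'_def
  proof (rule some_equality)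
    show "\<exists>h' (j::nat). h' \<in> H \<and> h \<otimes> g [^] i = h' \<otimes> g [^] j \<and> \<theta> h * c ^ i = \<theta> h' * c ^ j"
      using that by blast
  next
    fix v assume "\<exists>h' (j::nat). h' \<in> H \<and> h \<otimes> g [^] i = h' \<otimes> g [^] j \<and> v = \<theta> h' * c ^ j"
    then obtain h' and j :: nat where h': "h' \<in> H" "h \<otimes> g [^] i = h' \<otimes> g [^] j" "v = \<theta> h' * c ^ j"
      by blast
    show "v = \<theta> h * c ^ i" using wd[OF that h'(1,2)] h'(3) by simp
  qed
  have m': "(h \<otimes> g [^] i) \<otimes> (h' \<otimes> g [^] j) = (h \<otimes> h') \<otimes> g [^] (i + j)"
    if "h \<in> H" "h' \<in> H" for h h' and i j :: nat
  proof -
    have "g [^] (i + j) = g [^] i \<otimes> g [^] j" using g by (simp add: nat_pow_mult)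
    then show ?thesis using HG[OF that(1)] HG[OF that(2)] gk[of i] gk[of j] by (simp add: m_ac)
  qed
  show ?thesis
  proof (intro exI[of _ H'] exI[of _ \<theta>'] conjI ballI)
    show "subgroup H' G"
    proof (rule submonoid_imp_subgroup)
      show "H' \<subseteq> carrier G" using HG gk by (auto simp: H'_def)
      have "\<one> = \<one> \<otimes> g [^] (0::nat)" by simp
      then show "\<one> \<in> H'" unfolding H'_def using H.one_closed by blast
      show "x \<otimes> y \<in> H'" if xy: "x \<in> H'" "y \<in> H'" for x y
      proof -
        obtain h h' and i j :: nat where "h \<in> H" "x = h \<otimes> g [^] i" "h' \<in> H" "y = h' \<otimes> g [^] j"
          using xy unfolding H'_def by blast
        then have "x \<otimes> y = (h \<otimes> h') \<otimes> g [^] (i + j)" "h \<otimes> h' \<in> H" by (simp_all add: m')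
        then show ?thesis unfolding H'_def by blast
      qed
    qed
    have "x = x \<otimes> g [^] (0::nat)" if "x \<in> H" for x using HG[OF that] by simp
    then show "H \<subseteq> H'" unfolding H'_def by blast
    have "g = \<one> \<otimes> g [^] (1::nat)" using g by simp
    then show "g \<in> H'" unfolding H'_def using H.one_closed by blast
    show "\<theta>' x = \<theta> x" if "x \<in> H" for x using val[OF that, of 0] HG[OF that] by simp
    show "\<theta>' g = c" using val[OF H.one_closed, of 1] g one by simp
    show "\<theta>' (x \<otimes> y) = \<theta>' x * \<theta>' y" if xy: "x \<in> H'" "y \<in> H'" for x y
    proof -
      obtain h h' and i j :: nat where h: "h \<in> H" "x = h \<otimes> g [^] i" "h' \<in> H" "y = h' \<otimes> g [^] j"
        using xy unfolding H'_def by blast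
      then have "x \<otimes> y = (h \<otimes> h') \<otimes> g [^] (i + j)" "h \<otimes> h' \<in> H" by (simp_all add: m')
      then show ?thesis using h val[of "h \<otimes> h'" "i + j"] by (simp add: val mult power_add)
    qed
  qed
qed

lemma complex_root_exists:
  assumes "n > (0::nat)" obtains c :: complex where "c ^ n = a"
proof -
  have "(rcis (root n (cmod a)) (Arg a / n)) ^ n = a"
    using assms by (simp add: DeMoivre2 rcis_cmod_Arg)
  then show ?thesis by (rule that)
qed

lemma least_power:
  assumes H: "subgroup H G" and g: "g \<in> carrier G"
  obtains r :: nat where "r > 0" "g [^] r \<in> H" "\<And>s. s < r \<Longrightarrow> g [^] s \<in> H \<Longrightarrow> s = 0"
proof -
  let ?P = "\<lambda>r::nat. r > 0 \<and> g [^] r \<in> H"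
  have "?P (Coset.order G)" using g order_pos subgroup.one_closed[OF H] by (simp add: pow_order_eq_1)
  then have "?P (Least ?P)" by (rule LeastI)
  moreover have "s = 0" if "s < Least ?P" "g [^] s \<in> H" for s using not_less_Least[OF that(1)] that(2) by auto
  ultimately show ?thesis using that by blast
qed

text \<open>Each step adjoins one element outside \<open>H\<close>, and the root it requires exists
  in the complex numbers; the index of the subgroup shrinks until the whole group is
  reached.\<close>

lemma extend_lchar:
  assumes "subgroup H G" and "\<theta> \<one> = 1"
    and "\<And>x y. x \<in> H \<Longrightarrow> y \<in> H \<Longrightarrow> \<theta> (x \<otimes> y) = \<theta> x * \<theta> y"
  shows "\<exists>\<theta>'\<in>lchars G. \<forall>x\<in>H. \<theta>' x = \<theta> x"
  using assms
proof (induction "Coset.order G - card H" arbitrary: H \<theta> rule: less_induct)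
  case less
  have HG: "H \<subseteq> carrier G" using less.prems(1) by (rule subgroup.subset)
  show ?case
  proof (cases "H = carrier G")
    case True
    then show ?thesis using less.prems
      by (intro bexI[of _ "\<lambda>x. if x \<in> carrier G then \<theta> x else 0"]) (auto simp: lchars_def)
  next
    case False
    then obtain g where g: "g \<in> carrier G" "g \<notin> H" using HG by auto
    obtain r :: nat where r: "r > 0" "g [^] r \<in> H" "\<And>s. s < r \<Longrightarrow> g [^] s \<in> H \<Longrightarrow> s = 0"
      by (rule least_power[OF less.prems(1) g(1)], rule that)
    obtain c where c: "c ^ r = \<theta> (g [^] r)" by (rule complex_root_exists[OF r(1)])
    obtain H' \<theta>' where H': "subgroup H' G" "H \<subseteq> H'" "g \<in> H'" "\<And>x. x \<in> H \<Longrightarrow> \<theta>' x = \<theta> x"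
      "\<theta>' g = c" "\<And>x y. x \<in> H' \<Longrightarrow> y \<in> H' \<Longrightarrow> \<theta>' (x \<otimes> y) = \<theta>' x * \<theta>' y"
      using extend_lchar_step[OF less.prems g(1) r c] by blast
    have sub: "H' \<subseteq> carrier G" using H'(1) by (rule subgroup.subset)
    have "card H < card H'" using H'(2,3) g(2) finite_subset[OF sub fin] by (intro psubset_card_mono) auto
    moreover have "card H' \<le> Coset.order G" unfolding Coset.order_def using sub fin by (rule card_mono[rotated])
    ultimately have *: "\<exists>\<theta>''\<in>lchars G. \<forall>x\<in>H'. \<theta>'' x = \<theta>' x"
      using H'(1,4,6) less.prems(2) subgroup.one_closed[OF less.prems(1)] by (intro less.hyps) auto
    show ?thesis
    proof (rule bexE[OF *])
      fix \<mu> assume "\<mu> \<in> lchars G" "\<forall>x\<in>H'. \<mu> x = \<theta>' x"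
      then show ?thesis using H'(2,4) by (intro bexI[of _ \<mu>]) auto
    qed
  qed
qed

text \<open>Over the trivial subgroup \<open>r\<close> is the order of \<open>x\<close>, hence at
  least 2, so a root of unity other than 1 can be prescribed at \<open>x\<close> before
  extending.\<close>

lemma lchars_separate:
  assumes x: "x \<in> carrier G" "x \<noteq> \<one>"
  obtains \<theta> where "\<theta> \<in> lchars G" "\<theta> x \<noteq> 1"
proof -
  have T: "subgroup {\<one>} G" by (rule triv_subgroup)
  obtain r :: nat where r: "r > 0" "x [^] r \<in> {\<one>}" "\<And>s. s < r \<Longrightarrow> x [^] s \<in> {\<one>} \<Longrightarrow> s = 0"
    by (rule least_power[OF T x(1)], rule that)
  have "r \<noteq> 1" using r(2) x by auto
  then have "card {z::complex. z ^ r = 1} > 1" using r(1) by (simp add: card_roots_unity_eq)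
  then have "\<not> {z::complex. z ^ r = 1} \<subseteq> {1}"
    by (metis card_mono card.empty card.insert empty_iff finite.emptyI finite_insert One_nat_def not_less)
  then obtain c :: complex where c: "c ^ r = 1" "c \<noteq> 1" by blast
  have "\<exists>H' \<theta>'. subgroup H' G \<and> {\<one>} \<subseteq> H' \<and> x \<in> H' \<and> (\<forall>x\<in>{\<one>}. \<theta>' x = 1) \<and> \<theta>' x = c \<and>
      (\<forall>x\<in>H'. \<forall>y\<in>H'. \<theta>' (x \<otimes> y) = \<theta>' x * \<theta>' y)"
    by (rule extend_lchar_step[OF T _ _ x(1) r, of "\<lambda>_. 1" c]) (use c(1) in auto)
  then obtain H' \<theta>' where "subgroup H' G \<and> {\<one>} \<subseteq> H' \<and> x \<in> H' \<and> (\<forall>x\<in>{\<one>}. \<theta>' x = 1) \<and> \<theta>' x = c \<and>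
      (\<forall>x\<in>H'. \<forall>y\<in>H'. \<theta>' (x \<otimes> y) = \<theta>' x * \<theta>' y)"
    by (elim exE) (rule that)
  then have H': "subgroup H' G" "x \<in> H'" "\<theta>' \<one> = 1" "\<theta>' x = c"
      "\<And>x y. x \<in> H' \<Longrightarrow> y \<in> H' \<Longrightarrow> \<theta>' (x \<otimes> y) = \<theta>' x * \<theta>' y"
    by simp_all
  have "\<exists>\<theta>\<in>lchars G. \<forall>y\<in>H'. \<theta> y = \<theta>' y" by (rule extend_lchar[OF H'(1,3,5)])
  then obtain \<theta> where "\<theta> \<in> lchars G" "\<forall>y\<in>H'. \<theta> y = \<theta>' y" by blast
  then show ?thesis using that[of \<theta>] H'(2,4) c(2) by auto
qed

lemma sum_lchar:
  assumes \<theta>: "\<theta> \<in> lchars G"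
  shows "(\<Sum>x\<in>carrier G. \<theta> x) = (if \<forall>x\<in>carrier G. \<theta> x = 1 then of_nat (Coset.order G) else 0)"
proof (cases "\<forall>x\<in>carrier G. \<theta> x = 1")
  case True
  then show ?thesis by (simp add: Coset.order_def)
next
  case False
  then obtain y where y: "y \<in> carrier G" "\<theta> y \<noteq> 1" by auto
  have "\<theta> y * (\<Sum>x\<in>carrier G. \<theta> x) = (\<Sum>x\<in>carrier G. \<theta> (y \<otimes> x))"
    using y \<theta> by (simp add: sum_distrib_left lcharD)
  also have "\<dots> = (\<Sum>x\<in>carrier G. \<theta> x)"
    by (rule sum.reindex_bij_witness[where i = "\<lambda>x. inv y \<otimes> x" and j = "\<lambda>x. y \<otimes> x"])
      (use y in \<open>auto simp: m_assoc[symmetric]\<close>)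
  finally have "(\<theta> y - 1) * (\<Sum>x\<in>carrier G. \<theta> x) = 0" by (simp add: algebra_simps)
  then have "(\<Sum>x\<in>carrier G. \<theta> x) = 0" using y by simp
  then show ?thesis using False by (simp only: if_False)
qed

lemma sum_over_lchars:
  assumes x: "x \<in> carrier G"
  shows "(\<Sum>\<theta>\<in>lchars G. \<theta> x) = (if x = \<one> then of_nat (card (lchars G)) else 0)"
proof (cases "x = \<one>")
  case True
  then show ?thesis by (simp add: lcharD)
next
  case False
  then obtain \<mu> where \<mu>: "\<mu> \<in> lchars G" "\<mu> x \<noteq> 1" using lchars_separate[OF x] by blast
  have "\<mu> x * (\<Sum>\<theta>\<in>lchars G. \<theta> x) = (\<Sum>\<theta>\<in>lchars G. \<mu> x * \<theta> x)" by (simp add: sum_distrib_left)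
  also have "\<dots> = (\<Sum>\<theta>\<in>lchars G. \<theta> x)"
  proof (rule sum.reindex_bij_witness[where i = "\<lambda>\<theta> x. inverse (\<mu> x) * \<theta> x" and j = "\<lambda>\<theta> x. \<mu> x * \<theta> x"])
    fix \<theta> assume \<theta>: "\<theta> \<in> lchars G"
    have nz: "\<mu> y = 0 \<Longrightarrow> \<theta> y = 0" for y
      using lchar_nonzero[OF \<mu>(1)] lcharD(3)[OF \<theta>] by auto
    show "(\<lambda>x. inverse (\<mu> x) * (\<mu> x * \<theta> x)) = \<theta>" "(\<lambda>x. \<mu> x * (inverse (\<mu> x) * \<theta> x)) = \<theta>"
      using nz by (auto simp: fun_eq_iff field_simps)
    show "(\<lambda>x. \<mu> x * \<theta> x) \<in> lchars G" "(\<lambda>x. inverse (\<mu> x) * \<theta> x) \<in> lchars G"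
      using \<theta> \<mu> by (auto intro: lchar_mult lchar_inverse)
  qed simp
  finally show ?thesis using False \<mu>(2) by (simp add: mult_cancel_right1[symmetric] algebra_simps)
qed

lemma trivial_lchar: "(\<lambda>x. if x \<in> carrier G then 1 else 0) \<in> lchars G"
  by (auto simp: lchars_def)

text \<open>The values \<open>\<theta> x\<close> are summed over all pairs in both orders: in one
  order only \<open>\<one>\<close> contributes, in the other only the trivial character.\<close>

lemma card_lchars: "card (lchars G) = Coset.order G"
proof -
  have "of_nat (card (lchars G)) = (\<Sum>x\<in>carrier G. \<Sum>\<theta>\<in>lchars G. \<theta> x)"
    using fin by (simp add: sum_over_lchars)
  also have "\<dots> = (\<Sum>\<theta>\<in>lchars G. if \<theta> = (\<lambda>x. if x \<in> carrier G then 1 else 0) then of_nat (Coset.order G) else 0)"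
  proof (subst sum.swap, rule sum.cong[OF refl])
    fix \<theta> assume \<theta>: "\<theta> \<in> lchars G"
    then have "(\<forall>x\<in>carrier G. \<theta> x = 1) \<longleftrightarrow> \<theta> = (\<lambda>x. if x \<in> carrier G then 1 else 0)"
      by (auto simp: fun_eq_iff lcharD)
    then show "(\<Sum>x\<in>carrier G. \<theta> x) = (if \<theta> = (\<lambda>x. if x \<in> carrier G then 1 else 0) then of_nat (Coset.order G) else 0)"
      by (simp only: sum_lchar[OF \<theta>])
  qed
  also have "\<dots> = (of_nat (Coset.order G) :: complex)"
    using finite_lchars trivial_lchar by simp
  finally show ?thesis by (simp only: of_nat_eq_iff)
qed

text \<open>The inner product of \<phi> with \<theta>, where \<open>\<theta> (inv x)\<close> plays
  the complex conjugate. For the restriction of a virtual character it is a multiplicity.\<close>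

definition fourier :: "('a \<Rightarrow> complex) \<Rightarrow> ('a \<Rightarrow> complex) \<Rightarrow> complex" where
  "fourier \<phi> \<theta> = (\<Sum>x\<in>carrier G. \<phi> x * \<theta> (inv x)) / of_nat (Coset.order G)"

lemma fourier_inversion:
  assumes x: "x \<in> carrier G"
  shows "\<phi> x = (\<Sum>\<theta>\<in>lchars G. fourier \<phi> \<theta> * \<theta> x)"
proof -
  have "(\<Sum>\<theta>\<in>lchars G. fourier \<phi> \<theta> * \<theta> x)
      = (\<Sum>\<theta>\<in>lchars G. \<Sum>y\<in>carrier G. \<phi> y * \<theta> (inv y \<otimes> x)) / of_nat (Coset.order G)"
    using x by (simp add: fourier_def sum_divide_distrib sum_distrib_right lcharD mult.assoc)
  also have "(\<Sum>\<theta>\<in>lchars G. \<Sum>y\<in>carrier G. \<phi> y * \<theta> (inv y \<otimes> x))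
      = (\<Sum>y\<in>carrier G. \<phi> y * (\<Sum>\<theta>\<in>lchars G. \<theta> (inv y \<otimes> x)))"
    by (subst sum.swap) (simp add: sum_distrib_left)
  also have "\<dots> = (\<Sum>y\<in>carrier G. if y = x then \<phi> x * of_nat (Coset.order G) else 0)"
  proof (rule sum.cong[OF refl])
    fix y assume y: "y \<in> carrier G"
    have "inv y \<otimes> x = \<one> \<longleftrightarrow> y = x" using x y by (metis inv_equality inv_inv l_inv inv_closed)
    then show "\<phi> y * (\<Sum>\<theta>\<in>lchars G. \<theta> (inv y \<otimes> x)) = (if y = x then \<phi> x * of_nat (Coset.order G) else 0)"
      using x y by (simp add: sum_over_lchars card_lchars)
  qed
  also have "\<dots> / of_nat (Coset.order G) = \<phi> x" using x fin order_pos by simp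
  finally show ?thesis by simp
qed


end

section \<open>Characters with a common kernel and the decomposition of rational functions\<close>

context fin_comm_group
begin

definition ker :: "('a \<Rightarrow> complex) \<Rightarrow> 'a set" where
  "ker \<theta> = {x \<in> carrier G. \<theta> x = 1}"

text \<open>The case distinction matters for \<open>k = 0\<close>, where the bare power would be 1
  off the carrier and fall outside \<open>lchars G\<close>.\<close>

definition pow_lchar :: "('a \<Rightarrow> complex) \<Rightarrow> nat \<Rightarrow> 'a \<Rightarrow> complex" where
  "pow_lchar \<theta> k = (\<lambda>x. if x \<in> carrier G then \<theta> x ^ k else 0)"

lemma subgroup_ker: "\<theta> \<in> lchars G \<Longrightarrow> subgroup (ker \<theta>) G"
  by (rule submonoid_imp_subgroup) (auto simp: ker_def lcharD)

lemma pow_lchar: "\<theta> \<in> lchars G \<Longrightarrow> pow_lchar \<theta> k \<in> lchars G"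
  by (auto simp: lchars_def pow_lchar_def power_mult_distrib)

lemma finite_pow_lchars: "\<theta> \<in> lchars G \<Longrightarrow> finite (range (pow_lchar \<theta>))"
  by (rule finite_subset[OF _ finite_lchars]) (auto intro: pow_lchar)

text \<open>Multiplication by \<theta> permutes its powers, so the sum at \<open>x\<close> is
  unchanged by the factor \<open>\<theta> x\<close> and vanishes unless that factor is 1.\<close>

lemma sum_pow_lchars:
  assumes \<theta>: "\<theta> \<in> lchars G" and x: "x \<in> carrier G"
  shows "(\<Sum>\<mu>\<in>range (pow_lchar \<theta>). \<mu> x) = (if x \<in> ker \<theta> then of_nat (card (range (pow_lchar \<theta>))) else 0)"
proof (cases "x \<in> ker \<theta>")
  case True
  then have "\<mu> x = 1" if "\<mu> \<in> range (pow_lchar \<theta>)" for \<mu>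
    using that by (auto simp: ker_def pow_lchar_def)
  then have "(\<Sum>\<mu>\<in>range (pow_lchar \<theta>). \<mu> x) = (\<Sum>\<mu>\<in>range (pow_lchar \<theta>). 1)"
    by (intro sum.cong) simp_all
  then show ?thesis using True by simp
next
  case False
  define s where "s \<mu> = (\<lambda>y. \<theta> y * \<mu> y)" for \<mu>
  have s: "s (pow_lchar \<theta> k) = pow_lchar \<theta> (Suc k)" for k
    using \<theta> by (auto simp: s_def pow_lchar_def)
  have inj: "inj_on s (range (pow_lchar \<theta>))"
  proof (rule inj_onI)
    fix \<mu> \<nu> assume "\<mu> \<in> range (pow_lchar \<theta>)" "\<nu> \<in> range (pow_lchar \<theta>)" and eq: "s \<mu> = s \<nu>"
    then have lc: "\<mu> \<in> lchars G" "\<nu> \<in> lchars G" using pow_lchar[OF \<theta>] by auto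
    show "\<mu> = \<nu>"
    proof
      fix y
      show "\<mu> y = \<nu> y"
      proof (cases "y \<in> carrier G")
        case True
        have "\<theta> y * \<mu> y = \<theta> y * \<nu> y" using fun_cong[OF eq, of y] by (simp add: s_def)
        then show ?thesis using lchar_nonzero[OF \<theta> True] by simp
      qed (simp add: lcharD(3)[OF lc(1)] lcharD(3)[OF lc(2)])
    qed
  qed
  have "s ` range (pow_lchar \<theta>) \<subseteq> range (pow_lchar \<theta>)" using s by auto
  then have im: "s ` range (pow_lchar \<theta>) = range (pow_lchar \<theta>)"
    using inj finite_pow_lchars[OF \<theta>] by (simp add: endo_inj_surj)
  have "\<theta> x * (\<Sum>\<mu>\<in>range (pow_lchar \<theta>). \<mu> x) = (\<Sum>\<mu>\<in>range (pow_lchar \<theta>). s \<mu> x)"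
    by (simp add: sum_distrib_left s_def)
  also have "\<dots> = (\<Sum>\<mu>\<in>s ` range (pow_lchar \<theta>). \<mu> x)" using inj by (simp add: sum.reindex)
  also have "\<dots> = (\<Sum>\<mu>\<in>range (pow_lchar \<theta>). \<mu> x)" by (simp only: im)
  finally have "(\<theta> x - 1) * (\<Sum>\<mu>\<in>range (pow_lchar \<theta>). \<mu> x) = 0" by (simp add: algebra_simps)
  moreover have "\<theta> x \<noteq> 1" using False x by (simp add: ker_def)
  ultimately have "(\<Sum>\<mu>\<in>range (pow_lchar \<theta>). \<mu> x) = 0" by simp
  then show ?thesis using False by (simp only: if_False)
qed

lemma lchar_orthogonal:
  assumes "\<mu> \<in> lchars G" "\<nu> \<in> lchars G"
  shows "(\<Sum>x\<in>carrier G. \<mu> x * \<nu> (inv x)) = (if \<mu> = \<nu> then of_nat (Coset.order G) else 0)"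
proof -
  have "(\<Sum>x\<in>carrier G. \<mu> x * \<nu> (inv x)) = (\<Sum>x\<in>carrier G. \<mu> x * inverse (\<nu> x))"
    using assms by (intro sum.cong) (auto simp: lchar_inv)
  also have "\<dots> = (if \<forall>x\<in>carrier G. \<mu> x * inverse (\<nu> x) = 1 then of_nat (Coset.order G) else 0)"
    using sum_lchar[OF lchar_mult[OF assms(1) lchar_inverse[OF assms(2)]]] .
  also have "(\<forall>x\<in>carrier G. \<mu> x * inverse (\<nu> x) = 1) \<longleftrightarrow> \<mu> = \<nu>"
  proof
    assume a: "\<forall>x\<in>carrier G. \<mu> x * inverse (\<nu> x) = 1"
    show "\<mu> = \<nu>"
    proof
      fix x show "\<mu> x = \<nu> x"
        using a lchar_nonzero[OF assms(2), of x] lcharD(3)[OF assms(1), of x] lcharD(3)[OF assms(2), of x]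
        by (cases "x \<in> carrier G") (auto simp: field_simps)
    qed
  qed (use lchar_nonzero[OF assms(2)] in auto)
  finally show ?thesis .
qed

text \<open>The dual of the cyclic quotient by \<open>ker \<theta>\<close> is generated by \<theta>.
  If \<mu> were no power of \<theta>, it would be orthogonal to the sum of all powers; but that sum
  lives on \<open>ker \<theta>\<close>, where \<mu> is 1, so the pairing is positive.\<close>

lemma lchars_above_ker:
  assumes \<theta>: "\<theta> \<in> lchars G"
  shows "{\<mu> \<in> lchars G. ker \<theta> \<subseteq> ker \<mu>} = range (pow_lchar \<theta>)"
proof (intro equalityI subsetI)
  fix \<mu> assume "\<mu> \<in> range (pow_lchar \<theta>)"
  then show "\<mu> \<in> {\<mu> \<in> lchars G. ker \<theta> \<subseteq> ker \<mu>}"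
    using pow_lchar[OF \<theta>] by (auto simp: ker_def pow_lchar_def)
next
  fix \<mu> assume "\<mu> \<in> {\<mu> \<in> lchars G. ker \<theta> \<subseteq> ker \<mu>}"
  then have \<mu>: "\<mu> \<in> lchars G" "ker \<theta> \<subseteq> ker \<mu>" by auto
  let ?C = "range (pow_lchar \<theta>)"
  have sub: "ker \<theta> \<subseteq> carrier G" by (auto simp: ker_def)
  have one: "\<one> \<in> ker \<theta>" using \<theta> by (simp add: ker_def lcharD)
  show "\<mu> \<in> ?C"
  proof (rule ccontr)
    assume n: "\<mu> \<notin> ?C"
    have "(\<Sum>\<nu>\<in>?C. \<Sum>x\<in>carrier G. \<nu> x * \<mu> (inv x)) = 0"
      using n pow_lchar[OF \<theta>] \<mu>(1) by (intro sum.neutral) (auto simp: lchar_orthogonal)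
    also have "(\<Sum>\<nu>\<in>?C. \<Sum>x\<in>carrier G. \<nu> x * \<mu> (inv x)) = (\<Sum>x\<in>carrier G. (\<Sum>\<nu>\<in>?C. \<nu> x) * \<mu> (inv x))"
      by (subst sum.swap) (simp only: sum_distrib_right)
    also have "\<dots> = (\<Sum>x\<in>carrier G. if x \<in> ker \<theta> then of_nat (card ?C) else 0)"
    proof (rule sum.cong[OF refl])
      fix x assume x: "x \<in> carrier G"
      show "(\<Sum>\<nu>\<in>?C. \<nu> x) * \<mu> (inv x) = (if x \<in> ker \<theta> then of_nat (card ?C) else 0)"
        unfolding sum_pow_lchars[OF \<theta> x] using \<mu> x by (auto simp: lchar_inv ker_def)
    qed
    also have "\<dots> = of_nat (card (ker \<theta>)) * of_nat (card ?C)"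
      using fin sub by (simp add: sum.If_cases Int_absorb1)
    finally have "card (ker \<theta>) = 0 \<or> card ?C = 0" by (simp only: mult_eq_0_iff of_nat_eq_0_iff)
    then show False using finite_pow_lchars[OF \<theta>] finite_subset[OF sub fin] one by auto
  qed
qed

lemma card_pow_lchars:
  assumes \<theta>: "\<theta> \<in> lchars G"
  shows "card (range (pow_lchar \<theta>)) * card (ker \<theta>) = Coset.order G"
proof -
  let ?C = "range (pow_lchar \<theta>)"
  have sub: "ker \<theta> \<subseteq> carrier G" by (auto simp: ker_def)
  let ?one = "pow_lchar \<theta> 0"
  have one: "?one \<in> lchars G" by (rule pow_lchar[OF \<theta>])
  have "of_nat (card ?C * card (ker \<theta>)) = (\<Sum>x\<in>carrier G. if x \<in> ker \<theta> then of_nat (card ?C) else (0::complex))"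
    using fin sub by (simp add: sum.If_cases Int_absorb1)
  also have "\<dots> = (\<Sum>x\<in>carrier G. \<Sum>\<mu>\<in>?C. \<mu> x)"
    by (rule sum.cong[OF refl]) (simp only: sum_pow_lchars[OF \<theta>])
  also have "\<dots> = (\<Sum>\<mu>\<in>?C. \<Sum>x\<in>carrier G. \<mu> x * ?one (inv x))"
    by (subst sum.swap) (simp add: pow_lchar_def)
  also have "\<dots> = (\<Sum>\<mu>\<in>?C. if \<mu> = ?one then of_nat (Coset.order G) else 0)"
    using pow_lchar[OF \<theta>] one by (intro sum.cong) (auto simp: lchar_orthogonal)
  also have "\<dots> = of_nat (Coset.order G)"
    using finite_pow_lchars[OF \<theta>] by (simp add: sum.delta)
  finally show ?thesis by (simp only: of_nat_eq_iff)
qed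

text \<open>The right-hand side is the permutation character of the abelian group on its quotient by
  \<open>ker \<theta>\<close>. This is the place where sums of linear characters turn into
  permutation characters.\<close>

lemma sum_lchars_above:
  assumes \<theta>: "\<theta> \<in> lchars G" and x: "x \<in> carrier G"
  shows "(\<Sum>\<mu>\<in>{\<mu> \<in> lchars G. ker \<theta> \<subseteq> ker \<mu>}. \<mu> x)
    = (if x \<in> ker \<theta> then of_nat (Coset.order G) / of_nat (card (ker \<theta>)) else 0)"
proof -
  have "card (ker \<theta>) \<noteq> 0" using card_pow_lchars[OF \<theta>] order_pos by (metis mult_0_right not_gr_zero)
  then have "of_nat (Coset.order G) / of_nat (card (ker \<theta>)) = (of_nat (card (range (pow_lchar \<theta>))) :: complex)"
    using card_pow_lchars[OF \<theta>] by (simp add: field_simps flip: of_nat_mult)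
  then show ?thesis unfolding lchars_above_ker[OF \<theta>] sum_pow_lchars[OF \<theta> x] by simp
qed

lemma pow_bij:
  assumes "coprime k (Coset.order G)"
  shows "bij_betw (\<lambda>x. x [^] (k::nat)) (carrier G) (carrier G)"
proof -
  obtain l where l: "[k * l = 1] (mod Coset.order G)" using cong_solve_coprime_nat[OF assms] by auto
  have "(x [^] k) [^] l = x" if x: "x \<in> carrier G" for x
  proof -
    have "(x [^] k) [^] l = x [^] (k * l)" using x by (simp add: nat_pow_pow)
    also have "\<dots> = x [^] (k * l mod Coset.order G)"
      using x by (metis nat_pow_mult nat_pow_pow pow_order_eq_1 nat_pow_one div_mult_mod_eq mult.commute l_one nat_pow_closed)
    also have "k * l mod Coset.order G = 1 mod Coset.order G" using l by (simp add: cong_def)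
    also have "x [^] \<dots> = x"
      using x pow_order_eq_1[OF x] by (cases "Coset.order G = 1") (auto simp: mod_less order_pos)
    finally show ?thesis .
  qed
  then have "inj_on (\<lambda>x. x [^] k) (carrier G)" by (intro inj_on_inverseI[of _ "\<lambda>x. x [^] l"]) auto
  then show ?thesis using fin by (simp add: bij_betw_def endo_inj_surj image_subset_iff)
qed

text \<open>Substituting \<open>x [^] k\<close> for \<open>x\<close> in the sum moves the power from
  the argument to the character and leaves \<phi> unchanged.\<close>

lemma fourier_pow_lchar:
  assumes \<theta>: "\<theta> \<in> lchars G" and k: "coprime k (Coset.order G)"
    and inv: "\<And>x. x \<in> carrier G \<Longrightarrow> \<phi> (x [^] k) = \<phi> x"
  shows "fourier \<phi> (pow_lchar \<theta> k) = fourier \<phi> \<theta>"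
proof -
  have "(\<Sum>x\<in>carrier G. \<phi> x * pow_lchar \<theta> k (inv x)) = (\<Sum>x\<in>carrier G. \<phi> (x [^] k) * \<theta> (inv (x [^] k)))"
    using \<theta> inv by (intro sum.cong) (auto simp: pow_lchar_def lchar_pow nat_pow_inv[symmetric])
  also have "\<dots> = (\<Sum>x\<in>carrier G. \<phi> x * \<theta> (inv x))"
    by (rule sum.reindex_bij_betw[OF pow_bij[OF k]])
  finally show ?thesis by (simp add: fourier_def)
qed

text \<open>Characters with equal kernels are powers of one another, so
  \<open>fourier_pow_lchar\<close> applies once the exponent is made prime to \<open>N\<close>. The
  modulus \<open>N\<close> is kept separate from the group order because invariance of \<phi> will
  be known only for exponents prime to the order of an ambient group.\<close>

lemma fourier_ker_cong:
  assumes \<theta>: "\<theta> \<in> lchars G" and \<theta>': "\<theta>' \<in> lchars G" and ker: "ker \<theta> = ker \<theta>'"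
    and N: "N > 0" "Coset.order G dvd N"
    and inv: "\<And>k x. coprime k N \<Longrightarrow> x \<in> carrier G \<Longrightarrow> \<phi> (x [^] (k::nat)) = \<phi> x"
  shows "fourier \<phi> \<theta> = fourier \<phi> \<theta>'"
proof -
  have period: "pow_lchar \<mu> (k + Coset.order G) = pow_lchar \<mu> k" if "\<mu> \<in> lchars G" for \<mu> k
    using lchar_order[OF that] by (auto simp: pow_lchar_def power_add)
  have "\<theta>' \<in> range (pow_lchar \<theta>)" "\<theta> \<in> range (pow_lchar \<theta>')"
    using lchars_above_ker[OF \<theta>] lchars_above_ker[OF \<theta>'] \<theta> \<theta>' ker by auto
  then obtain k0 l0 where kl0: "\<theta>' = pow_lchar \<theta> k0" "\<theta> = pow_lchar \<theta>' l0" by auto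
  \<comment> \<open>A full period is added to make both exponents positive, so that
    \<open>k * l - 1\<close> is a genuine difference of natural numbers.\<close>
  define k l where "k = k0 + Coset.order G" and "l = l0 + Coset.order G"
  have kl: "\<theta>' = pow_lchar \<theta> k" "\<theta> = pow_lchar \<theta>' l" and pos: "k > 0" "l > 0"
    using kl0 period[OF \<theta>] period[OF \<theta>'] order_pos by (auto simp: k_def l_def)
  have "coprime k (k * l - 1)"
  proof (rule coprimeI)
    fix c assume c: "c dvd k" "c dvd k * l - 1"
    have "k * l = (k * l - 1) + 1" using pos by simp
    moreover have "c dvd k * l" using c(1) by simp
    ultimately have "c dvd 1" using c(2) by (metis dvd_add_right_iff)
    then show "is_unit c" .
  qed
  then obtain t where t: "coprime (k + (k * l - 1) * t) N" using coprime_add_mult_exists N(1) by blast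
  \<comment> \<open>Raising to the \<open>k\<close>-th and then to the \<open>l\<close>-th power
    returns \<theta>. Hence \<open>k * l - 1\<close> is a period of the exponents, and shifting
    \<open>k\<close> by its multiples does not change the power of \<theta>.\<close>
  have triv: "\<theta> x ^ (k * l - 1) = 1" if x: "x \<in> carrier G" for x
  proof -
    have "\<theta> x = \<theta>' x ^ l" using fun_cong[OF kl(2), of x] x by (simp add: pow_lchar_def)
    also have "\<theta>' x = \<theta> x ^ k" using fun_cong[OF kl(1), of x] x by (simp add: pow_lchar_def)
    also have "(\<theta> x ^ k) ^ l = \<theta> x ^ (k * l - 1) * \<theta> x"
      using pos by (metis Suc_diff_1 mult_pos_pos power_Suc2 power_mult)
    finally show ?thesis using lchar_nonzero[OF \<theta> x] by simp
  qed
  have "pow_lchar \<theta> (k + (k * l - 1) * t) = \<theta>'"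
    using triv by (subst kl(1)) (auto simp: pow_lchar_def power_add power_mult fun_eq_iff)
  moreover have "coprime (k + (k * l - 1) * t) (Coset.order G)" using t N(2) by (metis coprime_divisors dvd_refl)
  ultimately show ?thesis using fourier_pow_lchar[where \<phi> = \<phi> and k = "k + (k * l - 1) * t", OF \<theta>] inv[OF t] by simp
qed

abbreviation kers :: "'a set set" where "kers \<equiv> ker ` lchars G"

lemma finite_kers: "finite kers"
  using finite_lchars by simp

lemma subgroup_kers: "K \<in> kers \<Longrightarrow> subgroup K G"
  using subgroup_ker by auto

text \<open>The coefficients of \<phi> depend only on kernels, and inversion along inclusion
  regroups them into permutation characters on quotients by kernels. The last conclusion prepares
  the pairing of subgroups by the involution of a torus.\<close>

theorem rational_decomposition:
  assumes int: "\<And>\<theta>. \<theta> \<in> lchars G \<Longrightarrow> fourier \<phi> \<theta> \<in> \<int>"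
    and N: "N > 0" "Coset.order G dvd N"
    and inv: "\<And>k x. coprime k N \<Longrightarrow> x \<in> carrier G \<Longrightarrow> \<phi> (x [^] (k::nat)) = \<phi> x"
  obtains b where "\<And>K. K \<in> kers \<Longrightarrow> b K \<in> \<int>"
    "\<And>x. x \<in> carrier G \<Longrightarrow> \<phi> x = (\<Sum>K\<in>kers. b K * (if x \<in> K then of_nat (Coset.order G) / of_nat (card K) else 0))"
    "\<And>w K. w \<in> hom G G \<Longrightarrow> (\<And>x. x \<in> carrier G \<Longrightarrow> w (w x) = x \<and> \<phi> (w x) = \<phi> x) \<Longrightarrow> K \<in> kers
       \<Longrightarrow> w ` K \<in> kers \<and> b (w ` K) = b K"
proof -
  define A where "A K = fourier \<phi> (SOME \<theta>. \<theta> \<in> lchars G \<and> ker \<theta> = K)" for K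
  have A: "A (ker \<theta>) = fourier \<phi> \<theta>" if \<theta>: "\<theta> \<in> lchars G" for \<theta>
  proof -
    have "(SOME \<mu>. \<mu> \<in> lchars G \<and> ker \<mu> = ker \<theta>) \<in> lchars G \<and> ker (SOME \<mu>. \<mu> \<in> lchars G \<and> ker \<mu> = ker \<theta>) = ker \<theta>"
      by (rule someI[of _ \<theta>]) (simp add: \<theta>)
    then show ?thesis unfolding A_def using \<theta> fourier_ker_cong[OF _ \<theta> _ N inv] by blast
  qed
  have "\<exists>b. \<forall>L\<in>kers. b L \<in> \<int> \<and> A L = (\<Sum>K\<in>{K\<in>kers. K \<subseteq> L}. b K)"
    by (rule down_sums_exist[OF finite_kers]) (use A int in auto)
  then obtain b where b: "\<And>L. L \<in> kers \<Longrightarrow> b L \<in> \<int>" "\<And>L. L \<in> kers \<Longrightarrow> A L = (\<Sum>K\<in>{K\<in>kers. K \<subseteq> L}. b K)"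
    by blast
  show ?thesis
  proof (rule that[of b])
    show "b K \<in> \<int>" if "K \<in> kers" for K using b(1)[OF that] .
    fix x assume x: "x \<in> carrier G"
    have "\<phi> x = (\<Sum>\<theta>\<in>lchars G. A (ker \<theta>) * \<theta> x)" using fourier_inversion[OF x, of \<phi>] A by simp
    also have "\<dots> = (\<Sum>\<theta>\<in>lchars G. \<Sum>K\<in>{K\<in>kers. K \<subseteq> ker \<theta>}. b K * \<theta> x)"
      by (intro sum.cong) (simp_all add: b(2) sum_distrib_right)
    \<comment> \<open>After the exchange the inner sum runs over all characters trivial on
      \<open>K\<close>, not only over those with kernel \<open>K\<close>; this is the sum with a
      closed form.\<close>
    also have "\<dots> = (\<Sum>K\<in>kers. \<Sum>\<theta>\<in>{\<theta>\<in>lchars G. K \<subseteq> ker \<theta>}. b K * \<theta> x)"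
      by (rule sum.swap_restrict[OF finite_lchars finite_kers])
    also have "\<dots> = (\<Sum>K\<in>kers. b K * (if x \<in> K then of_nat (Coset.order G) / of_nat (card K) else 0))"
    proof (rule sum.cong[OF refl])
      fix K assume "K \<in> kers"
      then obtain \<theta> where \<theta>: "\<theta> \<in> lchars G" "K = ker \<theta>" by auto
      show "(\<Sum>\<theta>\<in>{\<theta>\<in>lchars G. K \<subseteq> ker \<theta>}. b K * \<theta> x) = b K * (if x \<in> K then of_nat (Coset.order G) / of_nat (card K) else 0)"
        unfolding \<theta>(2) sum_distrib_left[symmetric] sum_lchars_above[OF \<theta>(1) x] ..
    qed
    finally show "\<phi> x = (\<Sum>K\<in>kers. b K * (if x \<in> K then of_nat (Coset.order G) / of_nat (card K) else 0))" .
  next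
    fix w K assume w: "w \<in> hom G G" "\<And>x. x \<in> carrier G \<Longrightarrow> w (w x) = x \<and> \<phi> (w x) = \<phi> x" and K: "K \<in> kers"
    have wc: "w x \<in> carrier G" if "x \<in> carrier G" for x using w(1) that by (rule hom_in_carrier)
    interpret w: group_hom G G w using w(1) is_group by (simp add: group_hom_def group_hom_axioms_def)
    \<comment> \<open>Pulling characters back along \<open>w\<close> maps kernels to their images
      and preserves the coefficients of \<phi>.\<close>
    define T where "T \<theta> = (\<lambda>x. if x \<in> carrier G then \<theta> (w x) else 0)" for \<theta> :: "'a \<Rightarrow> complex"
    have T: "T \<theta> \<in> lchars G" if "\<theta> \<in> lchars G" for \<theta>
      using that wc by (auto simp: T_def lchars_def)
    have kT: "ker (T \<theta>) = w ` ker \<theta>" if "\<theta> \<in> lchars G" for \<theta>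
    proof (intro equalityI subsetI)
      fix x assume "x \<in> ker (T \<theta>)"
      then have "x \<in> carrier G" "w x \<in> ker \<theta>" using wc by (auto simp: ker_def T_def)
      then show "x \<in> w ` ker \<theta>" using w(2) by (metis imageI)
    qed (use wc w(2) in \<open>auto simp: ker_def T_def\<close>)
    have fT: "fourier \<phi> (T \<theta>) = fourier \<phi> \<theta>" if "\<theta> \<in> lchars G" for \<theta>
    proof -
      have "(\<Sum>x\<in>carrier G. \<phi> x * T \<theta> (inv x)) = (\<Sum>x\<in>carrier G. \<phi> x * \<theta> (inv x))"
        by (rule sum.reindex_bij_witness[where i = w and j = w]) (use w(2) wc in \<open>auto simp: T_def\<close>)
      then show ?thesis by (simp add: fourier_def)
    qed
    have wK: "w ` L \<in> kers" if "L \<in> kers" for L using that T kT by (metis (no_types, lifting) image_iff)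
    have ww: "w ` w ` L = L" if "L \<in> kers" for L
    proof -
      have "L \<subseteq> carrier G" using that by (auto simp: ker_def)
      then have "w ` w ` L = (\<lambda>x. x) ` L" unfolding image_image using w(2) by (intro image_cong) auto
      then show ?thesis by simp
    qed
    have Aw: "A (w ` L) = A L" if L: "L \<in> kers" for L
    proof -
      obtain \<theta> where \<theta>: "\<theta> \<in> lchars G" "L = ker \<theta>" using L by auto
      then have "A (w ` L) = fourier \<phi> (T \<theta>)" using A[OF T[OF \<theta>(1)]] kT[OF \<theta>(1)] by simp
      then show ?thesis using fT[OF \<theta>(1)] A[OF \<theta>(1)] \<theta>(2) by simp
    qed
    \<comment> \<open>Transporting \<open>b\<close> along \<open>w\<close> gives another solution of
      the same down-sum equations, so the two agree.\<close>
    have "b K = b (w ` K)"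
    proof (rule down_sums_unique[OF finite_kers _ _ K])
      show "finite L" if "L \<in> kers" for L using that fin by (auto simp: ker_def)
      fix L assume L: "L \<in> kers"
      have "(\<Sum>K\<in>{K\<in>kers. K \<subseteq> L}. b (w ` K)) = (\<Sum>K\<in>{K\<in>kers. K \<subseteq> w ` L}. b K)"
      proof (rule sum.reindex_bij_witness[where i = "image w" and j = "image w"])
        fix K assume K: "K \<in> {K \<in> kers. K \<subseteq> L}"
        show "w ` w ` K = K" using K ww by simp
        show "w ` K \<in> {K \<in> kers. K \<subseteq> w ` L}" using K wK by auto
      next
        fix K assume K: "K \<in> {K \<in> kers. K \<subseteq> w ` L}"
        show "w ` w ` K = K" using K ww by simp
        have "w ` K \<subseteq> w ` w ` L" using K by blast
        then show "w ` K \<in> {K \<in> kers. K \<subseteq> L}" using K wK ww[OF L] by simp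
      qed simp
      also have "\<dots> = (\<Sum>K\<in>{K\<in>kers. K \<subseteq> L}. b K)" using b(2)[OF wK[OF L]] b(2)[OF L] Aw[OF L] by simp
      finally show "(\<Sum>K\<in>{K\<in>kers. K \<subseteq> L}. b K) = (\<Sum>K\<in>{K\<in>kers. K \<subseteq> L}. b (w ` K))" by simp
    qed
    then show "w ` K \<in> kers \<and> b (w ` K) = b K" using wK[OF K] by simp
  qed
qed

end

section \<open>Rational-valued virtual characters\<close>

text \<open>
  The ring \<open>\<int>[\<zeta>]\<close> for \<open>\<zeta> = cis (2 * pi / d)\<close>, in the guise of those \<open>y\<close> for which the vector of
  powers of \<open>\<zeta>\<close> is an eigenvector of some integer matrix; such \<open>y\<close> are algebraic integers.
\<close>

definition cyclo_int :: "nat \<Rightarrow> complex set" where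
  "cyclo_int d = {y. \<exists>M :: nat \<Rightarrow> nat \<Rightarrow> int. \<forall>i<d.
     y * cis (2 * pi / d) ^ i = (\<Sum>k<d. of_int (M i k) * cis (2 * pi / d) ^ k)}"

lemma cyclo_int_add:
  assumes "y \<in> cyclo_int d" "z \<in> cyclo_int d"
  shows "y + z \<in> cyclo_int d"
proof -
  obtain M N :: "nat \<Rightarrow> nat \<Rightarrow> int"
    where "\<forall>i<d. y * cis (2 * pi / d) ^ i = (\<Sum>k<d. of_int (M i k) * cis (2 * pi / d) ^ k)"
      "\<forall>i<d. z * cis (2 * pi / d) ^ i = (\<Sum>k<d. of_int (N i k) * cis (2 * pi / d) ^ k)"
    using assms unfolding cyclo_int_def by blast
  then have "\<forall>i<d. (y + z) * cis (2 * pi / d) ^ i = (\<Sum>k<d. of_int (M i k + N i k) * cis (2 * pi / d) ^ k)"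
    by (simp add: distrib_right sum.distrib)
  then show ?thesis unfolding cyclo_int_def by (intro CollectI exI[of _ "\<lambda>i k. M i k + N i k"])
qed

text \<open>The vector of powers is a common eigenvector, so the product of the two matrices
  witnesses the product of the two numbers.\<close>

lemma cyclo_int_mult:
  assumes "y \<in> cyclo_int d" "z \<in> cyclo_int d"
  shows "y * z \<in> cyclo_int d"
proof -
  let ?z = "cis (2 * pi / d)"
  obtain M N :: "nat \<Rightarrow> nat \<Rightarrow> int"
    where M: "\<And>i. i < d \<Longrightarrow> y * ?z ^ i = (\<Sum>k<d. of_int (M i k) * ?z ^ k)"
      and N: "\<And>i. i < d \<Longrightarrow> z * ?z ^ i = (\<Sum>k<d. of_int (N i k) * ?z ^ k)"
    using assms unfolding cyclo_int_def by blast
  have "(y * z) * ?z ^ i = (\<Sum>k<d. of_int (\<Sum>j<d. M i j * N j k) * ?z ^ k)" if i: "i < d" for i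
  proof -
    have "(y * z) * ?z ^ i = (y * ?z ^ i) * z" by simp
    also have "\<dots> = (\<Sum>j<d. of_int (M i j) * (z * ?z ^ j))"
      unfolding M[OF i] sum_distrib_right by (simp add: mult_ac)
    also have "\<dots> = (\<Sum>j<d. \<Sum>k<d. of_int (M i j) * (of_int (N j k) * ?z ^ k))"
      by (simp add: N sum_distrib_left)
    also have "\<dots> = (\<Sum>k<d. of_int (\<Sum>j<d. M i j * N j k) * ?z ^ k)"
      by (subst sum.swap) (simp add: sum_distrib_right mult.assoc)
    finally show ?thesis .
  qed
  then show ?thesis unfolding cyclo_int_def
    by (intro CollectI exI[of _ "\<lambda>i k. \<Sum>j<d. M i j * N j k"]) blast
qed

lemma cyclo_int_of_int: "of_int c \<in> cyclo_int d"
proof -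
  have "of_int c * cis (2 * pi / d) ^ i = (\<Sum>k<d. of_int (if k = i then c else 0) * cis (2 * pi / d) ^ k)"
    if "i < d" for i using that by (simp add: if_distrib[of of_int] if_distrib[of "\<lambda>x. x * _"] cong: if_cong)
  then show ?thesis unfolding cyclo_int_def
    by (intro CollectI exI[of _ "\<lambda>i k. if k = i then c else 0"]) blast
qed

lemma cyclo_int_0: "0 \<in> cyclo_int d" and cyclo_int_1: "1 \<in> cyclo_int d"
  using cyclo_int_of_int[of 0 d] cyclo_int_of_int[of 1 d] by simp_all

lemma cyclo_int_power: "y \<in> cyclo_int d \<Longrightarrow> y ^ k \<in> cyclo_int d"
  by (induction k) (auto intro: cyclo_int_1 cyclo_int_mult)

lemma cyclo_int_sum: "(\<And>i. i \<in> I \<Longrightarrow> f i \<in> cyclo_int d) \<Longrightarrow> sum f I \<in> cyclo_int d"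
  by (induction I rule: infinite_finite_induct) (auto intro: cyclo_int_0 cyclo_int_add)

text \<open>The generator is witnessed by the matrix of the cyclic shift \<open>Suc i mod d\<close>;
  every other root is one of its powers.\<close>

lemma root_unity_cyclo_int:
  assumes "z ^ d = 1" "d > 0"
  shows "z \<in> cyclo_int d"
proof -
  let ?z = "cis (2 * pi / d)"
  have z1: "?z ^ d = 1" using assms(2) by (simp add: DeMoivre)
  have "?z * ?z ^ i = (\<Sum>k<d. of_int (if k = Suc i mod d then 1 else 0) * ?z ^ k)" if "i < d" for i
  proof -
    have "(\<Sum>k<d. of_int (if k = Suc i mod d then 1 else 0) * ?z ^ k) = ?z ^ (Suc i mod d)"
      using assms(2) by (simp add: if_distrib[of of_int] if_distrib[of "\<lambda>x. x * _"] cong: if_cong)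
    also have "\<dots> = ?z ^ Suc i"
      using that z1 by (cases "Suc i = d") auto
    finally show ?thesis by simp
  qed
  then have gen: "?z \<in> cyclo_int d" unfolding cyclo_int_def
    by (intro CollectI exI[of _ "\<lambda>i k. if k = Suc i mod d then 1 else 0"]) blast
  have "z \<in> (\<lambda>k. cis (2 * pi * real k / real d)) ` {..<d}"
    using bij_betw_roots_unity[OF assms(2)] assms(1) by (auto simp: bij_betw_def)
  then obtain k where "z = cis (2 * pi * real k / real d)" by auto
  then have "z = ?z ^ k" by (simp add: DeMoivre mult_ac)
  then show ?thesis using cyclo_int_power[OF gen] by simp
qed

text \<open>The defining equations make \<open>y\<close> an eigenvalue of an integer matrix, hence a
  root of a monic integral polynomial, and rational algebraic integers are integers. The eigenvector
  is nonzero because its entry at 0 is 1.\<close>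

lemma rational_cyclo_int:
  assumes y: "y \<in> cyclo_int d" "y \<in> \<rat>" and d: "d > 0"
  shows "y \<in> \<int>"
proof -
  let ?z = "cis (2 * pi / d)"
  obtain M :: "nat \<Rightarrow> nat \<Rightarrow> int"
    where M: "\<And>i. i < d \<Longrightarrow> y * ?z ^ i = (\<Sum>k<d. of_int (M i k) * ?z ^ k)"
    using y(1) unfolding cyclo_int_def by blast
  define A where "A = mat d d (\<lambda>(i,k). M i k)"
  let ?A = "map_mat of_int A :: complex mat"
  let ?v = "vec d (\<lambda>i. ?z ^ i)"
  have A: "A \<in> carrier_mat d d" by (simp add: A_def)
  have "?A *\<^sub>v ?v = y \<cdot>\<^sub>v ?v"
    by (rule eq_vecI) (simp_all add: A_def scalar_prod_def atLeast0LessThan M)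
  moreover have "?v \<noteq> 0\<^sub>v d"
  proof
    assume "?v = 0\<^sub>v d"
    then have "?v $ 0 = 0\<^sub>v d $ 0" by simp
    then show False using d by simp
  qed
  ultimately have "eigenvalue ?A y"
    unfolding eigenvalue_def eigenvector_def using A by (intro exI[of _ ?v]) auto
  then have "poly (char_poly ?A) y = 0" using A by (subst (asm) eigenvalue_root_char_poly[of _ d]) auto
  then have "poly (map_poly of_int (char_poly A)) y = 0"
    by (simp only: of_int_hom.char_poly_hom[OF A])
  moreover have "lead_coeff (char_poly A) = 1" using degree_monic_char_poly[OF A] by simp
  ultimately have "algebraic_int y" unfolding algebraic_int_altdef_ipoly by blast
  then show ?thesis using y(2) by (rule rational_algebraic_int_is_int)
qed

text \<open>The inner binomial coefficients are divisible by \<open>p\<close>. Congruence modulo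
  \<open>p\<close> in this ring is carried by an explicit quotient \<open>w\<close>.\<close>

lemma cyclo_int_freshman:
  assumes p: "prime p" and x: "x \<in> cyclo_int d" and y: "y \<in> cyclo_int d"
  shows "\<exists>w\<in>cyclo_int d. (x + y) ^ p = x ^ p + y ^ p + of_nat p * w"
proof -
  have p2: "p > 1" using p by (rule prime_gt_1_nat)
  let ?t = "\<lambda>k. of_nat ((p choose k) div p) * x ^ k * y ^ (p - k)"
  have "(x + y) ^ p = (\<Sum>k\<le>p. of_nat (p choose k) * x ^ k * y ^ (p - k))" by (rule binomial_ring)
  also have "{..p} = insert 0 (insert p {0<..<p})" using p2 by auto
  also have "(\<Sum>k\<in>insert 0 (insert p {0<..<p}). of_nat (p choose k) * x ^ k * y ^ (p - k))
     = y ^ p + x ^ p + (\<Sum>k\<in>{0<..<p}. of_nat (p choose k) * x ^ k * y ^ (p - k))"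
    using p2 by simp
  also have "(\<Sum>k\<in>{0<..<p}. of_nat (p choose k) * x ^ k * y ^ (p - k)) = (\<Sum>k\<in>{0<..<p}. of_nat p * ?t k)"
  proof (rule sum.cong[OF refl])
    fix k assume k: "k \<in> {0<..<p}"
    have "p dvd (p choose k)" by (rule dvd_choose_prime) (use k p in auto)
    then have "of_nat (p choose k) = (of_nat p * of_nat ((p choose k) div p) :: complex)"
      by (metis dvd_mult_div_cancel of_nat_mult)
    then show "of_nat (p choose k) * x ^ k * y ^ (p - k) = of_nat p * ?t k" by (simp add: mult.assoc)
  qed
  also have "\<dots> = of_nat p * (\<Sum>k\<in>{0<..<p}. ?t k)" by (simp add: sum_distrib_left)
  finally have "(x + y) ^ p = x ^ p + y ^ p + of_nat p * (\<Sum>k\<in>{0<..<p}. ?t k)" by simp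
  moreover have "(\<Sum>k\<in>{0<..<p}. ?t k) \<in> cyclo_int d"
    using cyclo_int_of_int[of "int _" d] x y
    by (intro cyclo_int_sum cyclo_int_mult cyclo_int_power) auto
  ultimately show ?thesis by blast
qed

lemma int_power_prime_cong:
  assumes "prime p" shows "[a ^ p = a] (mod int p)"
proof -
  define n where "n = nat (a mod int p)"
  have p0: "p > 0" using assms by (rule prime_gt_0_nat)
  have an: "[a = int n] (mod int p)" using p0 by (simp add: n_def cong_def)
  have "[n ^ p = n] (mod p)"
  proof (cases "p dvd n")
    case True
    then have "p dvd n ^ p" using p0 by (simp add: dvd_power_iff_le dvd_trans[OF _ dvd_power])
    then show ?thesis using True by (simp add: cong_def mod_eq_0_iff_dvd[symmetric])
  next
    case False
    then have "[n * n ^ (p - 1) = n * 1] (mod p)" using fermat_theorem[OF assms] by (intro cong_mult cong_refl)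
    then show ?thesis using p0 by (metis mult.right_neutral power_eq_if not_gr_zero)
  qed
  then have "[int n ^ p = int n] (mod int p)" by (metis cong_int_iff of_nat_power)
  then show ?thesis using an by (meson cong_pow cong_sym cong_trans)
qed

text \<open>The \<open>p\<close>-th power is additive modulo \<open>p\<close> and, by Fermat, fixes
  the integral coefficients; only the \<open>z i\<close> get raised.\<close>

lemma cyclo_int_sum_power:
  assumes p: "prime p" and "finite I"
    and z: "\<And>i. i \<in> I \<Longrightarrow> z i \<in> cyclo_int d" and a: "\<And>i. i \<in> I \<Longrightarrow> a i \<in> \<int>"
  shows "\<exists>w\<in>cyclo_int d. (\<Sum>i\<in>I. a i * z i) ^ p = (\<Sum>i\<in>I. a i * z i ^ p) + of_nat p * w"
  using \<open>finite I\<close> z a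
proof (induction I rule: finite_induct)
  case empty
  have "p > 0" using p by (rule prime_gt_0_nat)
  then show ?case by (intro bexI[of _ 0]) (auto simp: cyclo_int_0)
next
  case (insert j I)
  let ?s = "\<Sum>i\<in>I. a i * z i"
  have aO: "a i \<in> cyclo_int d" if "i \<in> insert j I" for i
    using insert.prems(2)[OF that] by (auto elim!: Ints_cases intro: cyclo_int_of_int)
  have sO: "?s \<in> cyclo_int d" using insert.prems(1) aO by (intro cyclo_int_sum cyclo_int_mult) auto
  obtain w1 where w1: "w1 \<in> cyclo_int d" "?s ^ p = (\<Sum>i\<in>I. a i * z i ^ p) + of_nat p * w1"
    using insert by auto
  obtain w2 where w2: "w2 \<in> cyclo_int d" "(a j * z j + ?s) ^ p = (a j * z j) ^ p + ?s ^ p + of_nat p * w2"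
    using cyclo_int_freshman[OF p cyclo_int_mult[OF aO insert.prems(1)] sO] by auto
  obtain c :: int where c: "a j = of_int c" using insert.prems(2)[of j] by (auto elim: Ints_cases)
  have "int p dvd c ^ p - c" using int_power_prime_cong[OF p, of c] by (simp add: cong_iff_dvd_diff)
  then obtain m where "c ^ p = c + int p * m" by (metis add.commute diff_eq_eq dvdE)
  then have m: "a j ^ p = a j + of_nat p * of_int m" by (simp add: c flip: of_int_power)
  have "(\<Sum>i\<in>insert j I. a i * z i) ^ p
      = (\<Sum>i\<in>insert j I. a i * z i ^ p) + of_nat p * (of_int m * z j ^ p + w1 + w2)"
    using insert.hyps w1 w2 m by (simp add: power_mult_distrib algebra_simps)
  moreover have "of_int m * z j ^ p + w1 + w2 \<in> cyclo_int d"
    using w1 w2 insert.prems(1) by (intro cyclo_int_add cyclo_int_mult cyclo_int_of_int cyclo_int_power) auto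
  ultimately show ?case by blast
qed

text \<open>
  The congruence modulo \<open>p\<close> becomes an equality because \<open>p\<close> exceeds twice the absolute values.
\<close>

lemma rational_power_sum_prime:
  assumes p: "prime p" "p > 2 * S" and fin: "finite I" and d: "d > 0"
    and z: "\<And>i. i \<in> I \<Longrightarrow> z i ^ d = 1" and a: "\<And>i. i \<in> I \<Longrightarrow> a i \<in> \<int>"
    and S: "(\<Sum>i\<in>I. cmod (a i)) \<le> real S"
    and rat: "(\<Sum>i\<in>I. a i * z i) \<in> \<rat>" "(\<Sum>i\<in>I. a i * z i ^ p) \<in> \<rat>"
  shows "(\<Sum>i\<in>I. a i * z i ^ p) = (\<Sum>i\<in>I. a i * z i)"
proof -
  have zO: "z i \<in> cyclo_int d" if "i \<in> I" for i using root_unity_cyclo_int[OF z[OF that] d] .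
  have aO: "a i \<in> cyclo_int d" if "i \<in> I" for i
    using a[OF that] by (auto elim!: Ints_cases intro: cyclo_int_of_int)
  have int: "(\<Sum>i\<in>I. a i * z i ^ k) \<in> \<int>" if "(\<Sum>i\<in>I. a i * z i ^ k) \<in> \<rat>" for k
    using that zO aO d by (intro rational_cyclo_int cyclo_int_sum cyclo_int_mult cyclo_int_power) auto
  have bound: "cmod (\<Sum>i\<in>I. a i * z i ^ k) \<le> S" for k
  proof -
    have "cmod (z i ^ k) = 1" if "i \<in> I" for i
    proof -
      have "cmod (z i) ^ d = 1" using z[OF that] by (metis norm_one norm_power)
      then have "cmod (z i) = 1" using d power_eq_imp_eq_base[of "cmod (z i)" d 1] by simp
      then show ?thesis by (simp add: norm_power)
    qed
    then have "cmod (\<Sum>i\<in>I. a i * z i ^ k) \<le> (\<Sum>i\<in>I. cmod (a i))"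
      using norm_sum[of "\<lambda>i. a i * z i ^ k" I] by (simp add: norm_mult)
    then show ?thesis using S by simp
  qed
  obtain u :: int where u: "(\<Sum>i\<in>I. a i * z i) = of_int u"
    using int[of 1] rat(1) by (auto elim: Ints_cases)
  obtain v :: int where v: "(\<Sum>i\<in>I. a i * z i ^ p) = of_int v"
    using int[OF rat(2)] by (auto elim: Ints_cases)
  obtain w where w: "w \<in> cyclo_int d" "of_int u ^ p = of_int v + of_nat p * w"
    using cyclo_int_sum_power[where z = z and a = a, OF p(1) fin] zO a unfolding u[symmetric] v[symmetric] by blast
  have p0: "p > 0" using p(1) by (rule prime_gt_0_nat)
  \<comment> \<open>The quotient of the congruence is a ratio of integers that lies in
    \<open>cyclo_int d\<close>, hence an integer. The congruence thus descends to the ordinary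
    integers \<open>u\<close> and \<open>v\<close>.\<close>
  have "w = (of_int (u ^ p - v) / of_nat p)" using w(2) p0 by (simp add: field_simps)
  then have "w \<in> \<rat>" by simp
  then have "w \<in> \<int>" using rational_cyclo_int[OF w(1) _ d] by simp
  then obtain n :: int where n: "w = of_int n" by (auto elim: Ints_cases)
  have "of_int (u ^ p) = (of_int (v + int p * n) :: complex)" using w(2) n by simp
  then have "u ^ p = v + int p * n" by (simp only: of_int_eq_iff)
  then have "[u ^ p = v] (mod int p)" by (simp add: cong_iff_dvd_diff)
  then have "[u = v] (mod int p)" using int_power_prime_cong[OF p(1), of u] by (meson cong_sym cong_trans)
  then have dvd: "int p dvd u - v" by (simp add: cong_iff_dvd_diff)
  have "real_of_int \<bar>u\<bar> \<le> S" using bound[of 1] u by simp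
  moreover have "real_of_int \<bar>v\<bar> \<le> S" using bound[of p] v by simp
  ultimately have "\<bar>u\<bar> \<le> int S" "\<bar>v\<bar> \<le> int S" by linarith+
  then have "\<bar>u - v\<bar> < int p" using p(2) by linarith
  then have "u - v = 0" using dvd dvd_imp_le_int[of "u - v" "int p"] by fastforce
  then show ?thesis using u v by simp
qed

section \<open>Invariance of rational virtual characters under powers\<close>

context fin_group
begin

lemma fin_comm_group_carrier:
  assumes "subgroup H G" and "\<And>x y. x \<in> H \<Longrightarrow> y \<in> H \<Longrightarrow> x \<otimes> y = y \<otimes> x"
  shows "fin_comm_group (G\<lparr>carrier := H\<rparr>)"
proof -
  interpret H: group "G\<lparr>carrier := H\<rparr>" by (rule subgroup_imp_group[OF assms(1)])
  have "comm_group (G\<lparr>carrier := H\<rparr>)"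
    by (rule H.group_comm_groupI) (use assms(2) in auto)
  moreover have "finite H" using finite_subset[OF subgroup.subset[OF assms(1)] fin] .
  ultimately show ?thesis
    by (simp add: fin_comm_group_def fin_group_def fin_group_axioms_def H.is_group)
qed

lemma virt_fourier_Ints:
  assumes X: "fin_comm_group (G\<lparr>carrier := H\<rparr>)"
    and f: "virt G f" and H: "subgroup H G" and \<theta>: "\<theta> \<in> lchars (G\<lparr>carrier := H\<rparr>)"
  shows "fin_comm_group.fourier (G\<lparr>carrier := H\<rparr>) f \<theta> \<in> \<int>"
proof -
  interpret X: fin_comm_group "G\<lparr>carrier := H\<rparr>" by (rule X)
  have "(\<Sum>x\<in>H. f x * \<theta> (inv x)) / of_nat (card H) \<in> \<int>"
    by (rule virt_multiplicity_Ints[OF f H]) (use \<theta> in \<open>auto simp: lchars_def\<close>)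
  moreover have "(\<Sum>x\<in>H. f x * \<theta> (inv\<^bsub>G\<lparr>carrier := H\<rparr>\<^esub> x)) = (\<Sum>x\<in>H. f x * \<theta> (inv x))"
    by (rule sum.cong) (simp_all add: m_inv_consistent[OF H])
  ultimately show ?thesis by (simp add: X.fourier_def Coset.order_def)
qed

text \<open>On the cyclic group of \<open>x\<close> the values of \<open>f\<close> are integral
  combinations of powers of roots of unity, so large primes may be applied as exponents without
  changing them, and hence so may products of large primes. Modulo the group order every admissible
  \<open>k\<close> is such a product.\<close>

lemma virt_rational_pow:
  assumes f: "virt G f" and rat: "\<And>x. x \<in> carrier G \<Longrightarrow> f x \<in> \<rat>"
    and k: "coprime k (Coset.order G)" and x: "x \<in> carrier G"
  shows "f (x [^] (k::nat)) = f x"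
proof -
  define H where "H = range (\<lambda>i::nat. x [^] i)"
  have H: "subgroup H G"
  proof (rule submonoid_imp_subgroup)
    show "H \<subseteq> carrier G" using x by (auto simp: H_def)
    show "\<one> \<in> H" unfolding H_def by (rule range_eqI[of _ _ 0]) simp
    show "y \<otimes> z \<in> H" if "y \<in> H" "z \<in> H" for y z using that x by (auto simp: H_def nat_pow_mult)
  qed
  let ?X = "G\<lparr>carrier := H\<rparr>"
  have X: "fin_comm_group ?X"
    by (rule fin_comm_group_carrier[OF H]) (use x in \<open>auto simp: H_def nat_pow_mult add.commute\<close>)
  interpret X: fin_comm_group ?X by (rule X)
  have xH: "x [^] (i::nat) \<in> H" for i by (simp add: H_def)
  have x1: "x \<in> H" using xH[of 1] x by simp
  have powX: "x [^]\<^bsub>?X\<^esub> (i::nat) = x [^] i" for i by (simp add: nat_pow_def)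
  let ?a = "X.fourier f"
  \<comment> \<open>This bounds all values of \<open>f\<close> on the cyclic group, since linear
    characters have absolute value 1 there.\<close>
  define S where "S = nat \<lceil>\<Sum>\<theta>\<in>lchars ?X. cmod (?a \<theta>)\<rceil>"
  have S: "(\<Sum>\<theta>\<in>lchars ?X. cmod (?a \<theta>)) \<le> real S" unfolding S_def by (rule real_nat_ceiling_ge)
  have val: "f (x [^] i) = (\<Sum>\<theta>\<in>lchars ?X. ?a \<theta> * \<theta> x ^ i)" for i :: nat
    using X.fourier_inversion[of "x [^] i" f] xH[of i] X.lchar_pow[of _ x i] x1 by (simp add: powX)
  have step: "f (x [^] (i * p)) = f (x [^] i)" if p: "prime p" "p > 2 * S" for i p :: nat
  proof -
    have rat': "(\<Sum>\<theta>\<in>lchars ?X. ?a \<theta> * \<theta> x ^ j) \<in> \<rat>" for j using rat[of "x [^] j"] x val[of j] by simp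
    have "(\<Sum>\<theta>\<in>lchars ?X. ?a \<theta> * (\<theta> x ^ i) ^ p) = (\<Sum>\<theta>\<in>lchars ?X. ?a \<theta> * \<theta> x ^ i)"
    proof (rule rational_power_sum_prime[OF p X.finite_lchars X.order_pos _ _ S])
      fix \<theta> assume \<theta>: "\<theta> \<in> lchars ?X"
      show "?a \<theta> \<in> \<int>" by (rule virt_fourier_Ints[OF X f H \<theta>])
      show "(\<theta> x ^ i) ^ Coset.order ?X = 1"
        using X.lchar_order[OF \<theta>, of x] x1 by (simp add: power_mult[symmetric] mult.commute[of i]) (simp add: power_mult)
    next
      show "(\<Sum>\<theta>\<in>lchars ?X. ?a \<theta> * \<theta> x ^ i) \<in> \<rat>" by (rule rat')
      show "(\<Sum>\<theta>\<in>lchars ?X. ?a \<theta> * (\<theta> x ^ i) ^ p) \<in> \<rat>" using rat'[of "i * p"] by (simp add: power_mult)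
    qed
    then show ?thesis unfolding val by (simp add: power_mult)
  qed
  \<comment> \<open>A prime that does not divide \<open>fact B\<close> exceeds \<open>B\<close>,
    hence \<open>2 * S\<close>. The summand 2 makes \<open>fact B\<close> even, which excludes the
    exponent \<open>m = 0\<close>.\<close>
  define B where "B = 2 * S + 2"
  have all: "f (x [^] m) = f x" if "coprime m (fact B :: nat)" for m :: nat
    using that
  proof (induction m rule: less_induct)
    case (less m)
    show ?case
    proof (cases "m = 1")
      case True
      then show ?thesis using x by simp
    next
      case False
      then obtain p where p: "prime p" "p dvd m" using prime_factor_nat by blast
      have "\<not> p dvd fact B" using less.prems p by (metis coprime_common_divisor not_prime_unit)
      then have "p > B" using p(1) by (simp add: prime_dvd_fact_iff)
      obtain m' where m': "m = m' * p" using p(2) by (metis dvd_def mult.commute)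
      have "m \<noteq> 0"
      proof
        assume "m = 0"
        then have "fact B = (1::nat)" using less.prems by simp
        moreover have "2 dvd (fact B :: nat)" by (rule dvd_fact) (simp_all add: B_def)
        ultimately show False by simp
      qed
      then have "m' < m" using m' prime_gt_1_nat[OF p(1)] by simp
      moreover have "coprime m' (fact B :: nat)" using less.prems m' by simp
      ultimately show ?thesis using less.IH[of m'] step[OF p(1), of m'] \<open>p > B\<close> m' by (simp add: B_def)
    qed
  qed
  obtain t where t: "coprime (k + Coset.order G * t) (fact B :: nat)"
    using coprime_add_mult_exists[OF k] by (metis fact_gt_zero)
  have "x [^] (k + Coset.order G * t) = x [^] k"
    using x by (simp add: nat_pow_mult[symmetric] nat_pow_pow[symmetric] pow_order_eq_1)
  then show ?thesis using all[OF t] by simp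
qed

end

section \<open>Halves of induced characters\<close>

lemma spanned_Ints_mult:
  assumes "S \<subseteq> carrier (fun_ring G)" "spanned G S f" "c \<in> \<int>"
  shows "spanned G S (\<lambda>x. c * f x)"
  using assms(3) spanned_int_mult[OF assms(1,2)] by (auto elim: Ints_cases)

text \<open>The members of \<open>S\<close> fall into pairs with equal \<open>h\<close>, and a pair
  of halves is one whole \<open>h K\<close>.\<close>

lemma perm_half_sum:
  assumes "finite S" and "\<And>K. K \<in> S \<Longrightarrow> c K \<in> S \<and> c K \<noteq> K \<and> c (c K) = K \<and> h (c K) = h K"
    and "\<And>K. K \<in> S \<Longrightarrow> perm G (h K)"
  shows "perm G (\<lambda>x. \<Sum>K\<in>S. h K x / 2)"
  using assms
proof (induction "card S" arbitrary: S rule: less_induct)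
  case less
  show ?case
  proof (cases "S = {}")
    case True
    then show ?thesis by (simp add: spanned_0)
  next
    case False
    then obtain K where K: "K \<in> S" by auto
    define S' where "S' = S - {K, c K}"
    have cK: "c K \<in> S" "c K \<noteq> K" "c (c K) = K" "h (c K) = h K" using less.prems(2)[OF K] by auto
    have "perm G (\<lambda>x. \<Sum>K\<in>S'. h K x / 2)"
    proof (rule less.hyps)
      show "card S' < card S" unfolding S'_def
        by (rule psubset_card_mono) (use less.prems(1) K in auto)
      show "c L \<in> S' \<and> c L \<noteq> L \<and> c (c L) = L \<and> h (c L) = h L" if "L \<in> S'" for L
        using less.prems(2)[of L] that cK unfolding S'_def by (metis Diff_iff insert_iff singletonD)
    qed (use less.prems in \<open>auto simp: S'_def\<close>)
    then have "perm G (\<lambda>x. h K x + (\<Sum>K\<in>S'. h K x / 2))"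
      using less.prems(3)[OF K] by (intro spanned_add)
    moreover have "(\<Sum>K\<in>S. h K x / 2) = h K x + (\<Sum>K\<in>S'. h K x / 2)" for x
    proof -
      have eq: "S = insert K (insert (c K) S')" using K cK(1) by (auto simp: S'_def)
      have "finite S'" "K \<notin> insert (c K) S'" "c K \<notin> S'" using less.prems(1) cK(2) by (auto simp: S'_def)
      then show ?thesis by (subst eq) (simp add: cK(4))
    qed
    ultimately show ?thesis by simp
  qed
qed

context fin_group
begin

text \<open>As a function of \<open>x\<close> this is the sum of all conjugates of the point mass at
  \<open>y\<close>: the order of the centraliser of \<open>x\<close> on the class of
  \<open>y\<close>, and 0 elsewhere. Induced functions are written as combinations of these.\<close>

definition conj_count :: "'a \<Rightarrow> 'a \<Rightarrow> complex" where
  "conj_count y x = of_nat (card {g \<in> carrier G. inv g \<otimes> x \<otimes> g = y})"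

lemma card_conj_mem:
  assumes "finite A"
  shows "of_nat (card {g \<in> carrier G. inv g \<otimes> x \<otimes> g \<in> A}) = (\<Sum>y\<in>A. conj_count y x)"
proof -
  have "{g \<in> carrier G. inv g \<otimes> x \<otimes> g \<in> A} = (\<Union>y\<in>A. {g \<in> carrier G. inv g \<otimes> x \<otimes> g = y})" by auto
  then have "card {g \<in> carrier G. inv g \<otimes> x \<otimes> g \<in> A} = (\<Sum>y\<in>A. card {g \<in> carrier G. inv g \<otimes> x \<otimes> g = y})"
    using assms fin by (simp only:) (subst card_UN_disjoint, auto)
  then show ?thesis by (simp add: conj_count_def)
qed

lemma perm_char_eq:
  assumes "subgroup H G"
  shows "perm_char H x = (\<Sum>y\<in>H. conj_count y x) / of_nat (card H)"
  using card_conj_mem[OF finite_subset[OF subgroup.subset[OF assms] fin]] by (simp add: perm_char_def)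

lemma conj_count_conj:
  assumes "h \<in> carrier G" "y \<in> carrier G" "x \<in> carrier G"
  shows "conj_count (inv h \<otimes> y \<otimes> h) x = conj_count y x"
proof -
  have "bij_betw (\<lambda>g. g \<otimes> h) {g \<in> carrier G. inv g \<otimes> x \<otimes> g = y}
      {g \<in> carrier G. inv g \<otimes> x \<otimes> g = inv h \<otimes> y \<otimes> h}"
  proof (rule bij_betw_byWitness[where f' = "\<lambda>g. g \<otimes> inv h"])
    show "(\<lambda>g. g \<otimes> h) ` {g \<in> carrier G. inv g \<otimes> x \<otimes> g = y} \<subseteq> {g \<in> carrier G. inv g \<otimes> x \<otimes> g = inv h \<otimes> y \<otimes> h}"
      using assms by (auto simp: inv_mult_group m_assoc)
    show "(\<lambda>g. g \<otimes> inv h) ` {g \<in> carrier G. inv g \<otimes> x \<otimes> g = inv h \<otimes> y \<otimes> h} \<subseteq> {g \<in> carrier G. inv g \<otimes> x \<otimes> g = y}"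
    proof
      fix k assume "k \<in> (\<lambda>g. g \<otimes> inv h) ` {g \<in> carrier G. inv g \<otimes> x \<otimes> g = inv h \<otimes> y \<otimes> h}"
      then obtain g where g: "g \<in> carrier G" "inv g \<otimes> x \<otimes> g = inv h \<otimes> y \<otimes> h" "k = g \<otimes> inv h" by auto
      have hz: "h \<otimes> (inv h \<otimes> z) = z" if "z \<in> carrier G" for z
        using that assms by (simp add: m_assoc[symmetric])
      have "inv k \<otimes> x \<otimes> k = h \<otimes> (inv g \<otimes> x \<otimes> g) \<otimes> inv h"
        using g(1,3) assms by (simp add: inv_mult_group m_assoc)
      also have "\<dots> = y" unfolding g(2) using assms by (simp add: m_assoc hz)
      finally show "k \<in> {g \<in> carrier G. inv g \<otimes> x \<otimes> g = y}" using g assms by simp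
    qed
  qed (use assms in \<open>auto simp: m_assoc\<close>)
  then show ?thesis unfolding conj_count_def by (simp add: bij_betw_same_card)
qed

lemma sum_conj_count:
  assumes y: "y \<in> carrier G"
  shows "(\<Sum>x\<in>carrier G. conj_count y x) = of_nat (Coset.order G)"
proof -
  have eq: "inv g \<otimes> x \<otimes> g = y \<longleftrightarrow> x = g \<otimes> y \<otimes> inv g" if "g \<in> carrier G" "x \<in> carrier G" for g x
    using that y by (metis inv_solve_left inv_solve_right m_assoc m_closed inv_closed)
  have "(\<Sum>x\<in>carrier G. conj_count y x) = (\<Sum>x\<in>carrier G. \<Sum>g\<in>carrier G. if inv g \<otimes> x \<otimes> g = y then 1 else 0)"
    using fin by (simp add: conj_count_def sum.If_cases Int_def)
  also have "\<dots> = (\<Sum>g\<in>carrier G. \<Sum>x\<in>carrier G. if x = g \<otimes> y \<otimes> inv g then 1 else 0)"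
    by (subst sum.swap) (auto intro!: sum.cong simp: eq)
  also have "\<dots> = (\<Sum>g\<in>carrier G. 1)"
    using fin y by (intro sum.cong) (auto simp: sum.delta)
  finally show ?thesis by (simp add: Coset.order_def)
qed

text \<open>The count vanishes unless \<open>x\<close> and \<open>y\<close> are conjugate. This is
  the projection formula in its smallest form: \<open>f\<close> may be evaluated inside or outside
  an induced sum.\<close>

lemma virt_conj_count: "virt G f \<Longrightarrow> x \<in> carrier G \<Longrightarrow> f y * conj_count y x = f x * conj_count y x"
proof -
  assume f: "virt G f" "x \<in> carrier G"
  show ?thesis
  proof (cases "{g \<in> carrier G. inv g \<otimes> x \<otimes> g = y} = {}")
    case True
    then have "conj_count y x = 0" unfolding conj_count_def by (simp only: card.empty of_nat_0)
    then show ?thesis by simp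
  next
    case False
    then have "f y = f x" using virt_conj[OF f] by auto
    then show ?thesis by simp
  qed
qed

text \<open>
  Half of the character induced from the restriction of \<open>f\<close> to an abelian subgroup \<open>X\<close> with a
  complemented extension by an involution \<open>w\<close>: the subgroups \<open>K\<close> of \<open>X\<close> that \<open>w\<close> moves occur in
  pairs, and for the others half of the character of \<open>G/K\<close> differs from that of
  \<open>G/(K \<union> K w)\<close> by the contribution of the coset \<open>K w\<close>.
\<close>

lemma half_induced_virt:
  assumes f: "virt G f" and rat: "\<And>x. x \<in> carrier G \<Longrightarrow> f x \<in> \<rat>"
    and X: "subgroup X G" and comm: "\<And>x y. x \<in> X \<Longrightarrow> y \<in> X \<Longrightarrow> x \<otimes> y = y \<otimes> x"
    and w: "w \<in> carrier G" "w \<notin> X" "w \<otimes> w = \<one>" and wX: "\<And>x. x \<in> X \<Longrightarrow> w \<otimes> x \<otimes> w \<in> X"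
  shows "\<exists>\<K> b. finite \<K> \<and> (\<forall>K\<in>\<K>. subgroup K G \<and> K \<subseteq> X \<and> b K \<in> \<int>) \<and>
    perm G (\<lambda>x. f x * perm_char X x / 2
       + (\<Sum>K\<in>\<K>. b K / (2 * of_nat (card K)) * (\<Sum>k\<in>K. conj_count (k \<otimes> w) x)))"
proof -
  let ?X = "G\<lparr>carrier := X\<rparr>"
  interpret XS: subgroup X G by (rule X)
  note XG = XS.mem_carrier
  have Xf: "fin_comm_group ?X" by (rule fin_comm_group_carrier[OF X comm])
  interpret X: fin_comm_group ?X by (rule Xf)
  have invw: "inv w = w" using w by (simp add: inv_equality)
  have ww: "w \<otimes> (w \<otimes> x) = x" "x \<otimes> w \<otimes> w = x" if "x \<in> carrier G" for x
    using that w by (simp_all add: m_assoc[symmetric]) (simp_all add: m_assoc)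
  \<comment> \<open>Conjugation by \<open>w\<close>, which is its own inverse.\<close>
  define c where "c x = w \<otimes> x \<otimes> w" for x
  have cX: "c x \<in> X" if "x \<in> X" for x using wX[OF that] by (simp add: c_def)
  have cc: "c (c x) = x" if "x \<in> carrier G" for x
    using that w ww by (simp add: c_def m_assoc)
  have ch: "c x \<otimes> c y = c (x \<otimes> y)" if "x \<in> carrier G" "y \<in> carrier G" for x y
    using that w ww by (simp add: c_def m_assoc)
  obtain b where b: "\<And>K. K \<in> X.kers \<Longrightarrow> b K \<in> \<int>"
    "\<And>x. x \<in> carrier ?X \<Longrightarrow> f x = (\<Sum>K\<in>X.kers. b K * (if x \<in> K then of_nat (Coset.order ?X) / of_nat (card K) else 0))"
    "\<And>w K. w \<in> hom ?X ?X \<Longrightarrow> (\<And>x. x \<in> carrier ?X \<Longrightarrow> w (w x) = x \<and> f (w x) = f x) \<Longrightarrow> K \<in> X.kers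
       \<Longrightarrow> w ` K \<in> X.kers \<and> b (w ` K) = b K"
  proof (rule X.rational_decomposition[of f "Coset.order G"])
    show "X.fourier f \<theta> \<in> \<int>" if "\<theta> \<in> lchars ?X" for \<theta> by (rule virt_fourier_Ints[OF Xf f X that])
    show "Coset.order ?X dvd Coset.order G"
      using lagrange[OF X] by (metis Coset.order_def dvd_triv_right partial_object.select_convs(1) partial_object.update_convs(1) partial_object.surjective)
    show "f (x [^]\<^bsub>?X\<^esub> k) = f x" if "coprime k (Coset.order G)" "x \<in> carrier ?X" for k :: nat and x
      using virt_rational_pow[OF f rat that(1), of x] that(2) XG by (simp add: nat_pow_def)
  qed (use order_pos in blast)+
  have bc: "c ` K \<in> X.kers \<and> b (c ` K) = b K" if "K \<in> X.kers" for K
  proof (rule b(3)[OF _ _ that])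
    show "c \<in> hom ?X ?X" using cX ch XG by (auto simp: hom_def)
    show "c (c x) = x \<and> f (c x) = f x" if "x \<in> carrier ?X" for x
      using that cc XG virt_conj[OF f XG w(1)] invw by (simp add: c_def)
  qed
  have sub: "subgroup K G" "K \<subseteq> X" if "K \<in> X.kers" for K
    using X.subgroup_kers[OF that] incl_subgroup[OF X] subgroup.subset by fastforce+
  have cck: "c ` c ` K = K" if "K \<in> X.kers" for K
  proof -
    have "c ` c ` K = (\<lambda>x. x) ` K" unfolding image_image
      using sub(2)[OF that] XG cc by (intro image_cong) auto
    then show ?thesis by simp
  qed
  have finK: "finite K" if "K \<in> X.kers" for K
    using finite_subset[OF subgroup.subset[OF sub(1)[OF that]] fin] .
  have cardK: "card K \<noteq> 0" if "K \<in> X.kers" for K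
    using finK[OF that] subgroup.one_closed[OF sub(1)[OF that]] by auto
  \<comment> \<open>By the projection formula the left side is the restriction of \<open>f\<close>
    to \<open>X\<close> induced to \<open>G\<close>; inducing the decomposition of that restriction
    replaces each \<open>K\<close> by its permutation character in \<open>G\<close>.\<close>
  have main: "f x * perm_char X x = (\<Sum>K\<in>X.kers. b K * perm_char K x)" if x: "x \<in> carrier G" for x
  proof -
    have finX: "finite X" using finite_subset[OF XS.subset fin] .
    have cX0: "of_nat (card X) \<noteq> (0::complex)" using finX XS.one_closed by (metis card_0_eq empty_iff of_nat_eq_0_iff)
    have oX: "Coset.order ?X = card X" by (simp add: Coset.order_def)
    have "f x * perm_char X x = (\<Sum>y\<in>X. f y * conj_count y x) / of_nat (card X)"
      by (simp add: perm_char_eq[OF X] sum_distrib_left virt_conj_count[OF f x])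
    also have "(\<Sum>y\<in>X. f y * conj_count y x)
        = (\<Sum>y\<in>X. \<Sum>K\<in>X.kers. b K * (if y \<in> K then of_nat (card X) / of_nat (card K) * conj_count y x else 0))"
    proof (rule sum.cong[OF refl])
      fix y assume "y \<in> X"
      then have "f y = (\<Sum>K\<in>X.kers. b K * (if y \<in> K then of_nat (card X) / of_nat (card K) else 0))"
        using b(2)[of y] unfolding oX by simp
      then have "f y * conj_count y x
          = (\<Sum>K\<in>X.kers. b K * (if y \<in> K then of_nat (card X) / of_nat (card K) else 0) * conj_count y x)"
        by (simp only: sum_distrib_right)
      also have "\<dots> = (\<Sum>K\<in>X.kers. b K * (if y \<in> K then of_nat (card X) / of_nat (card K) * conj_count y x else 0))"
        by (rule sum.cong) auto
      finally show "f y * conj_count y x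
          = (\<Sum>K\<in>X.kers. b K * (if y \<in> K then of_nat (card X) / of_nat (card K) * conj_count y x else 0))" .
    qed
    also have "\<dots> = (\<Sum>K\<in>X.kers. b K * (\<Sum>y\<in>X. if y \<in> K then of_nat (card X) / of_nat (card K) * conj_count y x else 0))"
      by (subst sum.swap) (simp only: sum_distrib_left)
    also have "\<dots> = (\<Sum>K\<in>X.kers. of_nat (card X) * (b K * perm_char K x))"
    proof (rule sum.cong[OF refl])
      fix K assume K: "K \<in> X.kers"
      have "(\<Sum>y\<in>X. if y \<in> K then of_nat (card X) / of_nat (card K) * conj_count y x else 0)
          = (\<Sum>y\<in>K. of_nat (card X) / of_nat (card K) * conj_count y x)"
        using sub(2)[OF K] finX by (simp add: sum.If_cases Int_absorb1)
      also have "\<dots> = of_nat (card X) * perm_char K x"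
        by (simp add: perm_char_eq[OF sub(1)[OF K]] sum_distrib_left sum_divide_distrib)
      finally show "b K * (\<Sum>y\<in>X. if y \<in> K then of_nat (card X) / of_nat (card K) * conj_count y x else 0)
          = of_nat (card X) * (b K * perm_char K x)" by simp
    qed
    also have "\<dots> / of_nat (card X) = (\<Sum>K\<in>X.kers. b K * perm_char K x)"
      using cX0 by (simp flip: sum_distrib_left)
    finally show ?thesis .
  qed
  define \<K> where "\<K> = {K \<in> X.kers. c ` K = K}"
  define \<M> where "\<M> = {K \<in> X.kers. c ` K \<noteq> K}"
  have finkers: "finite X.kers" by (rule X.finite_kers)
  \<comment> \<open>The value 0 off the carrier is chosen because \<open>perm_half_sum\<close> asks
    for equal functions, while conjugate subgroups are compared only at elements of
    \<open>G\<close>.\<close>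
  define pc where "pc K x = (if x \<in> carrier G then b K * perm_char K x else 0)" for K x
  have pc: "perm G (pc K)" if "K \<in> X.kers" for K
    by (rule spanned_cong[OF spanned_Ints_mult[OF perm_characters_carrier perm_perm_char[OF sub(1)[OF that]] b(1)[OF that]]])
      (simp add: pc_def)
  have conjpc: "perm_char (c ` K) x = perm_char K x" if K: "K \<in> X.kers" and x: "x \<in> carrier G" for K x
  proof -
    have KG: "k \<in> carrier G" if "k \<in> K" for k using that sub(2)[OF K] XG by auto
    have inj: "inj_on c K" by (rule inj_on_inverseI[of _ c]) (use KG cc in auto)
    have "subgroup (c ` K) G" using bc[OF K] sub(1) by auto
    then have "perm_char (c ` K) x = (\<Sum>y\<in>K. conj_count (c y) x) / of_nat (card K)"
      by (simp add: perm_char_eq sum.reindex[OF inj] card_image[OF inj])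
    also have "(\<Sum>y\<in>K. conj_count (c y) x) = (\<Sum>y\<in>K. conj_count y x)"
    proof (rule sum.cong[OF refl])
      fix y assume "y \<in> K"
      then show "conj_count (c y) x = conj_count y x"
        using conj_count_conj[OF w(1) KG x] invw by (simp add: c_def)
    qed
    finally show ?thesis by (simp add: perm_char_eq[OF sub(1)[OF K]])
  qed
  have moved: "perm G (\<lambda>x. \<Sum>K\<in>\<M>. pc K x / 2)"
  proof (rule perm_half_sum[where c = "image c"])
    show "finite \<M>" using finkers by (simp add: \<M>_def)
    fix K assume K: "K \<in> \<M>"
    then have K': "K \<in> X.kers" "c ` K \<noteq> K" by (auto simp: \<M>_def)
    have "c ` c ` K \<noteq> c ` K" using K'(2) cck[OF K'(1)] by metis
    moreover have "pc (c ` K) = pc K" using conjpc[OF K'(1)] bc[OF K'(1)] by (auto simp: pc_def)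
    ultimately show "c ` K \<in> \<M> \<and> c ` K \<noteq> K \<and> c ` c ` K = K \<and> pc (c ` K) = pc K"
      using K' bc[OF K'(1)] cck[OF K'(1)] by (simp add: \<M>_def)
    show "perm G (pc K)" by (rule pc[OF K'(1)])
  qed
  \<comment> \<open>Since \<open>w\<close> normalises a stable \<open>K\<close>, adding the coset
    gives a group of order \<open>2 * card K\<close>; its permutation character is half that of
    \<open>K\<close> plus the share of the coset.\<close>
  have ext: "subgroup (K \<union> (\<lambda>k. k \<otimes> w) ` K) G \<and>
      (\<forall>x. perm_char (K \<union> (\<lambda>k. k \<otimes> w) ` K) x = perm_char K x / 2 + (\<Sum>k\<in>K. conj_count (k \<otimes> w) x) / (2 * of_nat (card K)))"
    if K: "K \<in> \<K>" for K
  proof -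
    have K': "K \<in> X.kers" "c ` K = K" using K by (auto simp: \<K>_def)
    interpret K: subgroup K G by (rule sub(1)[OF K'(1)])
    note KG = K.mem_carrier
    have cK: "c k \<in> K" if "k \<in> K" for k using that K'(2) by blast
    have wk: "w \<otimes> k = c k \<otimes> w" if "k \<in> K" for k using that w ww KG by (simp add: c_def m_assoc)
    let ?L = "(\<lambda>k. k \<otimes> w) ` K"
    have inj: "inj_on (\<lambda>k. k \<otimes> w) K" using KG w by (auto simp: inj_on_def)
    have disj: "K \<inter> ?L = {}"
    proof (rule ccontr)
      assume "K \<inter> ?L \<noteq> {}"
      then obtain k where k: "k \<in> K" "k \<otimes> w \<in> K" by auto
      then have "inv k \<otimes> (k \<otimes> w) \<in> K" by simp
      then have "w \<in> K" using k(1) KG w by (simp add: m_assoc[symmetric])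
      then show False using w(2) sub(2)[OF K'(1)] by auto
    qed
    have S: "subgroup (K \<union> ?L) G"
    proof (rule submonoid_imp_subgroup)
      show "K \<union> ?L \<subseteq> carrier G" using KG w by auto
      show "\<one> \<in> K \<union> ?L" by simp
      fix x y assume "x \<in> K \<union> ?L" "y \<in> K \<union> ?L"
      moreover have "k \<otimes> (l \<otimes> w) \<in> ?L" if "k \<in> K" "l \<in> K" for k l
        using that KG w by (simp add: m_assoc[symmetric])
      moreover have "(k \<otimes> w) \<otimes> l \<in> ?L" if "k \<in> K" "l \<in> K" for k l
        using that KG w wk[OF that(2)] cK[OF that(2)] by (simp add: m_assoc) (simp add: m_assoc[symmetric])
      moreover have "(k \<otimes> w) \<otimes> (l \<otimes> w) \<in> K" if "k \<in> K" "l \<in> K" for k l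
      proof -
        have "(k \<otimes> w) \<otimes> (l \<otimes> w) = k \<otimes> c l" using that KG w by (simp add: m_assoc c_def)
        then show ?thesis using that cK by simp
      qed
      ultimately show "x \<otimes> y \<in> K \<union> ?L" by auto
    qed
    have "perm_char (K \<union> ?L) x = perm_char K x / 2 + (\<Sum>k\<in>K. conj_count (k \<otimes> w) x) / (2 * of_nat (card K))" for x
    proof -
      have cd: "card (K \<union> ?L) = 2 * card K"
        using disj finK[OF K'(1)] by (simp add: card_Un_disjoint card_image[OF inj])
      have "(\<Sum>y\<in>K \<union> ?L. conj_count y x) = (\<Sum>y\<in>K. conj_count y x) + (\<Sum>k\<in>K. conj_count (k \<otimes> w) x)"
        using disj finK[OF K'(1)] by (simp add: sum.union_disjoint sum.reindex[OF inj])
      then show ?thesis by (simp add: perm_char_eq[OF S] perm_char_eq[OF K.subgroup_axioms] cd add_divide_distrib)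
    qed
    then show ?thesis using S by blast
  qed
  show ?thesis
  proof (rule exI[of _ \<K>], rule exI[of _ b], rule conjI[OF _ conjI])
    show "finite \<K>" using finkers by (simp add: \<K>_def)
    show "\<forall>K\<in>\<K>. subgroup K G \<and> K \<subseteq> X \<and> b K \<in> \<int>" using sub b(1) by (auto simp: \<K>_def)
    \<comment> \<open>Moved subgroups enter by halves, stable ones through their extensions.
      Expanding the latter by \<open>ext\<close> produces the missing halves together with the coset
      terms.\<close>
    have "perm G (\<lambda>x. (\<Sum>K\<in>\<M>. pc K x / 2) + (\<Sum>K\<in>\<K>. b K * perm_char (K \<union> (\<lambda>k. k \<otimes> w) ` K) x))"
    proof (rule spanned_add[OF moved], rule spanned_sum)
      fix K assume K: "K \<in> \<K>"
      then have "b K \<in> \<int>" using b(1) by (auto simp: \<K>_def)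
      then show "perm G (\<lambda>x. b K * perm_char (K \<union> (\<lambda>k. k \<otimes> w) ` K) x)"
        using ext[OF K] by (intro spanned_Ints_mult perm_characters_carrier perm_perm_char) auto
    qed
    then show "perm G (\<lambda>x. f x * perm_char X x / 2
       + (\<Sum>K\<in>\<K>. b K / (2 * of_nat (card K)) * (\<Sum>k\<in>K. conj_count (k \<otimes> w) x)))"
    proof (rule spanned_cong)
      fix x assume x: "x \<in> carrier G"
      have "X.kers = \<M> \<union> \<K>" "\<M> \<inter> \<K> = {}" "finite \<M>" "finite \<K>"
        using finkers by (auto simp: \<M>_def \<K>_def)
      then have "f x * perm_char X x = (\<Sum>K\<in>\<M>. b K * perm_char K x) + (\<Sum>K\<in>\<K>. b K * perm_char K x)"
        unfolding main[OF x] by (simp only: sum.union_disjoint)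
      moreover have "(\<Sum>K\<in>\<K>. b K * perm_char (K \<union> (\<lambda>k. k \<otimes> w) ` K) x)
          = (\<Sum>K\<in>\<K>. b K * perm_char K x) / 2 + (\<Sum>K\<in>\<K>. b K / (2 * of_nat (card K)) * (\<Sum>k\<in>K. conj_count (k \<otimes> w) x))"
        unfolding sum_divide_distrib sum.distrib[symmetric]
      proof (rule sum.cong[OF refl])
        fix K assume "K \<in> \<K>"
        then have "perm_char (K \<union> (\<lambda>k. k \<otimes> w) ` K) x = perm_char K x / 2 + (\<Sum>k\<in>K. conj_count (k \<otimes> w) x) / (2 * of_nat (card K))"
          using ext by blast
        then show "b K * perm_char (K \<union> (\<lambda>k. k \<otimes> w) ` K) x
            = b K * perm_char K x / 2 + b K / (2 * of_nat (card K)) * (\<Sum>k\<in>K. conj_count (k \<otimes> w) x)"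
          by (simp add: distrib_left)
      qed
      moreover have "(\<Sum>K\<in>\<M>. pc K x / 2) = (\<Sum>K\<in>\<M>. b K * perm_char K x) / 2"
        using x by (simp add: pc_def sum_divide_distrib)
      ultimately show "(\<Sum>K\<in>\<M>. pc K x / 2) + (\<Sum>K\<in>\<K>. b K * perm_char (K \<union> (\<lambda>k. k \<otimes> w) ` K) x)
        = f x * perm_char X x / 2 + (\<Sum>K\<in>\<K>. b K / (2 * of_nat (card K)) * (\<Sum>k\<in>K. conj_count (k \<otimes> w) x))"
        by (simp add: add_divide_distrib)
    qed
  qed
qed

end

section \<open>The group of invertible two by two matrices\<close>

definition mat2 :: "'a \<Rightarrow> 'a \<Rightarrow> 'a \<Rightarrow> 'a \<Rightarrow> 'a mat" where
  "mat2 a b c d = mat 2 2 (\<lambda>(i, j). if i = 0 then (if j = 0 then a else b) else (if j = 0 then c else d))"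

abbreviation GL2 :: "'a::field mat monoid" where "GL2 \<equiv> GL TYPE('a) 2"

abbreviation GL2_times (infixl "\<star>" 70) where "x \<star> y \<equiv> x \<otimes>\<^bsub>GL2\<^esub> y"

abbreviation ginv where "ginv x \<equiv> inv\<^bsub>GL2\<^esub> x"

definition tr2 :: "'a::ring_1 mat \<Rightarrow> 'a" where "tr2 A = A $$ (0,0) + A $$ (1,1)"

definition det2 :: "'a::ring_1 mat \<Rightarrow> 'a" where "det2 A = A $$ (0,0) * A $$ (1,1) - A $$ (0,1) * A $$ (1,0)"

lemma mat2_carrier [simp]: "mat2 a b c d \<in> carrier_mat 2 2"
  by (simp add: mat2_def)

lemma mat2_index [simp]:
  "mat2 a b c d $$ (0,0) = a" "mat2 a b c d $$ (0,Suc 0) = b"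
  "mat2 a b c d $$ (Suc 0,0) = c" "mat2 a b c d $$ (Suc 0,Suc 0) = d"
  by (simp_all add: mat2_def)

lemma tr2_mat2 [simp]: "tr2 (mat2 a b c d) = a + d"
  and det2_mat2 [simp]: "det2 (mat2 a b c d) = a * d - b * c"
  by (simp_all add: tr2_def det2_def)

lemma mat2_cases:
  assumes "A \<in> carrier_mat 2 2"
  obtains a b c d where "A = mat2 a b c d"
proof -
  have "A = mat2 (A $$ (0,0)) (A $$ (0,1)) (A $$ (1,0)) (A $$ (1,1))"
    using assms by (intro eq_matI) (auto simp: mat2_def less_2_cases_iff)
  then show ?thesis by (rule that)
qed

lemma mat2_eq_iff [simp]:
  "mat2 a b c d = mat2 a' b' c' d' \<longleftrightarrow> a = a' \<and> b = b' \<and> c = c' \<and> d = d'"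
  by (metis mat2_index)

lemma mat2_mult: "mat2 a b c d * mat2 a' b' c' d'
    = mat2 (a * a' + b * c') (a * b' + b * d') (c * a' + d * c') (c * b' + d * (d' :: 'a :: semiring_0))"
  by (intro eq_matI) (auto simp: mat2_def scalar_prod_def less_2_cases_iff numeral_2_eq_2)

lemma one_mat2: "1\<^sub>m 2 = mat2 1 0 0 1"
  by (intro eq_matI) (auto simp: mat2_def less_2_cases_iff)

lemma GL2_mult: "x \<star> y = x * y" and GL2_one: "\<one>\<^bsub>GL2\<^esub> = mat2 1 0 0 1"
  by (simp_all add: GL_def units_of_def ring_mat_simps one_mat2)

lemma GL2_mult_mat2 [simp]: "mat2 a b c d \<star> mat2 a' b' c' d'
    = mat2 (a * a' + b * c') (a * b' + b * d') (c * a' + d * c') (c * b' + d * d')"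
  by (simp add: GL2_mult mat2_mult)

lemma det2_mult: "A \<in> carrier_mat 2 2 \<Longrightarrow> B \<in> carrier_mat 2 2 \<Longrightarrow> det2 (A * B) = det2 A * det2 (B :: 'a :: comm_ring_1 mat)"
  by (elim mat2_cases) (simp add: mat2_mult algebra_simps)

lemma tr2_comm: "A \<in> carrier_mat 2 2 \<Longrightarrow> B \<in> carrier_mat 2 2 \<Longrightarrow> tr2 (A * B) = tr2 (B * A :: 'a :: comm_ring_1 mat)"
  by (elim mat2_cases) (simp add: mat2_mult algebra_simps)

lemma GL2_carrier_iff: "x \<in> carrier GL2 \<longleftrightarrow> x \<in> carrier_mat 2 2 \<and> det2 x \<noteq> (0 :: 'a :: field)"
proof
  assume "x \<in> carrier GL2"
  then obtain y where xy: "x \<in> carrier_mat 2 2" "y \<in> carrier_mat 2 2" "x * y = 1\<^sub>m 2"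
    by (auto simp: GL_carrier)
  then have "det2 x * det2 y = det2 (mat2 1 0 0 (1::'a))" by (metis det2_mult one_mat2)
  then show "x \<in> carrier_mat 2 2 \<and> det2 x \<noteq> 0" using xy by auto
next
  assume x: "x \<in> carrier_mat 2 2 \<and> det2 x \<noteq> 0"
  then obtain a b c d where abcd: "x = mat2 a b c d" using mat2_cases by blast
  define e where "e = a * d - b * c"
  have e: "e \<noteq> 0" using x by (simp add: abcd e_def)
  let ?y = "mat2 (d / e) (- b / e) (- c / e) (a / e)"
  have "a * d / e - b * c / e = 1" using e by (simp add: e_def flip: diff_divide_distrib)
  then have "?y * x = 1\<^sub>m 2" "x * ?y = 1\<^sub>m 2" by (simp_all add: abcd mat2_mult one_mat2 mult.commute)
  then show "x \<in> carrier GL2" using x by (auto simp: GL_carrier intro!: bexI[of _ ?y])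
qed

lemma GL2_mat2 [simp]: "mat2 a b c d \<in> carrier GL2 \<longleftrightarrow> a * d - b * c \<noteq> (0 :: 'a :: field)"
  by (simp add: GL2_carrier_iff)

lemma GL2_cases:
  assumes "x \<in> carrier GL2"
  obtains a b c d :: "'a :: field" where "x = mat2 a b c d" "a * d - b * c \<noteq> 0"
  using assms mat2_cases[of x] by (metis GL2_carrier_iff det2_mat2)

lemma fin_group_GL2: "fin_group (GL2 :: 'a :: {field,finite} mat monoid)"
proof (intro fin_group.intro fin_group_axioms.intro)
  show "group (GL2 :: 'a mat monoid)" by (rule GL_group)
  have "carrier GL2 \<subseteq> (\<lambda>(a, b, c, d). mat2 a b c d) ` (UNIV :: ('a \<times> 'a \<times> 'a \<times> 'a) set)"
  proof
    fix x :: "'a mat" assume "x \<in> carrier GL2"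
    then obtain a b c d where "x = (\<lambda>(a, b, c, d). mat2 a b c d) (a, b, c, d)" by (auto elim: GL2_cases)
    then show "x \<in> range (\<lambda>(a, b, c, d). mat2 a b c d)" by (rule range_eqI)
  qed
  then show "finite (carrier (GL2 :: 'a mat monoid))" by (rule finite_subset) simp
qed

interpretation GL2: fin_group "GL2 :: 'a :: {field,finite} mat monoid"
  by (rule fin_group_GL2)

section \<open>Conjugacy of matrices through trace and determinant\<close>

lemma det2_conj:
  fixes x g :: "'a :: {field,finite} mat"
  assumes "x \<in> carrier GL2" "g \<in> carrier GL2"
  shows "det2 (ginv g \<star> x \<star> g) = det2 x" "tr2 (ginv g \<star> x \<star> g) = tr2 x"
proof -
  let ?i = "ginv g"
  have i: "?i \<in> carrier GL2" using assms by simp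
  have c: "x \<in> carrier_mat 2 2" "g \<in> carrier_mat 2 2" "?i \<in> carrier_mat 2 2"
    using assms i by (simp_all add: GL2_carrier_iff)
  have gi: "g * ?i = 1\<^sub>m 2" using GL2.r_inv[OF assms(2)] by (simp add: GL2_mult GL2_one one_mat2)
  have "det2 g * det2 ?i = det2 (mat2 1 0 0 (1::'a))" using gi det2_mult[OF c(2,3)] by (simp add: one_mat2)
  then show "det2 (?i \<star> x \<star> g) = det2 x"
    using c by (simp add: GL2_mult det2_mult mult_carrier_mat[of _ 2 2 _ 2] mult_ac)
  have "tr2 (?i * x * g) = tr2 (g * (?i * x))" using c by (intro tr2_comm) auto
  also have "g * (?i * x) = x" using c gi by (simp flip: assoc_mult_mat)
  finally show "tr2 (?i \<star> x \<star> g) = tr2 x" by (simp add: GL2_mult)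
qed

abbreviation sc :: "'a::zero \<Rightarrow> 'a mat" where "sc s \<equiv> mat2 s 0 0 s"

definition nonscalar :: "'a::zero mat \<Rightarrow> bool" where "nonscalar x \<longleftrightarrow> (\<forall>s. x \<noteq> sc s)"

lemma nonscalar_mat2 [simp]: "nonscalar (mat2 a b c d) \<longleftrightarrow> b \<noteq> 0 \<or> c \<noteq> 0 \<or> a \<noteq> d"
  by (auto simp: nonscalar_def)

lemma GL2_conjI:
  fixes x y g :: "'a :: {field,finite} mat"
  assumes "x \<in> carrier GL2" "y \<in> carrier GL2" "g \<in> carrier GL2" "x * g = g * y"
  shows "ginv g \<star> x \<star> g = y"
proof -
  have "ginv g \<star> x \<star> g = ginv g \<star> (g \<star> y)"
    using assms by (simp add: GL2.m_assoc) (simp add: GL2_mult)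
  also have "\<dots> = y" using assms by (simp add: GL2.m_assoc[symmetric])
  finally show ?thesis .
qed

lemma GL2_conj_iff:
  fixes x y g :: "'a :: {field,finite} mat"
  assumes "x \<in> carrier GL2" "y \<in> carrier GL2" "g \<in> carrier GL2"
  shows "ginv g \<star> x \<star> g = y \<longleftrightarrow> x * g = g * y"
proof
  assume "ginv g \<star> x \<star> g = y"
  then have "g \<star> y = g \<star> (ginv g \<star> x \<star> g)" by simp
  also have "\<dots> = x \<star> g" using assms by (simp add: GL2.m_assoc[symmetric])
  finally show "x * g = g * y" using assms by (simp add: GL2_mult)
qed (rule GL2_conjI[OF assms])

text \<open>A nonscalar matrix has a cyclic vector, and in the basis formed by that vector and its
  image it becomes a companion matrix. This treats all noncentral classes at once and in every
  characteristic.\<close>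

lemma nonscalar_conj_companion:
  fixes x :: "'a :: {field,finite} mat"
  assumes "x \<in> carrier GL2" "nonscalar x"
  obtains g where "g \<in> carrier GL2" "ginv g \<star> x \<star> g = mat2 0 (- det2 x) 1 (tr2 x)"
proof -
  obtain a b c d where x: "x = mat2 a b c d" "a * d - b * c \<noteq> 0" using GL2_cases[OF assms(1)] by metis
  have y: "mat2 0 (- det2 x) 1 (tr2 x) \<in> carrier GL2" using x by simp
  \<comment> \<open>The columns are a vector and its image under \<open>x\<close>, the vector being
    the first basis vector, the second, or their sum: the first of these that is not an
    eigenvector.\<close>
  define g where "g = (if c \<noteq> 0 then mat2 1 a 0 c else if b \<noteq> 0 then mat2 0 b 1 d else mat2 1 a 1 d)"
  have g: "g \<in> carrier GL2" using assms(2) x by (auto simp: g_def)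
  have "x * g = g * mat2 0 (- det2 x) 1 (tr2 x)"
    using x by (auto simp: g_def mat2_mult algebra_simps)
  then show ?thesis using GL2_conjI[OF assms(1) y g] that g by blast
qed

lemma nonscalar_conj:
  fixes x y :: "'a :: {field,finite} mat"
  assumes "x \<in> carrier GL2" "nonscalar x" "y \<in> carrier GL2" "nonscalar y" "tr2 x = tr2 y" "det2 x = det2 y"
  obtains g where "g \<in> carrier GL2" "ginv g \<star> x \<star> g = y"
proof -
  obtain g where g: "g \<in> carrier GL2" "ginv g \<star> x \<star> g = mat2 0 (- det2 x) 1 (tr2 x)"
    by (rule nonscalar_conj_companion[OF assms(1,2)])
  obtain h where h: "h \<in> carrier GL2" "ginv h \<star> y \<star> h = mat2 0 (- det2 x) 1 (tr2 x)"
    using nonscalar_conj_companion[OF assms(3,4)] assms(5,6) by metis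
  let ?k = "g \<star> ginv h"
  have hz: "h \<star> (ginv h \<star> z) = z" if "z \<in> carrier GL2" for z
    using that h(1) by (simp add: GL2.m_assoc[symmetric])
  have "ginv ?k \<star> x \<star> ?k = h \<star> (ginv g \<star> x \<star> g) \<star> ginv h"
    using g(1) h(1) assms by (simp add: GL2.inv_mult_group GL2.m_assoc)
  also have "\<dots> = h \<star> (ginv h \<star> y \<star> h) \<star> ginv h"
    by (simp only: g(2) h(2))
  also have "\<dots> = y" using h(1) assms by (simp add: GL2.m_assoc hz)
  finally show ?thesis using that[of ?k] g h by simp
qed

abbreviation J :: "'a :: {field,finite} mat \<Rightarrow> 'a mat \<Rightarrow> complex" where "J \<equiv> GL2.conj_count"

lemma J_cong:
  fixes x y z :: "'a :: {field,finite} mat"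
  assumes "y \<in> carrier GL2" "nonscalar y" "z \<in> carrier GL2" "nonscalar z" "tr2 y = tr2 z" "det2 y = det2 z"
    and "x \<in> carrier GL2"
  shows "J y x = J z x"
proof -
  obtain g where g: "g \<in> carrier GL2" "ginv g \<star> y \<star> g = z"
    by (rule nonscalar_conj[OF assms(1-6)])
  show ?thesis using GL2.conj_count_conj[OF g(1) assms(1,7)] g(2) by simp
qed

lemma virt_nonscalar_cong:
  fixes y z :: "'a :: {field,finite} mat"
  assumes "virt GL2 f" "y \<in> carrier GL2" "nonscalar y" "z \<in> carrier GL2" "nonscalar z" "tr2 y = tr2 z" "det2 y = det2 z"
  shows "f y = f z"
proof -
  obtain g where "g \<in> carrier GL2" "ginv g \<star> y \<star> g = z"
    by (rule nonscalar_conj[OF assms(2-7)])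
  then show ?thesis using GL2.virt_conj[OF assms(1,2)] by metis
qed

lemma J_eq_0:
  fixes x y :: "'a :: {field,finite} mat"
  assumes "x \<in> carrier GL2" "tr2 x \<noteq> tr2 y \<or> det2 x \<noteq> det2 y"
  shows "J y x = 0"
proof -
  have "{g \<in> carrier GL2. ginv g \<star> x \<star> g = y} = {}"
    using det2_conj[OF assms(1)] assms(2) by auto
  then show ?thesis unfolding GL2.conj_count_def by (simp only: card.empty of_nat_0)
qed

lemma sc_commute: "g \<in> carrier_mat 2 2 \<Longrightarrow> sc s * g = g * sc (s :: 'a :: comm_ring_1)"
  by (elim mat2_cases) (simp add: mat2_mult mult.commute)

lemma sc_conj:
  fixes g :: "'a :: {field,finite} mat"
  assumes "s \<noteq> 0" "g \<in> carrier GL2"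
  shows "ginv g \<star> sc s \<star> g = sc s"
  using assms by (intro GL2_conjI sc_commute) (simp_all add: GL2_carrier_iff)

lemma J_sc:
  fixes y :: "'a :: {field,finite} mat"
  assumes "s \<noteq> 0"
  shows "J y (sc s) = (if y = sc s then of_nat (Coset.order (GL2 :: 'a mat monoid)) else 0)"
proof -
  have "{g \<in> carrier GL2. ginv g \<star> sc s \<star> g = y} = (if y = sc s then carrier GL2 else {})"
    using sc_conj[OF assms] by auto
  then show ?thesis unfolding GL2.conj_count_def by (simp add: Coset.order_def)
qed

lemma nonscalar_conj_inv:
  fixes x g :: "'a :: {field,finite} mat"
  assumes "x \<in> carrier GL2" "g \<in> carrier GL2" "nonscalar x"
  shows "nonscalar (ginv g \<star> x \<star> g)"
proof (unfold nonscalar_def, rule ccontr)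
  assume "\<not> (\<forall>s. ginv g \<star> x \<star> g \<noteq> sc s)"
  then obtain s where s: "ginv g \<star> x \<star> g = sc s" by auto
  have scG: "sc s \<in> carrier GL2" using assms GL2.m_closed by (metis s GL2.inv_closed)
  then have s0: "s \<noteq> 0" by auto
  have "x * g = g * sc s" using GL2_conj_iff[OF assms(1) scG assms(2)] s by simp
  also have "\<dots> = sc s * g" using assms sc_commute by (metis GL2_carrier_iff)
  finally have "x \<star> g = sc s \<star> g" by (simp add: GL2_mult)
  then have "x = sc s" using assms s0 by simp
  then show False using assms(3) by (simp add: nonscalar_def)
qed

lemma J_sc_nonscalar:
  fixes x :: "'a :: {field,finite} mat"
  assumes "x \<in> carrier GL2" "nonscalar x"
  shows "J (sc s) x = 0"
proof -
  have "{g \<in> carrier GL2. ginv g \<star> x \<star> g = sc s} = {}"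
    using nonscalar_conj_inv[OF assms(1) _ assms(2)] by (auto simp: nonscalar_def)
  then show ?thesis unfolding GL2.conj_count_def by (simp only: card.empty of_nat_0)
qed

abbreviation units :: "'a::zero set" where "units \<equiv> UNIV - {0}"

text \<open>Matrices are sorted by whether the upper left entry vanishes. If it does not, the first
  row, the lower left entry and the determinant \<open>e\<close> serve as independent
  coordinates.\<close>

lemma order_GL2:
  "Coset.order (GL2 :: 'a :: {field,finite} mat monoid) = CARD('a) * (CARD('a) - 1)^2 * (CARD('a) + 1)"
proof -
  let ?q = "CARD('a)"
  have q: "?q > 0" by simp
  define S1 where "S1 = (\<lambda>(a, b, c, e). mat2 a b c ((e + b * c) / a)) ` ((units :: 'a set) \<times> UNIV \<times> UNIV \<times> (units :: 'a set))"
  define S2 where "S2 = (\<lambda>(b, c, d). mat2 0 b c d) ` ((units :: 'a set) \<times> (units :: 'a set) \<times> UNIV)"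
  have "carrier (GL2 :: 'a mat monoid) = S1 \<union> S2"
  proof (intro equalityI subsetI)
    fix x :: "'a mat" assume "x \<in> carrier GL2"
    then obtain a b c d where x: "x = mat2 a b c d" "a * d - b * c \<noteq> 0" by (rule GL2_cases)
    show "x \<in> S1 \<union> S2"
    proof (cases "a = 0")
      case True
      then have "x = (\<lambda>(b, c, d). mat2 0 b c d) (b, c, d)" using x by simp
      then show ?thesis using True x unfolding S2_def by (intro UnI2 image_eqI[of _ _ "(b, c, d)"]) auto
    next
      case False
      then have "x = (\<lambda>(a, b, c, e). mat2 a b c ((e + b * c) / a)) (a, b, c, a * d - b * c)" using x by simp
      then show ?thesis using False x unfolding S1_def
        by (intro UnI1 image_eqI[of _ _ "(a, b, c, a * d - b * c)"]) auto
    qed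
  qed (auto simp: S1_def S2_def)
  moreover have "S1 \<inter> S2 = {}" by (auto simp: S1_def S2_def)
  moreover have "card S1 = (?q - 1) * (?q * (?q * (?q - 1)))"
    unfolding S1_def by (subst card_image) (auto simp: inj_on_def card_cartesian_product card_Diff_singleton field_simps)
  moreover have "card S2 = (?q - 1) * ((?q - 1) * ?q)"
    unfolding S2_def by (subst card_image) (auto simp: inj_on_def card_cartesian_product card_Diff_singleton)
  moreover have "finite S1" "finite S2" by (auto simp: S1_def S2_def)
  ultimately have "Coset.order (GL2 :: 'a mat monoid) = (?q - 1) * (?q * (?q * (?q - 1))) + (?q - 1) * ((?q - 1) * ?q)"
    by (simp add: Coset.order_def card_Un_disjoint)
  also have "\<dots> = ?q * (?q - 1)^2 * (?q + 1)"
  proof -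
    have "(m - 1) * (m * (m * (m - 1))) + (m - 1) * ((m - 1) * m) = m * (m - 1)^2 * (m + 1)" for m :: nat
      by (cases m) (simp_all add: power2_eq_square algebra_simps)
    then show ?thesis .
  qed
  finally show ?thesis .
qed

text \<open>What split and nonsplit tori have in common, so that halving is carried out once.
  Conditions \<open>centralizer\<close> and \<open>conj\<close> say that \<open>X\<close> and its
  coset by \<open>w\<close> control all fusion in \<open>X\<close>; condition \<open>coset\<close>
  makes the defect depend on determinants alone. They are phrased with plain matrix products so that
  they can be checked entry by entry.\<close>

locale gl2_torus =
  fixes X :: "'a :: {field,finite} mat set" and w :: "'a mat"
  assumes X: "subgroup X GL2" and comm: "\<And>x y. x \<in> X \<Longrightarrow> y \<in> X \<Longrightarrow> x * y = y * x"
    and w: "w \<in> carrier GL2" "w \<notin> X" "w * w = mat2 1 0 0 1"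
    and wX: "\<And>x. x \<in> X \<Longrightarrow> w * x * w \<in> X"
    and sc: "\<And>s. s \<noteq> 0 \<Longrightarrow> sc s \<in> X"
    and centralizer: "\<And>t g. t \<in> X \<Longrightarrow> nonscalar t \<Longrightarrow> g \<in> carrier GL2 \<Longrightarrow> t * g = g * t \<Longrightarrow> g \<in> X"
    and conj: "\<And>t t'. t \<in> X \<Longrightarrow> t' \<in> X \<Longrightarrow> nonscalar t \<Longrightarrow> tr2 t = tr2 t' \<Longrightarrow> det2 t = det2 t' \<Longrightarrow> t' = t \<or> t' = w * t * w"
    and coset: "\<And>k. k \<in> X \<Longrightarrow> nonscalar (k * w) \<and> tr2 (k * w) = 0 \<and> det2 (k * w) = - det2 k"
begin

text \<open>For a nonscalar \<open>t\<close> in \<open>X\<close> the elements that conjugate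
  \<open>t\<close> into \<open>X\<close> are those of \<open>X\<close> and of its coset by
  \<open>w\<close>, twice \<open>card X\<close> in number; a class that misses \<open>X\<close>
  contributes nothing.\<close>

lemma perm_char_torus:
  assumes x: "x \<in> carrier GL2" "nonscalar x"
  shows "GL2.perm_char X x = (if \<exists>t\<in>X. tr2 t = tr2 x \<and> det2 t = det2 x \<and> nonscalar t then 2 else 0)"
proof (cases "\<exists>t\<in>X. tr2 t = tr2 x \<and> det2 t = det2 x \<and> nonscalar t")
  case False
  have "{g \<in> carrier GL2. ginv g \<star> x \<star> g \<in> X} = {}"
    using False det2_conj[OF x(1)] nonscalar_conj_inv[OF x(1) _ x(2)] by fastforce
  then have "GL2.perm_char X x = 0" unfolding GL2.perm_char_def by (simp only: card.empty of_nat_0 div_0)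
  then show ?thesis using False by (simp only: if_False)
next
  case True
  then obtain t where t: "t \<in> X" "tr2 t = tr2 x" "det2 t = det2 x" "nonscalar t" by auto
  interpret XS: subgroup X GL2 by (rule X)
  have tG: "t \<in> carrier GL2" by (rule XS.mem_carrier[OF t(1)])
  obtain h where h: "h \<in> carrier GL2" "ginv h \<star> t \<star> h = x"
    by (rule nonscalar_conj[OF tG t(4) x t(2,3)])
  have "GL2.perm_char X x = GL2.perm_char X t"
    using GL2.virt_conj[OF GL2.virt_perm_char[OF X] tG h(1)] h(2) by simp
  have ww: "w \<star> w = \<one>\<^bsub>GL2\<^esub>" using w(3) by (simp add: GL2_mult GL2_one)
  have invw: "ginv w = w" using ww w(1) by (simp add: GL2.inv_equality)
  have wwz: "z \<star> w \<star> w = z" if "z \<in> carrier GL2" for z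
    using that ww w(1) by (simp add: GL2.m_assoc)
  have wwl: "w \<star> (w \<star> z) = z" if "z \<in> carrier GL2" for z
    using that ww w(1) by (simp add: GL2.m_assoc[symmetric])
  let ?L = "(\<lambda>k. k \<star> w) ` X"
  have fixt: "ginv k \<star> t \<star> k = t" if "k \<in> X" for k
    using comm[OF t(1) that] tG XS.mem_carrier[OF that] by (intro GL2_conjI)
  have "{g \<in> carrier GL2. ginv g \<star> t \<star> g \<in> X} = X \<union> ?L"
  proof (intro equalityI subsetI)
    fix g assume "g \<in> {g \<in> carrier GL2. ginv g \<star> t \<star> g \<in> X}"
    then have g: "g \<in> carrier GL2" and tg: "ginv g \<star> t \<star> g \<in> X" by auto
    consider "ginv g \<star> t \<star> g = t" | "ginv g \<star> t \<star> g = w * t * w"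
      using conj[OF t(1) tg t(4)] det2_conj[OF tG g] by auto
    then show "g \<in> X \<union> ?L"
    proof cases
      case 1
      then have "t * g = g * t" using GL2_conj_iff[OF tG tG g] by simp
      then show ?thesis using centralizer[OF t(1,4) g] by simp
    next
      case 2
      \<comment> \<open>If \<open>g\<close> carries \<open>t\<close> to its conjugate by
        \<open>w\<close>, then \<open>g \<star> w\<close> centralises \<open>t\<close>.\<close>
      let ?g = "g \<star> w"
      have g': "?g \<in> carrier GL2" using g w by simp
      have "ginv ?g \<star> t \<star> ?g = w \<star> (ginv g \<star> t \<star> g) \<star> w"
        using g w(1) tG invw by (simp add: GL2.inv_mult_group GL2.m_assoc)
      also have "ginv g \<star> t \<star> g = w \<star> t \<star> w" using 2 by (simp add: GL2_mult)
      also have "w \<star> (w \<star> t \<star> w) \<star> w = t"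
        using tG w(1) ww by (simp add: GL2.m_assoc wwl)
      finally have "t * ?g = ?g * t" using GL2_conj_iff[OF tG tG g'] by simp
      then have "?g \<in> X" using centralizer[OF t(1,4) g'] by simp
      moreover have "g = ?g \<star> w" using wwz[OF g] by simp
      ultimately show ?thesis by blast
    qed
  next
    fix g assume "g \<in> X \<union> ?L"
    then show "g \<in> {g \<in> carrier GL2. ginv g \<star> t \<star> g \<in> X}"
    proof
      assume "g \<in> X"
      then show ?thesis using fixt[of g] t(1) XS.mem_carrier[of g] by simp
    next
      assume "g \<in> ?L"
      then obtain k where k: "k \<in> X" "g = k \<star> w" by auto
      have kG: "k \<in> carrier GL2" by (rule XS.mem_carrier[OF k(1)])
      have "ginv g \<star> t \<star> g = w \<star> (ginv k \<star> t \<star> k) \<star> w"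
        using kG w(1) tG invw by (simp add: k(2) GL2.inv_mult_group GL2.m_assoc)
      also have "\<dots> = w * t * w" unfolding fixt[OF k(1)] by (simp add: GL2_mult)
      finally show ?thesis using wX[OF t(1)] kG w(1) k(2) by simp
    qed
  qed
  moreover have "card (X \<union> ?L) = 2 * card X"
  proof -
    have finX: "finite X" using finite_subset[OF XS.subset GL2.fin] .
    have inj: "inj_on (\<lambda>k. k \<star> w) X" using w(1) XS.mem_carrier by (auto simp: inj_on_def)
    have "X \<inter> ?L = {}"
    proof (rule ccontr)
      assume "X \<inter> ?L \<noteq> {}"
      then obtain k where k: "k \<in> X" "k \<star> w \<in> X" by auto
      have kG: "k \<in> carrier GL2" by (rule XS.mem_carrier[OF k(1)])
      have "ginv k \<star> (k \<star> w) \<in> X" by (rule XS.m_closed[OF XS.m_inv_closed[OF k(1)] k(2)])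
      moreover have "ginv k \<star> (k \<star> w) = w" using kG w(1) by (simp add: GL2.m_assoc[symmetric])
      ultimately show False using w(2) by simp
    qed
    then show ?thesis using finX by (simp add: card_Un_disjoint card_image[OF inj])
  qed
  moreover have "card X \<noteq> 0"
    using finite_subset[OF XS.subset GL2.fin] XS.one_closed by (metis card_0_eq empty_iff)
  ultimately have "GL2.perm_char X t = 2" unfolding GL2.perm_char_def by simp
  then show ?thesis using True \<open>GL2.perm_char X x = GL2.perm_char X t\<close> by simp
qed

lemma perm_char_torus_sc:
  assumes "s \<noteq> 0"
  shows "GL2.perm_char X (sc s) = of_nat (Coset.order (GL2 :: 'a mat monoid)) / of_nat (card X)"
proof -
  have "{g \<in> carrier GL2. ginv g \<star> sc s \<star> g \<in> X} = carrier GL2"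
    using sc_conj[OF assms] sc[OF assms] by auto
  then show ?thesis unfolding GL2.perm_char_def by (simp add: Coset.order_def)
qed

text \<open>Both matrices are nonscalar with trace 0 and determinant \<open>- det2 k\<close>. The
  companion matrix on the right serves as a representative common to both tori.\<close>

lemma J_coset:
  assumes "k \<in> X" "x \<in> carrier GL2"
  shows "J (k \<star> w) x = J (mat2 0 (det2 k) 1 0) x"
proof (rule J_cong)
  have kG: "k \<in> carrier GL2" using subgroup.mem_carrier[OF X assms(1)] .
  then show "k \<star> w \<in> carrier GL2" using w by simp
  have "det2 k \<noteq> 0" using kG by (simp add: GL2_carrier_iff)
  then show "mat2 0 (det2 k) 1 0 \<in> carrier GL2" by simp
qed (use coset[OF assms(1)] assms(2) in \<open>simp_all add: GL2_mult\<close>)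

end

section \<open>Split and nonsplit tori\<close>

definition split_torus :: "'a::zero mat set" where
  "split_torus = (\<lambda>(a, d). mat2 a 0 0 d) ` (units \<times> units)"

lemma split_torus_mem [simp]: "mat2 a b c d \<in> split_torus \<longleftrightarrow> a \<noteq> 0 \<and> d \<noteq> 0 \<and> b = 0 \<and> c = 0"
  by (auto simp: split_torus_def)

lemma split_torusE:
  assumes "x \<in> split_torus"
  obtains a d where "x = mat2 a 0 0 d" "a \<noteq> 0" "d \<noteq> 0"
  using assms by (auto simp: split_torus_def)

lemma card_split_torus: "card (split_torus :: 'a :: {finite,zero} mat set) = (CARD('a) - 1) * (CARD('a) - 1)"
  unfolding split_torus_def by (subst card_image) (auto simp: inj_on_def card_cartesian_product card_Diff_singleton)

interpretation split: gl2_torus "split_torus :: 'a :: {field,finite} mat set" "mat2 0 1 1 0"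
proof (rule gl2_torus.intro)
  show "subgroup split_torus (GL2 :: 'a mat monoid)"
    by (rule GL2.submonoid_imp_subgroup) (auto simp: GL2_one elim!: split_torusE)
  show "t' = t \<or> t' = mat2 0 1 1 0 * t * mat2 0 1 1 0"
    if mem: "t \<in> split_torus" "t' \<in> split_torus" and tr: "tr2 t = tr2 t'" "det2 t = det2 t'" for t t' :: "'a mat"
  proof -
    obtain a d where t: "t = mat2 a 0 0 d" using mem(1) by (rule split_torusE)
    obtain a' d' where t': "t' = mat2 a' 0 0 d'" using mem(2) by (rule split_torusE)
    have eq: "a + d = a' + d'" "a * d = a' * d'" using tr by (simp_all add: t t')
    \<comment> \<open>\<open>a'\<close> is a root of the polynomial with roots \<open>a\<close> and
      \<open>d\<close>, so the diagonal entries agree up to order.\<close>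
    have "(a' - a) * (a' - d) = a' * a' - a' * (a + d) + a * d" by (simp add: algebra_simps)
    also have "\<dots> = 0" unfolding eq by (simp add: algebra_simps)
    finally have "a' = a \<or> a' = d" by simp
    then show ?thesis using eq by (auto simp: t t' mat2_mult)
  qed
qed (auto simp: mat2_mult elim!: split_torusE GL2_cases)

text \<open>A quadratic polynomial with trace \<open>t0\<close> and norm \<open>n0\<close> of a root
  \<alpha>. The quadratic extension is handled by coordinates with respect to 1 and \<alpha> rather
  than as a type.\<close>

locale irreducible_quadratic =
  fixes t0 n0 :: "'a :: {field,finite}"
  assumes no_root: "r * r - t0 * r + n0 \<noteq> 0"
begin

text \<open>The matrix of multiplication by \<open>x + y * \<alpha>\<close> in the basis 1,
  \<alpha>, where \<alpha> satisfies
  \<open>\<alpha> * \<alpha> = t0 * \<alpha> - n0\<close>.\<close>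

definition elt :: "'a \<Rightarrow> 'a \<Rightarrow> 'a mat" where "elt x y = mat2 x (- n0 * y) y (x + t0 * y)"

text \<open>The norm form of the quadratic extension.\<close>

definition nrm :: "'a \<Rightarrow> 'a \<Rightarrow> 'a" where "nrm x y = x * x + t0 * x * y + n0 * y * y"

definition nonsplit_torus :: "'a mat set" where
  "nonsplit_torus = (\<lambda>(x, y). elt x y) ` (UNIV - {(0, 0)})"

text \<open>For \<open>y \<noteq> 0\<close> the form is \<open>y * y\<close> times the quadratic at
  \<open>- x / y\<close>, so absence of roots means that the form is anisotropic.\<close>

lemma nrm_eq_0: "nrm x y = 0 \<longleftrightarrow> x = 0 \<and> y = 0"
proof
  assume n: "nrm x y = 0"
  show "x = 0 \<and> y = 0"
  proof (cases "y = 0")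
    case True
    then show ?thesis using n by (simp add: nrm_def)
  next
    case False
    have "y * y * ((- x / y) * (- x / y) - t0 * (- x / y) + n0) = nrm x y"
      using False by (simp add: nrm_def field_simps)
    then show ?thesis using n no_root[of "- x / y"] False by simp
  qed
qed (simp add: nrm_def)

lemma nrm_mult: "nrm (x * x' - n0 * y * y') (x * y' + y * x' + t0 * y * y') = nrm x y * nrm x' y'"
  by (simp add: nrm_def algebra_simps)

lemma elt_mult: "elt x y * elt x' y' = elt (x * x' - n0 * y * y') (x * y' + y * x' + t0 * y * y')"
  by (simp add: elt_def mat2_mult algebra_simps)

lemma det2_elt: "det2 (elt x y) = nrm x y" and tr2_elt: "tr2 (elt x y) = x + x + t0 * y"
  by (simp_all add: elt_def nrm_def algebra_simps)

lemma elt_eq_iff: "elt x y = elt x' y' \<longleftrightarrow> x = x' \<and> y = y'"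
  by (auto simp: elt_def)

lemma nonscalar_elt: "nonscalar (elt x y) \<longleftrightarrow> y \<noteq> 0"
  by (auto simp: elt_def)

lemma nonsplit_torus_mem: "elt x y \<in> nonsplit_torus \<longleftrightarrow> nrm x y \<noteq> 0"
  by (auto simp: nonsplit_torus_def elt_eq_iff nrm_eq_0)

lemma nonsplit_torusE:
  assumes "t \<in> nonsplit_torus"
  obtains x y where "t = elt x y" "nrm x y \<noteq> 0"
  using assms by (auto simp: nonsplit_torus_def nrm_eq_0)

lemma card_nonsplit_torus: "card nonsplit_torus = CARD('a) * CARD('a) - 1"
  unfolding nonsplit_torus_def
  by (subst card_image) (auto simp: inj_on_def elt_eq_iff card_Diff_singleton)

text \<open>In characteristic 2 squaring is injective, hence surjective on a finite field, so a
  quadratic without linear term would have a root. In the excluded case the involution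
  \<open>mat2 1 t0 0 (-1)\<close> would be the identity.\<close>

lemma separable: "\<not> (t0 = 0 \<and> (1::'a) + 1 = 0)"
proof
  assume a: "t0 = 0 \<and> (1::'a) + 1 = 0"
  have dbl: "z + z = 0" for z :: 'a
    using a by (metis distrib_left mult.right_neutral mult_zero_right)
  have "inj (\<lambda>z::'a. z * z)"
  proof (rule injI)
    fix x y :: 'a assume "x * x = y * y"
    then have "(x - y) * (x - y) = (y + y) * (y - x)" by (simp add: algebra_simps)
    then show "x = y" using dbl by simp
  qed
  then have "surj (\<lambda>z::'a. z * z)" by (simp add: finite_UNIV_inj_surj)
  then obtain r where "r * r = n0" by (metis surjD)
  then have "r * r - t0 * r + n0 = 0" using a dbl by simp
  then show False using no_root by blast
qed

text \<open>The involution is the matrix of the nontrivial automorphism of the extension, which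
  sends \<alpha> to \<open>t0 - \<alpha>\<close>; conjugation by it applies the automorphism to the
  field element.\<close>

lemma elt_conj: "mat2 1 t0 0 (-1) * elt x y * mat2 1 t0 0 (-1) = elt (x + t0 * y) (- y)"
  by (simp add: elt_def mat2_mult algebra_simps)

text \<open>If z' has the trace and the norm of z, it is a root of the polynomial with roots z and
  its conjugate, so one of the two differences is zero. In coordinates the norm form detects which
  factors of a vanishing product vanish.\<close>

lemma elt_same_char_poly:
  assumes tr: "x + x + t0 * y = x' + x' + t0 * y'" and n: "nrm x y = nrm x' y'"
  shows "(x' = x \<and> y' = y) \<or> (x' = x + t0 * y \<and> y' = - y)"
proof -
  \<comment> \<open>Coordinates of z' - z and of z' minus the conjugate of z. The coordinates of
    their product are combinations of the trace difference \<open>u\<close> and the norm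
    difference.\<close>
  let ?A = "x' - x" and ?B = "y' - y" and ?C = "x' - x - t0 * y" and ?D = "y' + y"
  define u where "u = (x' + x' + t0 * y') - (x + x + t0 * y)"
  have u: "u = 0" using tr by (simp add: u_def)
  have "?A * ?C - n0 * ?B * ?D = x' * u - (nrm x' y' - nrm x y)"
    by (simp add: u_def nrm_def algebra_simps)
  moreover have "?A * ?D + ?B * ?C + t0 * ?B * ?D = y' * u"
    by (simp add: u_def algebra_simps)
  ultimately have "nrm ?A ?B * nrm ?C ?D = nrm 0 0" using nrm_mult[of ?A ?C ?B ?D] u n by simp
  then have "nrm ?A ?B = 0 \<or> nrm ?C ?D = 0" by (simp add: nrm_def)
  then show ?thesis unfolding nrm_eq_0 by (auto simp: algebra_simps eq_neg_iff_add_eq_0)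
qed

sublocale nonsplit: gl2_torus nonsplit_torus "mat2 1 t0 0 (-1)"
proof (rule gl2_torus.intro)
  show "subgroup nonsplit_torus (GL2 :: 'a mat monoid)"
  proof (rule GL2.submonoid_imp_subgroup)
    show "nonsplit_torus \<subseteq> carrier GL2"
    proof
      fix t assume "t \<in> nonsplit_torus"
      then obtain x y where "t = elt x y" "nrm x y \<noteq> 0" by (rule nonsplit_torusE)
      then show "t \<in> carrier GL2" using det2_elt[of x y] by (simp add: GL2_carrier_iff elt_def)
    qed
    have "\<one>\<^bsub>GL2\<^esub> = elt 1 0" by (simp add: GL2_one elt_def)
    then show "\<one>\<^bsub>GL2\<^esub> \<in> nonsplit_torus" by (simp add: nonsplit_torus_mem nrm_eq_0)
    show "s \<star> t \<in> nonsplit_torus" if "s \<in> nonsplit_torus" "t \<in> nonsplit_torus" for s t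
      using that by (auto elim!: nonsplit_torusE simp: GL2_mult elt_mult nonsplit_torus_mem nrm_mult)
  qed
  show "s * t = t * s" if "s \<in> nonsplit_torus" "t \<in> nonsplit_torus" for s t
    using that by (auto elim!: nonsplit_torusE simp: elt_mult elt_eq_iff algebra_simps)
  show "mat2 1 t0 0 (-1) \<in> carrier GL2" by simp
  show "mat2 1 t0 0 (-1) \<notin> nonsplit_torus"
  proof
    assume "mat2 1 t0 0 (-1) \<in> nonsplit_torus"
    then obtain x y where "mat2 1 t0 0 (-1) = elt x y" by (rule nonsplit_torusE)
    then have "t0 = 0" "(-1::'a) = 1" by (auto simp: elt_def)
    then show False using separable by (metis add.right_inverse)
  qed
  show "mat2 1 t0 0 (-1) * mat2 1 t0 0 (-1) = mat2 1 0 0 1" by (simp add: mat2_mult)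
  show "mat2 1 t0 0 (-1) * t * mat2 1 t0 0 (-1) \<in> nonsplit_torus" if t: "t \<in> nonsplit_torus" for t
  proof -
    obtain x y where "t = elt x y" "nrm x y \<noteq> 0" using t by (rule nonsplit_torusE)
    then show ?thesis by (auto simp: elt_conj nonsplit_torus_mem nrm_eq_0)
  qed
  show "sc s \<in> nonsplit_torus" if "s \<noteq> 0" for s
  proof -
    have "sc s = elt s 0" by (simp add: elt_def)
    then show ?thesis using that by (simp add: nonsplit_torus_mem nrm_eq_0)
  qed
  show "g \<in> nonsplit_torus" if t: "t \<in> nonsplit_torus" and ns: "nonscalar t" and g: "g \<in> carrier GL2" and eq: "t * g = g * t" for t g
  proof -
    obtain x y where xy: "t = elt x y" "nrm x y \<noteq> 0" using t by (rule nonsplit_torusE)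
    have y: "y \<noteq> 0" using ns xy(1) nonscalar_elt by simp
    obtain p q r s where pqrs: "g = mat2 p q r s" "p * s - q * r \<noteq> 0" using g by (rule GL2_cases)
    have "x * p + - n0 * y * r = p * x + q * y" "y * p + (x + t0 * y) * r = r * x + s * y"
      using eq by (simp_all add: xy(1) pqrs(1) elt_def mat2_mult)
    \<comment> \<open>With \<open>y \<noteq> 0\<close> the relations determine the second column of
      \<open>g\<close> from the first, exactly as in \<open>elt p r\<close>.\<close>
    then have "y * (q + n0 * r) = 0" "y * (s - (p + t0 * r)) = 0" by (simp_all add: algebra_simps)
    then have "q = - n0 * r" "s = p + t0 * r" using y by (simp_all add: eq_neg_iff_add_eq_0)
    then have "g = elt p r" by (simp add: pqrs(1) elt_def)
    moreover have "nrm p r \<noteq> 0" using pqrs(2) det2_elt[of p r] \<open>g = elt p r\<close> pqrs(1) by (metis det2_mat2)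
    ultimately show ?thesis by (simp add: nonsplit_torus_mem)
  qed
  show "t' = t \<or> t' = mat2 1 t0 0 (-1) * t * mat2 1 t0 0 (-1)"
    if t: "t \<in> nonsplit_torus" "t' \<in> nonsplit_torus" and eq: "tr2 t = tr2 t'" "det2 t = det2 t'" for t t'
  proof -
    obtain x y where xy: "t = elt x y" using t(1) by (rule nonsplit_torusE)
    obtain x' y' where xy': "t' = elt x' y'" using t(2) by (rule nonsplit_torusE)
    show ?thesis
      using elt_same_char_poly[of x y x' y'] eq by (auto simp: xy xy' tr2_elt det2_elt elt_eq_iff elt_conj)
  qed
  show "nonscalar (k * mat2 1 t0 0 (-1)) \<and> tr2 (k * mat2 1 t0 0 (-1)) = 0 \<and> det2 (k * mat2 1 t0 0 (-1)) = - det2 k"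
    if k: "k \<in> nonsplit_torus" for k
  proof -
    obtain x y where xy: "k = elt x y" "nrm x y \<noteq> 0" using k by (rule nonsplit_torusE)
    have "k * mat2 1 t0 0 (-1) = mat2 x (x * t0 + n0 * y) y (- x)"
      by (simp add: xy(1) elt_def mat2_mult algebra_simps)
    moreover have "nonscalar (mat2 x (x * t0 + n0 * y) y (- x))"
    proof (rule ccontr)
      assume "\<not> nonscalar (mat2 x (x * t0 + n0 * y) y (- x))"
      \<comment> \<open>A scalar value would force both \<open>t0 = 0\<close> and characteristic 2,
        which \<open>separable\<close> excludes.\<close>
      then have a: "y = 0" "x * t0 = 0" "x = - x" by auto
      then have "x \<noteq> 0" using xy(2) by (auto simp: nrm_eq_0)
      moreover have "x * (1 + 1) = 0" using a(3) by (auto simp: distrib_left eq_neg_iff_add_eq_0)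
      ultimately show False using separable a(2) by simp
    qed
    ultimately show ?thesis unfolding xy(1) det2_elt by (simp add: nrm_def algebra_simps)
  qed
qed

text \<open>The characteristic polynomial at \<open>r\<close> is the norm of a field element whose
  second coordinate \<open>y\<close> is nonzero.\<close>

lemma nonsplit_no_root:
  assumes "t \<in> nonsplit_torus" "nonscalar t"
  shows "r * r - tr2 t * r + det2 t \<noteq> 0"
proof -
  obtain x y where xy: "t = elt x y" using assms(1) by (rule nonsplit_torusE)
  have "r * r - tr2 t * r + det2 t = nrm (x - r) y"
    by (simp add: xy tr2_elt det2_elt nrm_def algebra_simps)
  then show ?thesis using assms(2) by (simp add: xy nonscalar_elt nrm_eq_0)
qed

lemma card_le_twice_image:
  assumes "finite A" and "\<And>a a'. a \<in> A \<Longrightarrow> a' \<in> A \<Longrightarrow> f a = f a' \<Longrightarrow> a' = a \<or> a' = s a"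
  shows "card A \<le> 2 * card (f ` A)"
proof -
  have "card A = (\<Sum>y\<in>f ` A. card {a \<in> A. f a = y})"
    using sum.image_gen[OF assms(1), of "\<lambda>_. 1::nat" f] by simp
  also have "\<dots> \<le> (\<Sum>y\<in>f ` A. 2)"
  proof (rule sum_mono)
    fix y assume "y \<in> f ` A"
    then obtain a where a: "a \<in> A" "y = f a" by auto
    have "{a' \<in> A. f a' = y} \<subseteq> {a, s a}"
    proof
      fix a' assume "a' \<in> {a' \<in> A. f a' = y}"
      then have "a' \<in> A" "f a = f a'" using a(2) by auto
      then show "a' \<in> {a, s a}" using assms(2)[OF a(1)] by blast
    qed
    then have "card {a' \<in> A. f a' = y} \<le> card {a, s a}" by (intro card_mono) auto
    also have "\<dots> \<le> 2" by (simp add: card_insert_if)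
    finally show "card {a' \<in> A. f a' = y} \<le> 2" .
  qed
  finally show ?thesis by simp
qed

text \<open>A count of pairs of trace and determinant over a field with q elements: \<open>D\<close>
  from double roots has q elements, \<open>S\<close> from distinct roots and \<open>E\<close> from
  nonscalar torus elements have at least (q^2 - q)/2 each, being images of maps at most two-to-one.
  The three sets are disjoint and so exhaust all q^2 pairs; a single quadratic therefore yields all
  irreducible ones.\<close>

lemma no_root_nonsplit:
  assumes "\<And>r. r * r - t * r + n \<noteq> 0"
  obtains e where "e \<in> nonsplit_torus" "nonscalar e" "tr2 e = t" "det2 e = n"
proof -
  define D where "D = (\<lambda>a::'a. (a + a, a * a)) ` UNIV"
  define A where "A = {(a::'a, b). a \<noteq> b}"
  define S where "S = (\<lambda>(a, b). (a + b, a * b)) ` A"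
  define B where "B = {(x::'a, y::'a). y \<noteq> 0}"
  define E where "E = (\<lambda>(x, y). (x + x + t0 * y, nrm x y)) ` B"
  have cA: "card A = CARD('a) * CARD('a) - CARD('a)"
  proof -
    have "A = UNIV - (\<lambda>a. (a, a)) ` UNIV" by (auto simp: A_def)
    then show ?thesis by (simp add: card_Diff_subset card_image inj_on_def)
  qed
  have cB: "card B = CARD('a) * CARD('a) - CARD('a)"
  proof -
    have "B = UNIV - (\<lambda>a. (a, 0)) ` UNIV" by (auto simp: B_def)
    then show ?thesis by (simp add: card_Diff_subset card_image inj_on_def)
  qed
  have sq: "b = c" if "b + b = c + c" "b * b = c * c" for b c :: 'a
  proof -
    have "(b - c) * (b - c) = (b * b - c * c) - c * ((b + b) - (c + c))" by (simp add: algebra_simps)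
    then show ?thesis using that by simp
  qed
  have cD: "card D = CARD('a)"
    unfolding D_def by (rule card_image) (auto simp: inj_on_def intro: sq)
  have cS: "card A \<le> 2 * card S" unfolding S_def
  proof (rule card_le_twice_image[where s = "\<lambda>(a, b). (b, a)"])
    fix p p' :: "'a \<times> 'a" assume eq: "(case p of (a, b) \<Rightarrow> (a + b, a * b)) = (case p' of (a, b) \<Rightarrow> (a + b, a * b))"
    obtain a b a' b' where p: "p = (a, b)" "p' = (a', b')" by (metis surj_pair)
    have e: "a + b = a' + b'" "a * b = a' * b'" using eq by (simp_all add: p)
    have "(a' - a) * (a' - b) = a' * a' - a' * (a + b) + a * b" by (simp add: algebra_simps)
    also have "\<dots> = 0" unfolding e by (simp add: algebra_simps)
    finally have "a' = a \<or> a' = b" by simp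
    then show "p' = p \<or> p' = (case p of (a, b) \<Rightarrow> (b, a))" using e by (auto simp: p)
  qed simp
  have cE: "card B \<le> 2 * card E" unfolding E_def
  proof (rule card_le_twice_image[where s = "\<lambda>(x, y). (x + t0 * y, - y)"])
    fix p p' :: "'a \<times> 'a" assume eq: "(case p of (x, y) \<Rightarrow> (x + x + t0 * y, nrm x y)) = (case p' of (x, y) \<Rightarrow> (x + x + t0 * y, nrm x y))"
    obtain x y x' y' where p: "p = (x, y)" "p' = (x', y')" by (metis surj_pair)
    show "p' = p \<or> p' = (case p of (x, y) \<Rightarrow> (x + t0 * y, - y))"
      using elt_same_char_poly[of x y x' y'] eq by (auto simp: p)
  qed simp
  have DS: "D \<inter> S = {}"
  proof (rule ccontr)
    assume "D \<inter> S \<noteq> {}"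
    then obtain p where p: "p \<in> D" "p \<in> S" by blast
    obtain c where pc: "p = (c + c, c * c)" using p(1) by (auto simp: D_def)
    obtain a b where "a \<noteq> b" "p = (a + b, a * b)" using p(2) by (auto simp: S_def A_def)
    then have c: "a \<noteq> b" "c + c = a + b" "c * c = a * b" using pc by simp_all
    have "(c - a) * (c - b) = c * c - c * (a + b) + a * b" by (simp add: algebra_simps)
    also have "\<dots> = 0" unfolding c(2,3)[symmetric] by (simp add: algebra_simps)
    finally have "c = a \<or> c = b" by simp
    then show False using c by auto
  qed
  have root: "\<exists>r. r * r - u * r + v = 0" if "(u, v) \<in> D \<union> S" for u v
  proof -
    have "\<exists>a b. (u, v) = (a + b, a * b)"
      using \<open>(u, v) \<in> D \<union> S\<close>
    proof
      assume "(u, v) \<in> D"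
      then obtain c where "(u, v) = (c + c, c * c)" unfolding D_def by (rule imageE)
      then show ?thesis by blast
    next
      assume "(u, v) \<in> S"
      then show ?thesis unfolding S_def by (elim imageE) (simp only: split_paired_all prod.case, blast)
    qed
    then obtain a b where "u = a + b" "v = a * b" by blast
    then have "a * a - u * a + v = 0" by (simp add: algebra_simps)
    then show ?thesis ..
  qed
  have noroot: "r * r - u * r + v \<noteq> 0" if "(u, v) \<in> E" for u v r
  proof -
    obtain x y where xy: "y \<noteq> 0" "u = x + x + t0 * y" "v = nrm x y" using \<open>(u, v) \<in> E\<close> by (auto simp: E_def B_def)
    have "r * r - u * r + v = nrm (x - r) y" by (simp add: xy nrm_def algebra_simps)
    then show ?thesis using xy(1) by (simp add: nrm_eq_0)
  qed
  have DSE: "(D \<union> S) \<inter> E = {}"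
  proof (rule ccontr)
    assume "(D \<union> S) \<inter> E \<noteq> {}"
    then obtain u v where "(u, v) \<in> D \<union> S" "(u, v) \<in> E" by auto
    then show False using root noroot by metis
  qed
  have "CARD('a) * CARD('a) \<le> card (D \<union> S \<union> E)"
  proof -
    have "card (D \<union> S \<union> E) = card D + card S + card E"
      using DS DSE by (simp add: card_Un_disjoint)
    moreover have "CARD('a) \<le> CARD('a) * CARD('a)" by simp
    ultimately show ?thesis using cA cB cD cS cE by linarith
  qed
  then have "card (UNIV :: ('a \<times> 'a) set) \<le> card (D \<union> S \<union> E)" by simp
  then have "D \<union> S \<union> E = UNIV" by (intro card_seteq) auto
  then have "(t, n) \<in> E" using root[of t n] assms by auto
  then obtain x y where "y \<noteq> 0" "t = x + x + t0 * y" "n = nrm x y" by (auto simp: E_def B_def)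
  then show ?thesis
    using that[of "elt x y"] by (simp add: nonsplit_torus_mem nonscalar_elt tr2_elt det2_elt nrm_eq_0)
qed

end

text \<open>On a finite set the symmetric map \<open>h\<close> is not injective, hence not
  surjective; a missed pair is the sum and product of no two field elements.\<close>

lemma irreducible_quadratic_exists:
  obtains t0 n0 :: "'a :: {field,finite}" where "irreducible_quadratic t0 n0"
proof -
  define h where "h = (\<lambda>(a, b). (a + b, a * b) :: 'a \<times> 'a)"
  have "h (0, 1) = h (1, 0)" by (simp add: h_def)
  then have "\<not> inj h" by (metis injD prod.inject zero_neq_one)
  then have "\<not> surj h" using finite_UNIV_surj_inj[of h] by auto
  then obtain p where "p \<notin> range h" by blast
  then obtain t0 n0 where h: "(t0, n0) \<notin> range h" by (cases p) auto
  have "r * r - t0 * r + n0 \<noteq> 0" for r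
  proof
    assume "r * r - t0 * r + n0 = 0"
    then have "h (r, t0 - r) = (t0, n0)" by (simp add: h_def algebra_simps)
    then show False using h rangeI[of h "(r, t0 - r)"] by simp
  qed
  then show ?thesis by (intro that irreducible_quadratic.intro)
qed

section \<open>Virtual permutation characters from functions on the multiplicative group\<close>

context fin_group
begin

lemma conj_count_conj_right:
  assumes h: "h \<in> carrier G" and x: "x \<in> carrier G"
  shows "conj_count y (inv h \<otimes> x \<otimes> h) = conj_count y x"
proof -
  have hz: "h \<otimes> (inv h \<otimes> z) = z" "inv h \<otimes> (h \<otimes> z) = z" if "z \<in> carrier G" for z
    using that h by (simp_all add: m_assoc[symmetric])
  have "bij_betw (\<lambda>g. inv h \<otimes> g) {g \<in> carrier G. inv g \<otimes> x \<otimes> g = y}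
      {g \<in> carrier G. inv g \<otimes> (inv h \<otimes> x \<otimes> h) \<otimes> g = y}"
    by (rule bij_betw_byWitness[where f' = "\<lambda>g. h \<otimes> g"])
      (use h x in \<open>auto simp: inv_mult_group m_assoc hz\<close>)
  then show ?thesis unfolding conj_count_def by (simp add: bij_betw_same_card)
qed

end

definition unit_group :: "'a::field monoid" where
  "unit_group = \<lparr>carrier = units, monoid.mult = (*), one = 1\<rparr>"

lemma unit_group_simps [simp]:
  "carrier unit_group = units" "x \<otimes>\<^bsub>unit_group\<^esub> y = x * y" "\<one>\<^bsub>unit_group\<^esub> = 1"
  by (simp_all add: unit_group_def)

lemma comm_group_unit_group: "comm_group (unit_group :: 'a :: field monoid)"
proof (rule comm_groupI)
  fix x :: 'a assume "x \<in> carrier unit_group"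
  then show "\<exists>y\<in>carrier unit_group. y \<otimes>\<^bsub>unit_group\<^esub> x = \<one>\<^bsub>unit_group\<^esub>"
    by (intro bexI[of _ "inverse x"]) auto
qed auto

interpretation U: fin_comm_group "unit_group :: 'a :: {field,finite} monoid"
  by (intro fin_comm_group.intro fin_group.intro fin_group_axioms.intro comm_group_unit_group
    comm_group.axioms(2)) simp

lemma unit_group_inv: "x \<noteq> 0 \<Longrightarrow> inv\<^bsub>unit_group\<^esub> x = inverse (x :: 'a :: {field,finite})"
  by (rule U.inv_equality) auto

lemma unit_group_pow: "x [^]\<^bsub>unit_group\<^esub> (k::nat) = x ^ k"
  by (induction k) (simp_all add: mult.commute)

lemma order_unit_group: "Coset.order (unit_group :: 'a :: {field,finite} monoid) = CARD('a) - 1"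
  by (simp add: Coset.order_def card_Diff_singleton)

lemma card_units: "card (units :: 'a :: {finite,zero} set) = CARD('a) - 1"
  by (simp add: card_Diff_singleton)

lemma card_field_gt_1: "CARD('a :: {field,finite}) > 1"
  using card_mono[of UNIV "{0, 1::'a}"] by simp

lemma order_unit_group_dvd:
  "Coset.order (unit_group :: 'a :: {field,finite} monoid) dvd Coset.order (GL2 :: 'a mat monoid)"
  by (simp add: order_unit_group order_GL2 power2_eq_square)

text \<open>The hypotheses of \<open>rational_decomposition\<close> for the multiplicative group; in
  effect a rational virtual character of it. Exponents are prime to the order of \<open>GL2\<close>
  because that is the invariance inherited from functions on \<open>GL2\<close>.\<close>

definition rational_virt :: "('a :: {field,finite} \<Rightarrow> complex) \<Rightarrow> bool" where
  "rational_virt \<phi> \<longleftrightarrow> (\<forall>\<theta>\<in>lchars unit_group. U.fourier \<phi> \<theta> \<in> \<int>) \<and>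
     (\<forall>k x. coprime k (Coset.order (GL2 :: 'a mat monoid)) \<longrightarrow> x \<noteq> 0 \<longrightarrow> \<phi> (x ^ k) = \<phi> x)"

text \<open>The blocks play the role of the fibres of a homomorphism onto the multiplicative group.
  The function is \<phi> inflated along it and induced to \<open>GL2\<close>, and decomposing \<phi>
  over subgroups \<open>K\<close> turns it into permutation characters of their preimages.\<close>

lemma perm_blocks:
  fixes P :: "'a :: {field,finite} \<Rightarrow> 'a mat set"
  assumes \<phi>: "rational_virt \<phi>"
    and sub: "\<And>M. subgroup M unit_group \<Longrightarrow> subgroup (\<Union>d\<in>M. P d) GL2"
    and disj: "\<And>d e. d \<noteq> e \<Longrightarrow> P d \<inter> P e = {}"
    and P: "\<And>d. d \<noteq> 0 \<Longrightarrow> finite (P d) \<and> card (P d) = p"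
  shows "perm GL2 (\<lambda>x. (\<Sum>d\<in>units. \<phi> d * (\<Sum>y\<in>P d. J y x)) / (of_nat (CARD('a) - 1) * of_nat p))"
proof -
  let ?U = "unit_group :: 'a monoid"
  obtain b where b: "\<And>K. K \<in> U.kers \<Longrightarrow> b K \<in> \<int>"
    "\<And>x::'a. x \<in> carrier ?U \<Longrightarrow> \<phi> x = (\<Sum>K\<in>U.kers. b K * (if x \<in> K then of_nat (Coset.order ?U) / of_nat (card K) else 0))"
    by (rule U.rational_decomposition[of \<phi> "Coset.order (GL2 :: 'a mat monoid)"])
      (use \<phi> order_unit_group_dvd GL2.order_pos in \<open>auto simp: rational_virt_def unit_group_pow\<close>)
  have q: "of_nat (CARD('a) - 1) \<noteq> (0::complex)" using card_field_gt_1[where 'a = 'a] by simp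
  \<comment> \<open>The union over the trivial subgroup is a group, so the block at 1 is
    nonempty.\<close>
  have p0: "p \<noteq> 0"
  proof -
    have "subgroup {1} ?U" using U.triv_subgroup by simp
    from subgroup.one_closed[OF sub[OF this]] have "P 1 \<noteq> {}" by auto
    then show ?thesis using P[of 1] by auto
  qed
  have "perm GL2 (\<lambda>x. \<Sum>K\<in>U.kers. b K * GL2.perm_char (\<Union>d\<in>K. P d) x)"
    by (intro spanned_sum spanned_Ints_mult perm_characters_carrier GL2.perm_perm_char sub U.subgroup_kers b(1))
  then show ?thesis
  proof (rule spanned_cong)
    fix x :: "'a mat"
    have pc: "GL2.perm_char (\<Union>d\<in>K. P d) x = (\<Sum>d\<in>K. \<Sum>y\<in>P d. J y x) / (of_nat (card K) * of_nat p)"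
      if K: "K \<in> U.kers" for K
    proof -
      have K0: "d \<noteq> 0" if "d \<in> K" for d using subgroup.subset[OF U.subgroup_kers[OF K]] that by auto
      have "card (\<Union>d\<in>K. P d) = (\<Sum>d\<in>K. card (P d))"
        using disj P K0 by (intro card_UN_disjoint) auto
      also have "\<dots> = card K * p" using P K0 by simp
      finally have c: "card (\<Union>d\<in>K. P d) = card K * p" .
      have "(\<Sum>y\<in>(\<Union>d\<in>K. P d). J y x) = (\<Sum>d\<in>K. \<Sum>y\<in>P d. J y x)"
        using disj P K0 by (intro sum.UNION_disjoint) auto
      then show ?thesis by (simp add: GL2.perm_char_eq[OF sub[OF U.subgroup_kers[OF K]]] c)
    qed
    have "(\<Sum>d\<in>units. \<phi> d * (\<Sum>y\<in>P d. J y x))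
        = (\<Sum>d\<in>units. \<Sum>K\<in>U.kers. b K * (if d \<in> K then of_nat (CARD('a) - 1) / of_nat (card K) * (\<Sum>y\<in>P d. J y x) else 0))"
    proof (rule sum.cong[OF refl])
      fix d :: 'a assume "d \<in> units"
      then have "\<phi> d * (\<Sum>y\<in>P d. J y x)
          = (\<Sum>K\<in>U.kers. b K * (if d \<in> K then of_nat (CARD('a) - 1) / of_nat (card K) else 0) * (\<Sum>y\<in>P d. J y x))"
        using b(2)[of d] unfolding order_unit_group by (simp only: sum_distrib_right unit_group_simps)
      also have "\<dots> = (\<Sum>K\<in>U.kers. b K * (if d \<in> K then of_nat (CARD('a) - 1) / of_nat (card K) * (\<Sum>y\<in>P d. J y x) else 0))"
        by (rule sum.cong) auto
      finally show "\<phi> d * (\<Sum>y\<in>P d. J y x)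
          = (\<Sum>K\<in>U.kers. b K * (if d \<in> K then of_nat (CARD('a) - 1) / of_nat (card K) * (\<Sum>y\<in>P d. J y x) else 0))" .
    qed
    also have "\<dots> = (\<Sum>K\<in>U.kers. \<Sum>d\<in>units. b K * (if d \<in> K then of_nat (CARD('a) - 1) / of_nat (card K) * (\<Sum>y\<in>P d. J y x) else 0))"
      by (rule sum.swap)
    also have "\<dots> = (\<Sum>K\<in>U.kers. of_nat (CARD('a) - 1) * of_nat p * (b K * GL2.perm_char (\<Union>d\<in>K. P d) x))"
    proof (rule sum.cong[OF refl])
      fix K :: "'a set" assume K: "K \<in> U.kers"
      have Ku: "K \<subseteq> units" using subgroup.subset[OF U.subgroup_kers[OF K]] by simp
      have "(\<Sum>d\<in>units. b K * (if d \<in> K then of_nat (CARD('a) - 1) / of_nat (card K) * (\<Sum>y\<in>P d. J y x) else 0))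
          = b K * (\<Sum>d\<in>K. of_nat (CARD('a) - 1) / of_nat (card K) * (\<Sum>y\<in>P d. J y x))"
        using Ku by (simp add: sum_distrib_left[symmetric] sum.If_cases Int_absorb1)
      also have "\<dots> = of_nat (CARD('a) - 1) * of_nat p * (b K * GL2.perm_char (\<Union>d\<in>K. P d) x)"
        unfolding pc[OF K] sum_distrib_left[symmetric] using p0 by simp
      finally show "(\<Sum>d\<in>units. b K * (if d \<in> K then of_nat (CARD('a) - 1) / of_nat (card K) * (\<Sum>y\<in>P d. J y x) else 0))
          = of_nat (CARD('a) - 1) * of_nat p * (b K * GL2.perm_char (\<Union>d\<in>K. P d) x)" .
    qed
    also have "\<dots> = of_nat (CARD('a) - 1) * of_nat p * (\<Sum>K\<in>U.kers. b K * GL2.perm_char (\<Union>d\<in>K. P d) x)"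
      by (simp only: sum_distrib_left)
    finally have eq: "(\<Sum>d\<in>units. \<phi> d * (\<Sum>y\<in>P d. J y x))
      = of_nat (CARD('a) - 1) * of_nat p * (\<Sum>K\<in>U.kers. b K * GL2.perm_char (\<Union>d\<in>K. P d) x)" .
    show "(\<Sum>K\<in>U.kers. b K * GL2.perm_char (\<Union>d\<in>K. P d) x)
        = (\<Sum>d\<in>units. \<phi> d * (\<Sum>y\<in>P d. J y x)) / (of_nat (CARD('a) - 1) * of_nat p)"
      unfolding eq using q p0 by simp
  qed
qed

definition borel :: "'a::zero mat set" where
  "borel = (\<lambda>(d, a, b). mat2 a b 0 d) ` (units \<times> units \<times> UNIV)"

lemma borel_mem [simp]: "mat2 a b c d \<in> borel \<longleftrightarrow> a \<noteq> 0 \<and> d \<noteq> 0 \<and> c = 0"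
  by (force simp: borel_def)

lemma borelE:
  assumes "x \<in> borel"
  obtains a b d where "x = mat2 a b 0 d" "a \<noteq> 0" "d \<noteq> 0"
  using assms by (auto simp: borel_def)

lemma subgroup_borel: "subgroup borel (GL2 :: 'a :: {field,finite} mat monoid)"
  by (rule GL2.submonoid_imp_subgroup) (auto simp: GL2_one elim!: borelE)

lemma card_borel: "card (borel :: 'a :: {finite,zero} mat set) = (CARD('a) - 1) * ((CARD('a) - 1) * CARD('a))"
  unfolding borel_def by (subst card_image) (auto simp: inj_on_def card_cartesian_product card_Diff_singleton)

lemma sum_borel: "(\<Sum>y\<in>borel. F y) = (\<Sum>d\<in>units. \<Sum>a\<in>units. \<Sum>b\<in>UNIV. F (mat2 a b 0 (d :: 'a :: {finite,zero})))"
  unfolding borel_def by (subst sum.reindex) (auto simp: inj_on_def sum.cartesian_product split_beta)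

lemma sum_split_torus: "(\<Sum>y\<in>split_torus. F y) = (\<Sum>d\<in>units. \<Sum>a\<in>units. F (mat2 a 0 0 (d :: 'a :: {finite,zero})))"
proof -
  have "(\<Sum>y\<in>split_torus. F y) = (\<Sum>(a, d)\<in>units \<times> units. F (mat2 a 0 0 d))"
    unfolding split_torus_def by (subst sum.reindex) (auto simp: inj_on_def split_beta)
  also have "\<dots> = (\<Sum>a\<in>units. \<Sum>d\<in>units. F (mat2 a 0 0 d))" by (rule sum.cartesian_product[symmetric])
  also have "\<dots> = (\<Sum>d\<in>units. \<Sum>a\<in>units. F (mat2 a 0 0 d))" by (rule sum.swap)
  finally show ?thesis .
qed

lemma GL2_inv_upper:
  fixes a b d :: "'a :: {field,finite}"
  assumes "a \<noteq> 0" "d \<noteq> 0"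
  shows "ginv (mat2 a b 0 d) = mat2 (1 / a) (- b / (a * d)) 0 (inverse d)"
  by (rule GL2.inv_equality) (use assms in \<open>simp_all add: GL2_one field_simps\<close>)

text \<open>For \<open>a \<noteq> d\<close> the entry \<open>b\<close> does not matter, which gives
  q copies of the diagonal sum. At \<open>a = d\<close> only one of the q terms is scalar, and the
  last summand corrects the other q - 1.\<close>

lemma sum_upper:
  fixes F :: "'a :: {field,finite} mat \<Rightarrow> complex"
  assumes d: "d \<noteq> 0" and 1: "\<And>a b. a \<noteq> 0 \<Longrightarrow> a \<noteq> d \<Longrightarrow> F (mat2 a b 0 d) = F (mat2 a 0 0 d)"
    and 2: "\<And>b. b \<noteq> 0 \<Longrightarrow> F (mat2 d b 0 d) = F (mat2 d 1 0 d)"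
  shows "(\<Sum>a\<in>units. \<Sum>b\<in>UNIV. F (mat2 a b 0 d))
    = of_nat CARD('a) * (\<Sum>a\<in>units. F (mat2 a 0 0 d)) - of_nat (CARD('a) - 1) * (F (sc d) - F (mat2 d 1 0 d))"
proof -
  have du: "(\<Sum>b\<in>UNIV. F (mat2 d b 0 d)) = F (sc d) + of_nat (CARD('a) - 1) * F (mat2 d 1 0 d)"
  proof -
    have "(\<Sum>b\<in>UNIV. F (mat2 d b 0 d)) = F (sc d) + (\<Sum>b\<in>units. F (mat2 d b 0 d))"
      by (rule sum.remove) simp_all
    also have "(\<Sum>b\<in>units. F (mat2 d b 0 d)) = (\<Sum>b\<in>(units :: 'a set). F (mat2 d 1 0 d))"
      by (rule sum.cong[OF refl], rule 2) simp
    finally show ?thesis by (simp add: card_units)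
  qed
  have ad: "(\<Sum>b\<in>UNIV. F (mat2 a b 0 d)) = of_nat CARD('a) * F (mat2 a 0 0 d)" if "a \<in> units - {d}" for a
  proof -
    have "(\<Sum>b\<in>UNIV. F (mat2 a b 0 d)) = (\<Sum>b\<in>(UNIV :: 'a set). F (mat2 a 0 0 d))"
      by (rule sum.cong[OF refl], rule 1) (use that in simp_all)
    then show ?thesis by simp
  qed
  have "(\<Sum>a\<in>units. \<Sum>b\<in>UNIV. F (mat2 a b 0 d))
      = (F (sc d) + of_nat (CARD('a) - 1) * F (mat2 d 1 0 d)) + (\<Sum>a\<in>units - {d}. of_nat CARD('a) * F (mat2 a 0 0 d))"
    using d ad by (simp add: sum.remove[of units d] du)
  moreover have "(\<Sum>a\<in>units. F (mat2 a 0 0 d)) = F (sc d) + (\<Sum>a\<in>units - {d}. F (mat2 a 0 0 d))"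
    using d by (intro sum.remove) simp_all
  moreover have "of_nat (CARD('a) - 1) = (of_nat CARD('a) - 1 :: complex)"
    using card_field_gt_1[where 'a = 'a] by (simp add: of_nat_diff)
  ultimately show ?thesis by (simp add: sum_distrib_left[symmetric] algebra_simps)
qed

lemma J_upper:
  fixes x :: "'a :: {field,finite} mat"
  assumes "x \<in> carrier GL2" "d \<noteq> 0"
  shows "a \<noteq> 0 \<Longrightarrow> a \<noteq> d \<Longrightarrow> J (mat2 a b 0 d) x = J (mat2 a 0 0 d) x"
    and "b \<noteq> 0 \<Longrightarrow> J (mat2 d b 0 d) x = J (mat2 d 1 0 d) x"
  by (rule J_cong; use assms in simp)+

lemma virt_upper:
  fixes d :: "'a :: {field,finite}"
  assumes "virt GL2 f" "d \<noteq> 0"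
  shows "a \<noteq> 0 \<Longrightarrow> a \<noteq> d \<Longrightarrow> f (mat2 a b 0 d) = f (mat2 a 0 0 d)"
    and "b \<noteq> 0 \<Longrightarrow> f (mat2 d b 0 d) = f (mat2 d 1 0 d)"
  by (rule virt_nonscalar_cong[OF assms(1)]; use assms(2) in simp)+

text \<open>
  The multiplicities of \<open>s \<mapsto> (f (sc s) - f (s u)) / q\<close> are differences of those of linear
  characters of the split torus and of the Borel subgroup.
\<close>

lemma fourier_unipotent_jump:
  fixes \<theta> :: "'a :: {field,finite} \<Rightarrow> complex"
  assumes f: "virt GL2 f" and \<theta>: "\<theta> \<in> lchars unit_group"
  shows "U.fourier (\<lambda>s. (f (sc s) - f (mat2 s 1 0 s)) / of_nat CARD('a)) \<theta> \<in> \<int>"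
proof -
  let ?q = "of_nat CARD('a) :: complex" and ?r = "of_nat (CARD('a) - 1) :: complex"
  have q: "?q \<noteq> 0" "?r \<noteq> 0" using card_field_gt_1[where 'a = 'a] by simp_all
  \<comment> \<open>The lower right entry is multiplicative on upper triangular matrices, so \<mu>
    restricts to a linear character of the Borel subgroup and of the split torus.\<close>
  define \<mu> where "\<mu> A = \<theta> (A $$ (Suc 0, Suc 0))" for A
  have \<theta>1: "\<theta> 1 = 1" and \<theta>m: "x \<noteq> 0 \<Longrightarrow> y \<noteq> 0 \<Longrightarrow> \<theta> (x * y) = \<theta> x * \<theta> y" for x y
    using \<theta> by (auto simp: lchars_def)
  have T: "(\<Sum>y\<in>split_torus. f y * \<mu> (ginv y)) / of_nat (card (split_torus :: 'a mat set)) \<in> \<int>"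
    by (rule GL2.virt_multiplicity_Ints[OF f split.X]) (auto simp: \<mu>_def GL2_one \<theta>1 \<theta>m elim!: split_torusE)
  have B: "(\<Sum>y\<in>borel. f y * \<mu> (ginv y)) / of_nat (card (borel :: 'a mat set)) \<in> \<int>"
    by (rule GL2.virt_multiplicity_Ints[OF f subgroup_borel]) (auto simp: \<mu>_def GL2_one \<theta>1 \<theta>m elim!: borelE)
  define A where "A d = (\<Sum>a\<in>units. f (mat2 a 0 0 d))" for d
  have Ts: "(\<Sum>y\<in>split_torus. f y * \<mu> (ginv y)) = (\<Sum>d\<in>units. A d * \<theta> (inverse d))"
    unfolding sum_split_torus A_def sum_distrib_right
    by (intro sum.cong refl) (simp add: GL2_inv_upper \<mu>_def)
  have Bs: "(\<Sum>y\<in>borel. f y * \<mu> (ginv y))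
      = (\<Sum>d\<in>units. (?q * A d - ?r * (f (sc d) - f (mat2 d 1 0 d))) * \<theta> (inverse d))"
    unfolding sum_borel
  proof (rule sum.cong[OF refl])
    fix d :: 'a assume d: "d \<in> units"
    then have d0: "d \<noteq> 0" by simp
    have "(\<Sum>a\<in>units. \<Sum>b\<in>UNIV. f (mat2 a b 0 d) * \<mu> (ginv (mat2 a b 0 d)))
        = (\<Sum>a\<in>units. \<Sum>b\<in>UNIV. f (mat2 a b 0 d)) * \<theta> (inverse d)"
      unfolding sum_distrib_right using d by (intro sum.cong refl) (simp add: GL2_inv_upper \<mu>_def)
    also have "(\<Sum>a\<in>units. \<Sum>b\<in>UNIV. f (mat2 a b 0 d)) = ?q * A d - ?r * (f (sc d) - f (mat2 d 1 0 d))"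
      unfolding A_def by (rule sum_upper[OF d0 virt_upper[OF f d0]])
    finally show "(\<Sum>a\<in>units. \<Sum>b\<in>UNIV. f (mat2 a b 0 d) * \<mu> (ginv (mat2 a b 0 d)))
       = (?q * A d - ?r * (f (sc d) - f (mat2 d 1 0 d))) * \<theta> (inverse d)" .
  qed
  have "U.fourier (\<lambda>s. (f (sc s) - f (mat2 s 1 0 s)) / ?q) \<theta>
      = (\<Sum>d\<in>units. (f (sc d) - f (mat2 d 1 0 d)) / ?q * \<theta> (inverse d)) / ?r"
    unfolding U.fourier_def order_unit_group by (simp add: unit_group_inv)
  \<comment> \<open>In the torus multiplicity minus the Borel multiplicity the diagonal sums
    \<open>A d\<close> cancel and the jump remains, with the factor q in its denominator.\<close>
  also have "\<dots> = (\<Sum>d\<in>units. A d * \<theta> (inverse d)) / (?r * ?r)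
      - (\<Sum>d\<in>units. (?q * A d - ?r * (f (sc d) - f (mat2 d 1 0 d))) * \<theta> (inverse d)) / (?r * (?r * ?q))"
    unfolding sum_divide_distrib sum_subtractf[symmetric]
  proof (rule sum.cong[OF refl])
    have "X / v * t / r = Y * t / (r * r) - (v * Y - r * X) * t / (r * (r * v))"
      if "v \<noteq> 0" "r \<noteq> 0" for X Y t v r :: complex
      using that by (simp add: field_simps)
    then show "(f (sc d) - f (mat2 d 1 0 d)) / ?q * \<theta> (inverse d) / ?r = A d * \<theta> (inverse d) / (?r * ?r)
        - (?q * A d - ?r * (f (sc d) - f (mat2 d 1 0 d))) * \<theta> (inverse d) / (?r * (?r * ?q))" for d
      using q by blast
  qed
  also have "\<dots> \<in> \<int>" using T B unfolding Ts Bs card_split_torus card_borel of_nat_mult by (rule Ints_diff)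
  finally show ?thesis .
qed

text \<open>Translation by 1 permutes the field, so the sum of all elements is unchanged when q
  times 1 is added.\<close>

lemma of_nat_card_field: "of_nat CARD('a :: {field,finite}) = (0 :: 'a)"
proof -
  have "(\<Sum>x\<in>UNIV. x) = (\<Sum>x\<in>UNIV. x + 1 :: 'a)"
    by (rule sum.reindex_bij_witness[where i = "\<lambda>x. x + 1" and j = "\<lambda>x. x - 1"]) auto
  also have "\<dots> = (\<Sum>x\<in>UNIV. x) + of_nat CARD('a)" by (simp add: sum.distrib)
  finally show ?thesis by simp
qed

lemma of_nat_coprime_nonzero:
  assumes "coprime k CARD('a :: {field,finite})"
  shows "of_nat k \<noteq> (0 :: 'a)"
proof
  assume k: "of_nat k = (0 :: 'a)"
  have "k \<noteq> 0" using assms card_field_gt_1[where 'a = 'a] by (intro notI) simp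
  then obtain x y where "k * x = CARD('a) * y + gcd k CARD('a)" using bezout_nat by blast
  then have "k * x = CARD('a) * y + 1" using assms by simp
  then have "of_nat (k * x) = (of_nat (CARD('a) * y + 1) :: 'a)" by simp
  then show False using k of_nat_card_field[where 'a = 'a] by simp
qed

text \<open>These are the two ingredients of the correction term. The second is integral because it
  is the central value minus q times the first.\<close>

lemma rational_virt_restrictions:
  fixes f :: "'a :: {field,finite} mat \<Rightarrow> complex"
  assumes f: "virt GL2 f" and rat: "\<And>x. x \<in> carrier GL2 \<Longrightarrow> f x \<in> \<rat>"
  shows "rational_virt (\<lambda>s. (f (sc s) - f (mat2 s 1 0 s)) / of_nat CARD('a))"
    and "rational_virt (\<lambda>s. f (mat2 s 1 0 s))"
proof -
  let ?q = "of_nat CARD('a) :: complex"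
  have q: "?q \<noteq> 0" by simp
  let ?D = "\<lambda>s. (f (sc s) - f (mat2 s 1 0 s)) / ?q"
  have pow: "f (sc (s ^ k)) = f (sc s)" "f (mat2 (s ^ k) 1 0 (s ^ k)) = f (mat2 s 1 0 s)"
    if k: "coprime k (Coset.order (GL2 :: 'a mat monoid))" and s: "s \<noteq> 0" for k s
  proof -
    have p1: "sc s [^]\<^bsub>GL2\<^esub> k = sc (s ^ k)" by (induction k) (simp_all add: GL2_one mult.commute)
    show "f (sc (s ^ k)) = f (sc s)"
      using GL2.virt_rational_pow[OF f rat k, of "sc s"] s p1 by simp
    \<comment> \<open>At \<open>m = 0\<close> the truncated exponent \<open>m - 1\<close> is
      harmless, since its coefficient is \<open>of_nat 0\<close>.\<close>
    have p2: "mat2 s 1 0 s [^]\<^bsub>GL2\<^esub> m = mat2 (s ^ m) (of_nat m * s ^ (m - 1)) 0 (s ^ m)" for m :: nat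
    proof (induction m)
      case (Suc m)
      have "s ^ m + of_nat m * s ^ (m - 1) * s = (1 + of_nat m) * s ^ m"
        by (cases m) (simp_all add: algebra_simps)
      then show ?case using Suc by (simp add: mult.commute)
    qed (simp add: GL2_one)
    \<comment> \<open>The field size divides the group order, so \<open>k\<close> is nonzero in the
      field; the power keeps a nonzero upper right entry and is conjugate to the matrix with entry
      1.\<close>
    have "CARD('a) dvd Coset.order (GL2 :: 'a mat monoid)" by (simp add: order_GL2 mult.assoc)
    then have "coprime k CARD('a)" using k by (metis coprime_divisors dvd_refl)
    then have "of_nat k \<noteq> (0::'a)" by (rule of_nat_coprime_nonzero)
    then have "f (mat2 (s ^ k) (of_nat k * s ^ (k - 1)) 0 (s ^ k)) = f (mat2 (s ^ k) 1 0 (s ^ k))"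
      using s by (intro virt_upper(2)[OF f]) simp_all
    then show "f (mat2 (s ^ k) 1 0 (s ^ k)) = f (mat2 s 1 0 s)"
      using GL2.virt_rational_pow[OF f rat k, of "mat2 s 1 0 s"] s p2[of k] by simp
  qed
  have fourD: "U.fourier ?D \<theta> \<in> \<int>" if "\<theta> \<in> lchars unit_group" for \<theta>
    by (rule fourier_unipotent_jump[OF f that])
  show "rational_virt ?D" unfolding rational_virt_def using fourD pow by simp
  have four: "U.fourier (\<lambda>s. f (mat2 s 1 0 s)) \<theta> \<in> \<int>" if \<theta>: "\<theta> \<in> lchars unit_group" for \<theta>
  proof -
    let ?Z = "sc ` (units :: 'a set)"
    have Z: "subgroup ?Z GL2"
      by (rule GL2.submonoid_imp_subgroup) (auto simp: GL2_one)
    have \<theta>1: "\<theta> 1 = 1" and \<theta>m: "x \<noteq> 0 \<Longrightarrow> y \<noteq> 0 \<Longrightarrow> \<theta> (x * y) = \<theta> x * \<theta> y" for x y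
      using \<theta> by (auto simp: lchars_def)
    have inj: "inj_on sc (units :: 'a set)" by (auto simp: inj_on_def)
    define \<mu> where "\<mu> A = \<theta> (A $$ (Suc 0, Suc 0))" for A
    have "(\<Sum>y\<in>?Z. f y * \<mu> (ginv y)) / of_nat (card ?Z) \<in> \<int>"
    proof (rule GL2.virt_multiplicity_Ints[OF f Z])
      fix x y :: "'a mat" assume "x \<in> ?Z" "y \<in> ?Z"
      then obtain s t where "x = sc s" "y = sc t" "s \<noteq> 0" "t \<noteq> 0" by auto
      then show "\<mu> (x \<star> y) = \<mu> x * \<mu> y" by (simp add: \<mu>_def \<theta>m)
    qed (simp add: \<mu>_def GL2_one \<theta>1)
    also have "(\<Sum>y\<in>?Z. f y * \<mu> (ginv y)) = (\<Sum>d\<in>units. f (sc d) * \<theta> (inverse d))"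
      unfolding sum.reindex[OF inj] by (rule sum.cong) (auto simp: GL2_inv_upper \<mu>_def)
    finally have Zi: "U.fourier (\<lambda>s. f (sc s)) \<theta> \<in> \<int>"
      unfolding U.fourier_def order_unit_group by (simp add: unit_group_inv card_image[OF inj] card_units)
    have "U.fourier (\<lambda>s. f (mat2 s 1 0 s)) \<theta> = U.fourier (\<lambda>s. f (sc s)) \<theta> - ?q * U.fourier ?D \<theta>"
    proof -
      let ?t = "\<lambda>x. \<theta> (inv\<^bsub>unit_group\<^esub> x)"
      have "(\<Sum>x\<in>units. f (mat2 x 1 0 x) * ?t x) = (\<Sum>x\<in>units. f (sc x) * ?t x) - ?q * (\<Sum>x\<in>units. ?D x * ?t x)"
        unfolding sum_distrib_left sum_subtractf[symmetric]
        by (rule sum.cong) (use q in \<open>simp_all add: field_simps\<close>)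
      then show ?thesis unfolding U.fourier_def unit_group_simps by (simp only: diff_divide_distrib times_divide_eq_right)
    qed
    also have "\<dots> \<in> \<int>" using Zi fourD[OF \<theta>] by (intro Ints_diff Ints_mult) auto
    finally show ?thesis .
  qed
  show "rational_virt (\<lambda>s. f (mat2 s 1 0 s))" unfolding rational_virt_def using four pow by simp
qed

section \<open>The decomposition of rational virtual characters\<close>

text \<open>The value is the order of the centraliser, which consists of the invertible polynomials
  in the matrix.\<close>

lemma J_self_unipotent:
  fixes s :: "'a :: {field,finite}"
  assumes "s \<noteq> 0"
  shows "J (mat2 s 1 0 s) (mat2 s 1 0 s) = of_nat CARD('a) * of_nat (CARD('a) - 1)"
proof -
  let ?u = "mat2 s 1 0 s"
  have u: "?u \<in> carrier GL2" using assms by simp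
  have "{g \<in> carrier GL2. ginv g \<star> ?u \<star> g = ?u} = (\<lambda>(a, b). mat2 a b 0 a) ` (units \<times> UNIV)"
  proof (intro equalityI subsetI)
    fix g assume "g \<in> {g \<in> carrier GL2. ginv g \<star> ?u \<star> g = ?u}"
    then have g: "g \<in> carrier GL2" "?u * g = g * ?u" using GL2_conj_iff[OF u u] by auto
    obtain a b c d where abcd: "g = mat2 a b c d" "a * d - b * c \<noteq> 0" using g(1) by (rule GL2_cases)
    have "c = 0" "d = a" using g(2) by (auto simp: abcd mat2_mult algebra_simps)
    then show "g \<in> (\<lambda>(a, b). mat2 a b 0 a) ` (units \<times> UNIV)" using abcd by (intro image_eqI[of _ _ "(a, b)"]) auto
  next
    fix g assume "g \<in> (\<lambda>(a, b). mat2 a b 0 a) ` ((units :: 'a set) \<times> UNIV)"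
    then obtain a b where g: "g = mat2 a b 0 a" "a \<noteq> 0" by auto
    then have "ginv g \<star> ?u \<star> g = ?u"
      using u by (intro GL2_conjI) (simp_all add: mat2_mult algebra_simps)
    then show "g \<in> {g \<in> carrier GL2. ginv g \<star> ?u \<star> g = ?u}" using g by simp
  qed
  moreover have "card ((\<lambda>(a, b). mat2 a b 0 a) ` ((units :: 'a set) \<times> UNIV)) = (CARD('a) - 1) * CARD('a)"
    by (subst card_image) (auto simp: inj_on_def card_cartesian_product card_units)
  ultimately show ?thesis unfolding GL2.conj_count_def by simp
qed

lemma J_unipotent:
  fixes x :: "'a :: {field,finite} mat"
  assumes s: "s \<noteq> 0" and x: "x \<in> carrier GL2" "nonscalar x" "tr2 x = s + s" "det2 x = s * s"
  shows "J (mat2 s 1 0 s) x = of_nat CARD('a) * of_nat (CARD('a) - 1)"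
proof -
  have u: "mat2 s 1 0 s \<in> carrier GL2" using s by simp
  have ns: "nonscalar (mat2 s 1 0 s)" by simp
  obtain h where "h \<in> carrier GL2" "ginv h \<star> mat2 s 1 0 s \<star> h = x"
    by (rule nonscalar_conj[OF u ns x(1,2)]) (use x in simp_all)
  then show ?thesis
    using GL2.conj_count_conj_right[OF _ u] J_self_unipotent[OF s] by metis
qed

lemma double_root_unique:
  fixes a b d :: "'a :: field"
  assumes "a + b = d + d" "a * b = d * d"
  shows "a = d" "b = d"
proof -
  have "(d - a) * (d - b) = d * d - d * (a + b) + a * b" by (simp add: algebra_simps)
  also have "\<dots> = 0" unfolding assms by (simp add: algebra_simps)
  finally have "d = a \<or> d = b" by simp
  then show "a = d" "b = d" using assms(1) by auto
qed

context irreducible_quadratic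
begin

text \<open>Checked class by class. At scalars the tori give q(q+1) and q(q-1), with mean q^2, and
  the correction is q^2 - 1. At a nonscalar element with a double eigenvalue both tori give 0 and
  the correction is -1. At every other element exactly one torus gives 2 and the correction is
  0.\<close>

lemma torus_weights:
  assumes x: "x \<in> carrier GL2"
  shows "GL2.perm_char split_torus x / 2 + GL2.perm_char nonsplit_torus x / 2
    - (\<Sum>d\<in>units. J (sc d) x - J (mat2 d 1 0 d) x) / (of_nat CARD('a) * of_nat (CARD('a) - 1)) = 1"
proof (cases "nonscalar x")
  case False
  then obtain s where s: "x = sc s" by (auto simp: nonscalar_def)
  have s0: "s \<noteq> 0" using x s by auto
  obtain m where m: "CARD('a) = Suc m" using card_field_gt_1[where 'a = 'a] by (cases "CARD('a)") auto
  have m0: "of_nat m \<noteq> (0 :: complex)" using m card_field_gt_1[where 'a = 'a] by auto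
  \<comment> \<open>\<open>M\<close> is q - 1; in terms of it all orders are polynomials free of
    truncated subtraction.\<close>
  define M where "M = (of_nat m :: complex)"
  have M: "M \<noteq> 0" "M + 1 \<noteq> 0" "M + 2 \<noteq> 0"
  proof -
    show "M \<noteq> 0" using m0 by (simp add: M_def)
    have "of_nat (m + 1) \<noteq> (0 :: complex)" "of_nat (m + 2) \<noteq> (0 :: complex)" by (simp_all only: of_nat_eq_0_iff)
    then show "M + 1 \<noteq> 0" "M + 2 \<noteq> 0" by (simp_all add: M_def add.commute)
  qed
  have q: "of_nat CARD('a) = M + 1" "of_nat (CARD('a) - 1) = M" by (simp_all add: M_def m)
  have G: "of_nat (Coset.order (GL2 :: 'a mat monoid)) = (M + 1) * (M * M) * (M + 2)"
    by (simp add: order_GL2 m M_def power2_eq_square algebra_simps)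
  have "GL2.perm_char split_torus x = (M + 1) * (M * M) * (M + 2) / (M * M)"
    unfolding s split.perm_char_torus_sc[OF s0] card_split_torus G by (simp add: m M_def)
  then have 1: "GL2.perm_char split_torus x = (M + 1) * (M + 2)" using M by simp
  have "of_nat (CARD('a) * CARD('a) - 1) = M * (M + 2)"
    by (simp add: m M_def algebra_simps)
  then have "GL2.perm_char nonsplit_torus x = (M + 1) * (M * M) * (M + 2) / (M * (M + 2))"
    unfolding s nonsplit.perm_char_torus_sc[OF s0] card_nonsplit_torus G by simp
  also have "\<dots> = ((M + 1) * M) * (M * (M + 2)) / (M * (M + 2))" by (simp only: mult_ac)
  also have "\<dots> = (M + 1) * M" using M by simp
  finally have 2: "GL2.perm_char nonsplit_torus x = (M + 1) * M" .
  have "(\<Sum>d\<in>units. J (sc d) x - J (mat2 d 1 0 d) x) = (\<Sum>d\<in>units. if d = s then (M + 1) * (M * M) * (M + 2) else 0)"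
    by (rule sum.cong[OF refl]) (simp add: s J_sc[OF s0] G)
  also have "\<dots> = (M + 1) * (M * M) * (M + 2)" using s0 by (simp add: sum.delta)
  finally have 3: "(\<Sum>d\<in>units. J (sc d) x - J (mat2 d 1 0 d) x) = (M + 1) * (M * M) * (M + 2)" .
  have "(M + 1) * (M * M) * (M + 2) / ((M + 1) * M) = M * (M + 2)" using M by simp
  then show ?thesis unfolding 1 2 3 q by (simp add: field_simps)
next
  case True
  have xd: "det2 x \<noteq> 0" using x by (simp add: GL2_carrier_iff)
  have Jsc: "J (sc d) x = 0" for d by (rule J_sc_nonscalar[OF x True])
  let ?roots = "\<lambda>r. r * r - tr2 x * r + det2 x = 0"
  have split0: "?roots a \<and> ?roots d \<and> a \<noteq> d"
    if t: "mat2 a 0 0 d \<in> split_torus" "tr2 (mat2 a 0 0 d) = tr2 x" "det2 (mat2 a 0 0 d) = det2 x" "nonscalar (mat2 a 0 0 d)" for a d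
  proof -
    have "tr2 x = a + d" "det2 x = a * d" "a \<noteq> d" using t by simp_all
    then show ?thesis by (simp add: algebra_simps)
  qed
  show ?thesis
  proof (cases "\<exists>r. ?roots r")
    case False
    have "\<not> (\<exists>t\<in>split_torus. tr2 t = tr2 x \<and> det2 t = det2 x \<and> nonscalar t)"
    proof
      assume "\<exists>t\<in>split_torus. tr2 t = tr2 x \<and> det2 t = det2 x \<and> nonscalar t"
      then obtain t where t: "t \<in> split_torus" "tr2 t = tr2 x" "det2 t = det2 x" "nonscalar t" by blast
      obtain a d where ad: "t = mat2 a 0 0 d" using t(1) by (rule split_torusE)
      have "?roots a" using split0[of a d] t unfolding ad by blast
      then show False using False by blast
    qed
    then have 1: "GL2.perm_char split_torus x = 0" using split.perm_char_torus[OF x True] by (simp only: if_False)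
    have nr: "r * r - tr2 x * r + det2 x \<noteq> 0" for r using False by blast
    obtain e where "e \<in> nonsplit_torus" "nonscalar e" "tr2 e = tr2 x" "det2 e = det2 x"
      by (rule no_root_nonsplit[OF nr])
    then have "\<exists>t\<in>nonsplit_torus. tr2 t = tr2 x \<and> det2 t = det2 x \<and> nonscalar t" by blast
    then have 2: "GL2.perm_char nonsplit_torus x = 2" using nonsplit.perm_char_torus[OF x True] by (simp only: if_True)
    have "J (mat2 d 1 0 d) x = 0" for d
    proof (rule J_eq_0[OF x], rule ccontr)
      assume "\<not> (tr2 x \<noteq> tr2 (mat2 d 1 0 d) \<or> det2 x \<noteq> det2 (mat2 d 1 0 d))"
      then have "?roots d" by (simp add: algebra_simps)
      then show False using False by blast
    qed
    then show ?thesis by (simp add: 1 2 Jsc)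
  next
    case ex: True
    then obtain r where r: "?roots r" by blast
    \<comment> \<open>The second root, by Vieta.\<close>
    define r' where "r' = tr2 x - r"
    have tr: "tr2 x = r + r'" by (simp add: r'_def)
    have "det2 x = (r * r - tr2 x * r + det2 x) + r * r'" by (simp add: r'_def algebra_simps)
    then have det: "det2 x = r * r'" using r by simp
    have r0: "r \<noteq> 0" "r' \<noteq> 0" using xd det by auto
    have "\<not> (\<exists>t\<in>nonsplit_torus. tr2 t = tr2 x \<and> det2 t = det2 x \<and> nonscalar t)"
      using nonsplit_no_root r by metis
    then have 2: "GL2.perm_char nonsplit_torus x = 0" using nonsplit.perm_char_torus[OF x True] by (simp only: if_False)
    show ?thesis
    proof (cases "r = r'")
      case False
      have "\<exists>t\<in>split_torus. tr2 t = tr2 x \<and> det2 t = det2 x \<and> nonscalar t"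
        using False r0 by (intro bexI[of _ "mat2 r 0 0 r'"]) (simp_all add: tr det)
      then have 1: "GL2.perm_char split_torus x = 2" using split.perm_char_torus[OF x True] by (simp only: if_True)
      have "J (mat2 d 1 0 d) x = 0" for d
        by (rule J_eq_0[OF x]) (use double_root_unique[of r r' d] False in \<open>auto simp: tr det\<close>)
      then show ?thesis by (simp add: 1 2 Jsc)
    next
      case eq: True
      have "\<not> (\<exists>t\<in>split_torus. tr2 t = tr2 x \<and> det2 t = det2 x \<and> nonscalar t)"
        using double_root_unique[of _ _ r] eq by (force simp: tr det elim!: split_torusE)
      then have 1: "GL2.perm_char split_torus x = 0" using split.perm_char_torus[OF x True] by (simp only: if_False)
      have "J (mat2 d 1 0 d) x = (if d = r then of_nat CARD('a) * of_nat (CARD('a) - 1) else 0)" for d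
      proof (cases "d = r")
        case True
        then show ?thesis using J_unipotent[OF r0(1) x \<open>nonscalar x\<close>] tr det eq by simp
      next
        case False
        then have "J (mat2 d 1 0 d) x = 0"
          by (intro J_eq_0[OF x]) (use double_root_unique[of r r d] eq in \<open>auto simp: tr det\<close>)
        then show ?thesis using False by simp
      qed
      then have 3: "(\<Sum>d\<in>units. J (sc d) x - J (mat2 d 1 0 d) x) = - (of_nat CARD('a) * of_nat (CARD('a) - 1))"
        using r0 by (simp add: Jsc sum_negf sum.delta)
      have "of_nat CARD('a) * of_nat (CARD('a) - 1) \<noteq> (0 :: complex)"
        using card_field_gt_1[where 'a = 'a] by simp
      then show ?thesis unfolding 1 2 3 by simp
    qed
  qed
qed

end

lemma subgroup_unit_groupD:
  assumes "subgroup M (unit_group :: 'a :: {field,finite} monoid)"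
  shows "x \<in> M \<Longrightarrow> x \<noteq> 0" "1 \<in> M" "x \<in> M \<Longrightarrow> y \<in> M \<Longrightarrow> x * y \<in> M"
  using subgroup.subset[OF assms] subgroup.one_closed[OF assms] subgroup.m_closed[OF assms] by auto

text \<open>Three inductions are combined: the jump from the centre, and the value at nonsemisimple
  elements from the split torus minus the Borel subgroup, whose difference is evaluated by
  \<open>sum_upper\<close>. The denominator q at the central term is covered by the integrality of
  the jump divided by q.\<close>

lemma perm_central_unipotent:
  fixes f :: "'a :: {field,finite} mat \<Rightarrow> complex"
  assumes f: "virt GL2 f" and rat: "\<And>x. x \<in> carrier GL2 \<Longrightarrow> f x \<in> \<rat>"
  shows "perm GL2 (\<lambda>x. f x * ((\<Sum>d\<in>units. J (sc d) x - J (mat2 d 1 0 d) x) / (of_nat CARD('a) * of_nat (CARD('a) - 1))))"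
proof -
  let ?q = "of_nat CARD('a) :: complex" and ?r = "of_nat (CARD('a) - 1) :: complex"
  have q: "?q \<noteq> 0" "?r \<noteq> 0" using card_field_gt_1[where 'a = 'a] by simp_all
  let ?h = "\<lambda>s. f (mat2 s 1 0 s)"
  let ?P = "\<lambda>d :: 'a. (\<lambda>a. mat2 a 0 0 d) ` units" and ?B = "\<lambda>d :: 'a. (\<lambda>(a, b). mat2 a b 0 d) ` (units \<times> UNIV)"
  let ?n = "of_nat ((CARD('a) - 1) * CARD('a)) :: complex"
  let ?z = "\<lambda>x d. ((f (sc d) - ?h d) / ?q) * (\<Sum>y\<in>{sc d}. J y x)"
    and ?p = "\<lambda>x d. ?h d * (\<Sum>y\<in>?P d. J y x)" and ?b = "\<lambda>x d. ?h d * (\<Sum>y\<in>?B d. J y x)"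
  note rv = rational_virt_restrictions[OF f rat]
  have Z: "perm GL2 (\<lambda>x. (\<Sum>d\<in>units. ?z x d) / (?r * of_nat 1))"
  proof (rule perm_blocks[OF rv(1)])
    fix M :: "'a set" assume M: "subgroup M unit_group"
    show "subgroup (\<Union>d\<in>M. {sc d}) GL2"
      by (rule GL2.submonoid_imp_subgroup) (use subgroup_unit_groupD[OF M] in \<open>auto simp: GL2_one\<close>)
  qed auto
  have P: "perm GL2 (\<lambda>x. (\<Sum>d\<in>units. ?p x d) / (?r * ?r))"
  proof (rule perm_blocks[OF rv(2)])
    fix M :: "'a set" assume M: "subgroup M unit_group"
    show "subgroup (\<Union>d\<in>M. ?P d) GL2"
    proof (rule GL2.submonoid_imp_subgroup)
      show "(\<Union>d\<in>M. ?P d) \<subseteq> carrier GL2" using subgroup_unit_groupD[OF M] by auto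
      have "mat2 1 0 0 1 \<in> ?P 1" by (rule image_eqI[of _ _ 1]) auto
      then show "\<one>\<^bsub>GL2\<^esub> \<in> (\<Union>d\<in>M. ?P d)" using subgroup_unit_groupD(2)[OF M] unfolding GL2_one by blast
      fix x y assume "x \<in> (\<Union>d\<in>M. ?P d)" "y \<in> (\<Union>d\<in>M. ?P d)"
      then obtain d a d' a' where xy: "x = mat2 a 0 0 d" "d \<in> M" "a \<noteq> 0" "y = mat2 a' 0 0 d'" "d' \<in> M" "a' \<noteq> 0"
        by auto
      have "x \<star> y = mat2 (a * a') 0 0 (d * d')" "a * a' \<in> units" using xy by simp_all
      then have "x \<star> y \<in> ?P (d * d')" by blast
      then show "x \<star> y \<in> (\<Union>d\<in>M. ?P d)" using subgroup_unit_groupD(3)[OF M xy(2,5)] by blast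
    qed
  qed (auto simp: card_image inj_on_def card_units)
  have B: "perm GL2 (\<lambda>x. (\<Sum>d\<in>units. ?b x d) / (?r * ?n))"
  proof (rule perm_blocks[OF rv(2)])
    fix M :: "'a set" assume M: "subgroup M unit_group"
    show "subgroup (\<Union>d\<in>M. ?B d) GL2"
    proof (rule GL2.submonoid_imp_subgroup)
      show "(\<Union>d\<in>M. ?B d) \<subseteq> carrier GL2" using subgroup_unit_groupD[OF M] by auto
      have "mat2 1 0 0 1 \<in> ?B 1" by (rule image_eqI[of _ _ "(1, 0)"]) auto
      then show "\<one>\<^bsub>GL2\<^esub> \<in> (\<Union>d\<in>M. ?B d)" using subgroup_unit_groupD(2)[OF M] unfolding GL2_one by blast
      fix x y assume "x \<in> (\<Union>d\<in>M. ?B d)" "y \<in> (\<Union>d\<in>M. ?B d)"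
      then obtain d d' where d: "d \<in> M" "x \<in> ?B d" "d' \<in> M" "y \<in> ?B d'" by blast
      have BE: "\<exists>a b. z = mat2 a b 0 e \<and> a \<noteq> 0" if mem: "z \<in> ?B e" for z e
      proof -
        obtain p where "p \<in> (units :: 'a set) \<times> (UNIV :: 'a set)" "z = (\<lambda>(a, b). mat2 a b 0 e) p" using mem by (rule imageE)
        then show ?thesis by (cases p) auto
      qed
      obtain a b where x: "x = mat2 a b 0 d" "a \<noteq> 0" using BE[OF d(2)] by blast
      obtain a' b' where y: "y = mat2 a' b' 0 d'" "a' \<noteq> 0" using BE[OF d(4)] by blast
      note xy = x(1) d(1) x(2) y(1) d(3) y(2)
      have "x \<star> y = (\<lambda>(a, b). mat2 a b 0 (d * d')) (a * a', a * b' + b * d')" by (simp add: xy)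
      moreover have "(a * a', a * b' + b * d') \<in> units \<times> UNIV" using xy by simp
      ultimately have "x \<star> y \<in> ?B (d * d')" by (rule image_eqI)
      then show "x \<star> y \<in> (\<Union>d\<in>M. ?B d)" using subgroup_unit_groupD(3)[OF M xy(2,5)] by blast
    qed
  qed (auto simp: card_image inj_on_def card_units card_cartesian_product)
  have "perm GL2 (\<lambda>x. (\<Sum>d\<in>units. ?z x d) / (?r * of_nat 1)
      + (\<Sum>d\<in>units. ?p x d) / (?r * ?r)
      - (\<Sum>d\<in>units. ?b x d) / (?r * ?n))"
    by (intro spanned_diff perm_characters_carrier spanned_add Z P B)
  then show ?thesis
  proof (rule spanned_cong)
    fix x :: "'a mat" assume x: "x \<in> carrier GL2"
    \<comment> \<open>Here \<open>X\<close> and \<open>h\<close> are the values of \<open>f\<close>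
      at the scalar and the nonsemisimple element, \<open>j\<close> and \<open>u\<close> the
      corresponding counts, \<open>A\<close> the diagonal sum, and \<open>v\<close>,
      \<open>w\<close> stand for q and q - 1.\<close>
    have alg: "((X - h) / v) * j / (w * 1) + h * A / (w * w) - h * (v * A - w * (j - u)) / (w * (w * v)) = (X * j - h * u) / (v * w)"
      if "v \<noteq> 0" "w \<noteq> 0" for X h v w j u A :: complex using that by (simp add: field_simps)
    have Bs: "(\<Sum>y\<in>?B d. J y x) = ?q * (\<Sum>a\<in>units. J (mat2 a 0 0 d) x) - ?r * (J (sc d) x - J (mat2 d 1 0 d) x)"
      if d: "d \<noteq> 0" for d
    proof -
      have "(\<Sum>y\<in>?B d. J y x) = (\<Sum>a\<in>units. \<Sum>b\<in>UNIV. J (mat2 a b 0 d) x)"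
        by (subst sum.reindex) (auto simp: inj_on_def sum.cartesian_product split_beta)
      also have "\<dots> = ?q * (\<Sum>a\<in>units. J (mat2 a 0 0 d) x) - ?r * (J (sc d) x - J (mat2 d 1 0 d) x)"
        by (rule sum_upper[OF d J_upper[OF x d]])
      finally show ?thesis .
    qed
    have Ps: "(\<Sum>y\<in>?P d. J y x) = (\<Sum>a\<in>units. J (mat2 a 0 0 d) x)" for d
      by (subst sum.reindex) (auto simp: inj_on_def)
    have comb: "(\<Sum>d\<in>D. A d) / p1 + (\<Sum>d\<in>D. B d) / p2 - (\<Sum>d\<in>D. C d) / p3
      = (\<Sum>d\<in>D. A d / p1 + B d / p2 - C d / p3)" for A B C :: "'a \<Rightarrow> complex" and p1 p2 p3 D
      by (simp only: sum.distrib sum_subtractf sum_divide_distrib)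
    have comb': "F * ((\<Sum>d\<in>D. A d) / p1) = (\<Sum>d\<in>D. F * A d / p1)" for A :: "'a \<Rightarrow> complex" and F p1 D
      by (simp only: sum_distrib_left sum_divide_distrib times_divide_eq_right)
    have summand: "?z x d / (?r * of_nat 1)
       + ?p x d / (?r * ?r)
       - ?b x d / (?r * ?n)
       = f x * (J (sc d) x - J (mat2 d 1 0 d) x) / (?q * ?r)" if d: "d \<in> units" for d
    proof -
      have "?z x d / (?r * of_nat 1)
       + ?p x d / (?r * ?r)
       - ?b x d / (?r * ?n)
       = (f (sc d) * J (sc d) x - ?h d * J (mat2 d 1 0 d) x) / (?q * ?r)"
        using alg[OF q, of "f (sc d)" "?h d" "J (sc d) x" "\<Sum>a\<in>units. J (mat2 a 0 0 d) x" "J (mat2 d 1 0 d) x"] Bs[of d] Ps[of d] d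
        by (simp only: of_nat_mult of_nat_1 DiffE singletonI sum.insert sum.empty empty_iff finite.emptyI add_0_right not_False_eq_True) simp
      also have "f (sc d) * J (sc d) x - ?h d * J (mat2 d 1 0 d) x = f x * (J (sc d) x - J (mat2 d 1 0 d) x)"
        by (simp add: GL2.virt_conj_count[OF f x] right_diff_distrib)
      finally show ?thesis .
    qed
    show "(\<Sum>d\<in>units. ?z x d) / (?r * of_nat 1)
      + (\<Sum>d\<in>units. ?p x d) / (?r * ?r)
      - (\<Sum>d\<in>units. ?b x d) / (?r * ?n)
      = f x * ((\<Sum>d\<in>units. J (sc d) x - J (mat2 d 1 0 d) x) / (?q * ?r))"
      unfolding comb comb' by (rule sum.cong[OF refl summand])
  qed
qed

text \<open>By \<open>J_coset\<close> the defect from \<open>half_induced_virt\<close> can be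
  regrouped by determinants. The coefficients are power invariant because taking powers permutes
  each \<open>K\<close> and raises determinants to the same power.\<close>

lemma (in gl2_torus) half_torus:
  assumes f: "virt GL2 f" and rat: "\<And>x. x \<in> carrier GL2 \<Longrightarrow> f x \<in> \<rat>"
  shows "\<exists>v. (\<forall>k c. coprime k (Coset.order (GL2 :: 'a mat monoid)) \<longrightarrow> c \<noteq> 0 \<longrightarrow> v (c ^ k) = v c) \<and>
    perm GL2 (\<lambda>x. f x * (GL2.perm_char X x / 2) + (\<Sum>c\<in>units. v c * J (mat2 0 c 1 0) x))"
proof -
  have comm': "x \<star> y = y \<star> x" if "x \<in> X" "y \<in> X" for x y
    using comm[OF that] by (simp add: GL2_mult)
  have ww: "w \<star> w = \<one>\<^bsub>GL2\<^esub>" using w(3) by (simp add: GL2_mult GL2_one)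
  have wX': "w \<star> x \<star> w \<in> X" if "x \<in> X" for x using wX[OF that] by (simp add: GL2_mult)
  obtain \<K> b where "finite \<K>" "\<forall>K\<in>\<K>. subgroup K GL2 \<and> K \<subseteq> X \<and> b K \<in> \<int>"
    and \<K>: "perm GL2 (\<lambda>x. f x * GL2.perm_char X x / 2
       + (\<Sum>K\<in>\<K>. b K / (2 * of_nat (card K)) * (\<Sum>k\<in>K. J (k \<star> w) x)))"
    using GL2.half_induced_virt[OF f rat X comm' w(1,2) ww wX'] by blast
  then have KX: "subgroup K GL2" "K \<subseteq> X" if "K \<in> \<K>" for K using that by blast+
  define v where "v c = (\<Sum>K\<in>\<K>. b K / (2 * of_nat (card K)) * of_nat (card {k \<in> K. det2 k = c}))" for c
  show ?thesis
  proof (rule exI[of _ v], intro conjI allI impI)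
    fix k c assume k: "coprime k (Coset.order (GL2 :: 'a mat monoid))" and c: "(c::'a) \<noteq> 0"
    have "card {y \<in> K. det2 y = c ^ k} = card {y \<in> K. det2 y = c}" if K: "K \<in> \<K>" for K
    proof -
      note KS = KX[OF K]
      let ?K = "GL2\<lparr>carrier := K\<rparr>"
      interpret K: fin_comm_group ?K
        by (rule GL2.fin_comm_group_carrier[OF KS(1)]) (use comm' KS(2) in auto)
      have dvd: "Coset.order ?K dvd Coset.order (GL2 :: 'a mat monoid)"
        using GL2.lagrange[OF KS(1)] by (simp add: Coset.order_def dvd_def) (metis mult.commute)
      have "coprime k (Coset.order ?K)" by (rule coprime_divisors[OF dvd_refl dvd k])
      from K.pow_bij[OF this] have bij: "bij_betw (\<lambda>y. y [^]\<^bsub>GL2\<^esub> k) K K" by (simp add: nat_pow_def)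
      \<comment> \<open>Powers are injective on determinants as well, so nothing outside the fibre
        over \<open>c\<close> lands in the fibre over \<open>c ^ k\<close>.\<close>
      have "coprime k (Coset.order (unit_group :: 'a monoid))" by (rule coprime_divisors[OF dvd_refl order_unit_group_dvd k])
      from U.pow_bij[OF this] have inj: "inj_on (\<lambda>d::'a. d ^ k) units" by (simp add: bij_betw_def unit_group_pow)
      have KG: "y \<in> carrier GL2" if "y \<in> K" for y using subgroup.mem_carrier[OF KS(1) that] .
      have det: "det2 (y [^]\<^bsub>GL2\<^esub> m) = det2 y ^ m" if "y \<in> carrier GL2" for y :: "'a mat" and m :: nat
      proof (induction m)
        case (Suc m)
        have "y [^]\<^bsub>GL2\<^esub> m \<in> carrier GL2" using that by simp
        then show ?case using Suc that by (simp add: GL2_mult det2_mult GL2_carrier_iff mult.commute)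
      qed (simp add: GL2_one)
      have d0: "det2 y \<noteq> 0" if "y \<in> K" for y using KG[OF that] by (simp add: GL2_carrier_iff)
      have "(\<lambda>y. y [^]\<^bsub>GL2\<^esub> k) ` {y \<in> K. det2 y = c} = {y \<in> K. det2 y = c ^ k}"
      proof (intro equalityI subsetI)
        fix z assume "z \<in> (\<lambda>y. y [^]\<^bsub>GL2\<^esub> k) ` {y \<in> K. det2 y = c}"
        then show "z \<in> {y \<in> K. det2 y = c ^ k}" using bij_betwE[OF bij] det KG by auto
      next
        fix z assume z: "z \<in> {y \<in> K. det2 y = c ^ k}"
        then obtain y where y: "y \<in> K" "z = y [^]\<^bsub>GL2\<^esub> k" using bij_betw_imp_surj_on[OF bij] by auto
        have "det2 y ^ k = c ^ k" using z y det[OF KG[OF y(1)]] by simp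
        then have "det2 y = c" using inj d0[OF y(1)] c by (auto simp: inj_on_def)
        then show "z \<in> (\<lambda>y. y [^]\<^bsub>GL2\<^esub> k) ` {y \<in> K. det2 y = c}" using y by blast
      qed
      moreover have "inj_on (\<lambda>y. y [^]\<^bsub>GL2\<^esub> k) {y \<in> K. det2 y = c}"
        using bij_betw_imp_inj_on[OF bij] by (rule inj_on_subset) auto
      ultimately show ?thesis using card_image by fastforce
    qed
    then show "v (c ^ k) = v c" unfolding v_def by (intro sum.cong) auto
  next
    show "perm GL2 (\<lambda>x. f x * (GL2.perm_char X x / 2) + (\<Sum>c\<in>units. v c * J (mat2 0 c 1 0) x))"
    proof (rule spanned_cong[OF \<K>])
      fix x :: "'a mat" assume x: "x \<in> carrier GL2"
      have "(\<Sum>k\<in>K. J (k \<star> w) x) = (\<Sum>c\<in>units. of_nat (card {k \<in> K. det2 k = c}) * J (mat2 0 c 1 0) x)"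
        if K: "K \<in> \<K>" for K
      proof -
        note KS = KX[OF K]
        have finK: "finite K" using finite_subset[OF subgroup.subset[OF KS(1)] GL2.fin] .
        have d0: "det2 ` K \<subseteq> units"
          using subgroup.mem_carrier[OF KS(1)] by (auto simp: GL2_carrier_iff)
        have "(\<Sum>k\<in>K. J (k \<star> w) x) = (\<Sum>k\<in>K. J (mat2 0 (det2 k) 1 0) x)"
          by (rule sum.cong[OF refl]) (use J_coset[OF _ x] KS(2) in auto)
        also have "\<dots> = (\<Sum>c\<in>units. \<Sum>k\<in>{k \<in> K. det2 k = c}. J (mat2 0 (det2 k) 1 0) x)"
          by (rule sum.group[symmetric, OF finK _ d0]) simp
        also have "\<dots> = (\<Sum>c\<in>units. of_nat (card {k \<in> K. det2 k = c}) * J (mat2 0 c 1 0) x)"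
          by (intro sum.cong refl) simp
        finally show ?thesis .
      qed
      then have "(\<Sum>K\<in>\<K>. b K / (2 * of_nat (card K)) * (\<Sum>k\<in>K. J (k \<star> w) x))
          = (\<Sum>K\<in>\<K>. \<Sum>c\<in>units. b K / (2 * of_nat (card K)) * of_nat (card {k \<in> K. det2 k = c}) * J (mat2 0 c 1 0) x)"
        by (intro sum.cong refl) (simp add: sum_distrib_left mult.assoc)
      also have "\<dots> = (\<Sum>c\<in>units. v c * J (mat2 0 c 1 0) x)"
        unfolding v_def sum_distrib_right by (rule sum.swap)
      finally show "f x * GL2.perm_char X x / 2 + (\<Sum>K\<in>\<K>. b K / (2 * of_nat (card K)) * (\<Sum>k\<in>K. J (k \<star> w) x))
          = f x * (GL2.perm_char X x / 2) + (\<Sum>c\<in>units. v c * J (mat2 0 c 1 0) x)" by simp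
    qed
  qed
qed


text \<open>
  The summands \<open>J (mat2 0 c 1 0)\<close> come from the antidiagonal matrices, that is, from the difference
  between the groups of monomial and of diagonal matrices with determinant up to sign in a given
  subgroup of the multiplicative group.
\<close>

lemma perm_trace_zero:
  fixes v :: "'a :: {field,finite} \<Rightarrow> complex"
  assumes v: "\<And>k c. coprime k (Coset.order (GL2 :: 'a mat monoid)) \<Longrightarrow> c \<noteq> 0 \<Longrightarrow> v (c ^ k) = v c"
    and virt: "virt GL2 (\<lambda>x. \<Sum>c\<in>units. v c * J (mat2 0 c 1 0) x)"
  shows "perm GL2 (\<lambda>x. \<Sum>c\<in>units. v c * J (mat2 0 c 1 0) x)"
proof -
  let ?r = "of_nat (CARD('a) - 1) :: complex"
  let ?G = "GL2 :: 'a mat monoid"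
  have r: "?r \<noteq> 0" using card_field_gt_1[where 'a = 'a] by simp
  have m: "mat2 0 c 1 0 \<in> carrier GL2" if "c \<noteq> 0" for c :: 'a using that by simp
  have oG: "of_nat (Coset.order ?G) \<noteq> (0 :: complex)" using GL2.order_pos[where 'a = 'a] by simp
  \<comment> \<open>The virtual character is paired with \<open>\<theta> \<circ> det2\<close>. Each
    \<open>J\<close> has total mass the group order and sits in determinant \<open>- c\<close>, so
    the multiplicity is this sum up to the sign \<open>\<theta> (- 1)\<close>.\<close>
  have int: "(\<Sum>c\<in>units. v c * \<theta> (inverse c)) \<in> \<int>" if \<theta>: "\<theta> \<in> lchars unit_group" for \<theta>
  proof -
    have \<theta>1: "\<theta> 1 = 1" and \<theta>m: "x \<noteq> 0 \<Longrightarrow> y \<noteq> 0 \<Longrightarrow> \<theta> (x * y) = \<theta> x * \<theta> y" for x y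
      using \<theta> by (auto simp: lchars_def)
    define \<mu> where "\<mu> A = \<theta> (det2 A)" for A
    have \<mu>m: "\<mu> (x \<star> y) = \<mu> x * \<mu> y" if "x \<in> carrier GL2" "y \<in> carrier GL2" for x y
      using that by (simp add: \<mu>_def GL2_mult det2_mult GL2_carrier_iff \<theta>m)
    have inv: "\<mu> (ginv x) = \<theta> (inverse (det2 x))" if x: "x \<in> carrier GL2" for x
    proof -
      have "det2 x * det2 (ginv x) = det2 (x \<star> ginv x)"
        using x GL2.inv_closed[OF x] by (simp add: GL2_mult det2_mult GL2_carrier_iff del: GL2.r_inv GL2.inv_closed)
      also have "\<dots> = 1" using x by (simp add: GL2_one)
      finally show ?thesis unfolding \<mu>_def by (metis inverse_unique)
    qed
    have "(\<Sum>x\<in>carrier ?G. (\<Sum>c\<in>units. v c * J (mat2 0 c 1 0) x) * \<mu> (ginv x)) / of_nat (card (carrier ?G)) \<in> \<int>"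
      by (rule GL2.virt_multiplicity_Ints[OF virt GL2.subgroup_self]) (simp_all add: \<mu>m, simp add: \<mu>_def GL2_one \<theta>1)
    also have "(\<Sum>x\<in>carrier ?G. (\<Sum>c\<in>units. v c * J (mat2 0 c 1 0) x) * \<mu> (ginv x))
        = (\<Sum>x\<in>carrier ?G. \<Sum>c\<in>units. v c * \<theta> (inverse (- c)) * J (mat2 0 c 1 0) x)"
    proof (rule sum.cong[OF refl])
      fix x assume x: "x \<in> carrier ?G"
      have "J (mat2 0 c 1 0) x * \<theta> (inverse (det2 x)) = J (mat2 0 c 1 0) x * \<theta> (inverse (- c))" for c
        using J_eq_0[OF x, of "mat2 0 c 1 0"] by (cases "det2 x = - c") simp_all
      then show "(\<Sum>c\<in>units. v c * J (mat2 0 c 1 0) x) * \<mu> (ginv x)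
          = (\<Sum>c\<in>units. v c * \<theta> (inverse (- c)) * J (mat2 0 c 1 0) x)"
        unfolding inv[OF x] sum_distrib_right by (intro sum.cong refl) (simp only: mult_ac)
    qed
    also have "\<dots> = (\<Sum>c\<in>units. v c * \<theta> (inverse (- c)) * (\<Sum>x\<in>carrier ?G. J (mat2 0 c 1 0) x))"
      by (subst sum.swap) (simp only: sum_distrib_left)
    also have "\<dots> = (\<Sum>c\<in>units. v c * \<theta> (inverse (- c)) * of_nat (Coset.order ?G))"
      by (rule sum.cong[OF refl]) (simp add: GL2.sum_conj_count)
    also have "\<dots> / of_nat (card (carrier ?G)) = (\<Sum>c\<in>units. v c * \<theta> (inverse (- c)))"
      unfolding sum_distrib_right[symmetric] Coset.order_def[symmetric] using oG by simp
    also have "\<dots> = \<theta> (- 1) * (\<Sum>c\<in>units. v c * \<theta> (inverse c))"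
    proof -
      have "\<theta> (inverse (- c)) = \<theta> (- 1) * \<theta> (inverse c)" if "c \<noteq> 0" for c
        using \<theta>m[of "- 1" "inverse c"] that by (simp add: inverse_minus_eq)
      then show ?thesis unfolding sum_distrib_left by (intro sum.cong) auto
    qed
    finally have Z: "\<theta> (- 1) * (\<Sum>c\<in>units. v c * \<theta> (inverse c)) \<in> \<int>" .
    have "\<theta> (- 1) * \<theta> (- 1) = 1" using \<theta>m[of "- 1" "- 1"] \<theta>1 by simp
    then have "\<theta> (- 1) = 1 \<or> \<theta> (- 1) = - 1" by (simp add: square_eq_1_iff)
    then show ?thesis using Z by auto
  qed
  \<comment> \<open>The factor q - 1 cancels the normalisation of \<open>U.fourier\<close>, so
    integrality becomes exactly \<open>int\<close>.\<close>
  have rv: "rational_virt (\<lambda>c. ?r * v c)"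
    unfolding rational_virt_def
  proof (intro conjI ballI allI impI)
    fix \<theta> assume \<theta>: "\<theta> \<in> lchars (unit_group :: 'a monoid)"
    have "(\<Sum>x\<in>units. ?r * v x * \<theta> (inv\<^bsub>unit_group\<^esub> x)) = ?r * (\<Sum>c\<in>units. v c * \<theta> (inverse c))"
      unfolding sum_distrib_left by (rule sum.cong) (simp_all add: unit_group_inv)
    then show "U.fourier (\<lambda>c. ?r * v c) \<theta> \<in> \<int>"
      using int[OF \<theta>] r unfolding U.fourier_def unit_group_simps order_unit_group by simp
  qed (simp add: v)
  \<comment> \<open>Diagonal and antidiagonal matrices whose two nonzero entries have product
    \<open>c\<close>; the determinants are \<open>c\<close> and \<open>- c\<close>. Indexing by this
    product rather than by the determinant makes the unions over a subgroup closed under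
    multiplication.\<close>
  let ?P = "\<lambda>c. (\<lambda>a. mat2 a 0 0 (c / a)) ` (units :: 'a set)" and ?Q = "\<lambda>c. (\<lambda>a. mat2 0 a (c / a) 0) ` (units :: 'a set)"
  let ?n = "of_nat (2 * (CARD('a) - 1)) :: complex"
  let ?A = "\<lambda>x. \<Sum>c\<in>units. ?r * v c * (\<Sum>y\<in>?P c. J y x)"
    and ?B = "\<lambda>x. \<Sum>c\<in>units. ?r * v c * (\<Sum>y\<in>?P c \<union> ?Q c. J y x)"
  have Pm: "mat2 a 0 0 d \<in> ?P c" if "a \<noteq> 0" "a * d = c" for a d c
    using that by (intro image_eqI[of _ _ a]) (auto simp: field_simps)
  have Qm: "mat2 0 a d 0 \<in> ?Q c" if "a \<noteq> 0" "a * d = c" for a d c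
    using that by (intro image_eqI[of _ _ a]) (auto simp: field_simps)
  have P1: "mat2 1 0 0 1 \<in> ?P 1" by (rule Pm) simp_all
  have PE: "\<exists>a d. x = mat2 a 0 0 d \<and> a \<noteq> 0 \<and> a * d = c" if mem: "x \<in> ?P c" for x c
  proof -
    obtain a where "a \<in> (units :: 'a set)" "x = mat2 a 0 0 (c / a)" using mem by (rule imageE)
    then show ?thesis by (intro exI[of _ a] exI[of _ "c / a"]) simp
  qed
  have QE: "\<exists>a d. x = mat2 0 a d 0 \<and> a \<noteq> 0 \<and> a * d = c" if mem: "x \<in> ?Q c" for x c
  proof -
    obtain a where "a \<in> (units :: 'a set)" "x = mat2 0 a (c / a) 0" using mem by (rule imageE)
    then show ?thesis by (intro exI[of _ a] exI[of _ "c / a"]) simp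
  qed
  have PQ: "?P c \<inter> ?Q c = {}" for c by auto
  have P: "perm GL2 (\<lambda>x. ?A x / (?r * ?r))"
  proof (rule perm_blocks[OF rv])
    fix M :: "'a set" assume M: "subgroup M unit_group"
    note MD = subgroup_unit_groupD[OF M]
    show "subgroup (\<Union>c\<in>M. ?P c) GL2"
    proof (rule GL2.submonoid_imp_subgroup)
      show "(\<Union>c\<in>M. ?P c) \<subseteq> carrier GL2"
      proof
        fix z assume "z \<in> (\<Union>c\<in>M. ?P c)"
        then obtain c where c: "c \<in> M" "z \<in> ?P c" by blast
        then show "z \<in> carrier GL2" using PE[OF c(2)] MD(1)[OF c(1)] by auto
      qed
      show "\<one>\<^bsub>GL2\<^esub> \<in> (\<Union>c\<in>M. ?P c)" unfolding GL2_one using MD(2) P1 by blast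
      fix x y assume "x \<in> (\<Union>c\<in>M. ?P c)" "y \<in> (\<Union>c\<in>M. ?P c)"
      then obtain c c' where c: "c \<in> M" "x \<in> ?P c" "c' \<in> M" "y \<in> ?P c'" by blast
      obtain a d where x: "x = mat2 a 0 0 d" "a \<noteq> 0" "a * d = c" using PE[OF c(2)] by blast
      obtain a' d' where y: "y = mat2 a' 0 0 d'" "a' \<noteq> 0" "a' * d' = c'" using PE[OF c(4)] by blast
      have "x \<star> y = mat2 (a * a') 0 0 (d * d')" by (simp add: x y)
      also have "\<dots> \<in> ?P (c * c')" using x y by (intro Pm) auto
      finally show "x \<star> y \<in> (\<Union>c\<in>M. ?P c)" using MD(3)[OF c(1,3)] by blast
    qed
  next
    show "?P c \<inter> ?P c' = {}" if "c \<noteq> c'" for c c'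
      using that by auto
    show "finite (?P c) \<and> card (?P c) = CARD('a) - 1" if "c \<noteq> 0" for c
      by (simp add: card_image inj_on_def card_units)
  qed
  have Q: "perm GL2 (\<lambda>x. ?B x / (?r * ?n))"
  proof (rule perm_blocks[OF rv])
    fix M :: "'a set" assume M: "subgroup M unit_group"
    note MD = subgroup_unit_groupD[OF M]
    show "subgroup (\<Union>c\<in>M. ?P c \<union> ?Q c) GL2"
    proof (rule GL2.submonoid_imp_subgroup)
      show "(\<Union>c\<in>M. ?P c \<union> ?Q c) \<subseteq> carrier GL2"
      proof
        fix z assume "z \<in> (\<Union>c\<in>M. ?P c \<union> ?Q c)"
        then obtain c where c: "c \<in> M" "z \<in> ?P c \<union> ?Q c" by blast
        obtain a d where "z = mat2 a 0 0 d \<or> z = mat2 0 a d 0" "a * d = c"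
          using PE[of z c] QE[of z c] c(2) by blast
        then show "z \<in> carrier GL2" using MD(1)[OF c(1)] by auto
      qed
      show "\<one>\<^bsub>GL2\<^esub> \<in> (\<Union>c\<in>M. ?P c \<union> ?Q c)" unfolding GL2_one using MD(2) P1 by blast
      fix x y assume "x \<in> (\<Union>c\<in>M. ?P c \<union> ?Q c)" "y \<in> (\<Union>c\<in>M. ?P c \<union> ?Q c)"
      then obtain c c' where c: "c \<in> M" "x \<in> ?P c \<union> ?Q c" "c' \<in> M" "y \<in> ?P c' \<union> ?Q c'" by blast
      obtain a d where x: "x = mat2 a 0 0 d \<or> x = mat2 0 a d 0" "a \<noteq> 0" "a * d = c"
        using PE[of x c] QE[of x c] c(2) by blast
      obtain a' d' where y: "y = mat2 a' 0 0 d' \<or> y = mat2 0 a' d' 0" "a' \<noteq> 0" "a' * d' = c'"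
        using PE[of y c'] QE[of y c'] c(4) by blast
      have d: "d \<noteq> 0" "d' \<noteq> 0" using x(3) y(3) MD(1)[OF c(1)] MD(1)[OF c(3)] by auto
      have pr: "(a * a') * (d * d') = c * c'" "(a * d') * (d * a') = c * c'"
        unfolding x(3)[symmetric] y(3)[symmetric] by (simp_all only: mult_ac)
      have xy: "x \<star> y \<in> {mat2 (a * a') 0 0 (d * d'), mat2 0 (a * a') (d * d') 0, mat2 0 (a * d') (d * a') 0, mat2 (a * d') 0 0 (d * a')}"
        using x(1) y(1) by auto
      have mem: "mat2 (a * a') 0 0 (d * d') \<in> ?P (c * c')" "mat2 (a * d') 0 0 (d * a') \<in> ?P (c * c')"
        "mat2 0 (a * a') (d * d') 0 \<in> ?Q (c * c')" "mat2 0 (a * d') (d * a') 0 \<in> ?Q (c * c')"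
        using Pm[OF _ pr(1)] Pm[OF _ pr(2)] Qm[OF _ pr(1)] Qm[OF _ pr(2)] x(2) y(2) d by simp_all
      have "z \<in> S \<union> T" if "z \<in> {p1, q1, q2, p2}" "p1 \<in> S" "p2 \<in> S" "q1 \<in> T" "q2 \<in> T"
        for z p1 p2 q1 q2 :: "'a mat" and S T using that by blast
      from this[OF xy mem] have "x \<star> y \<in> ?P (c * c') \<union> ?Q (c * c')" .
      then show "x \<star> y \<in> (\<Union>c\<in>M. ?P c \<union> ?Q c)" using MD(3)[OF c(1,3)] by blast
    qed
  next
    show "(?P c \<union> ?Q c) \<inter> (?P c' \<union> ?Q c') = {}" if "c \<noteq> c'" for c c'
      using that by auto
    show "finite (?P c \<union> ?Q c) \<and> card (?P c \<union> ?Q c) = 2 * (CARD('a) - 1)" if "c \<noteq> 0" for c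
      using PQ[of c] by (simp add: card_Un_disjoint card_image inj_on_def card_units)
  qed
  \<comment> \<open>The monomial group is twice as large as the diagonal one, so twice its induced
    function minus the diagonal one leaves the antidiagonal part.\<close>
  have "perm GL2 (\<lambda>x. of_int 2 * (?B x / (?r * ?n))
      - ?A x / (?r * ?r))"
    by (intro spanned_diff spanned_int_mult perm_characters_carrier P Q)
  then show ?thesis
  proof (rule spanned_cong)
    fix x :: "'a mat" assume x: "x \<in> carrier GL2"
    define A B where "A = (\<Sum>c\<in>units. v c * (\<Sum>y\<in>?P c. J y x))" and "B = (\<Sum>c\<in>units. v c * J (mat2 0 c 1 0) x)"
    have Qs: "(\<Sum>y\<in>?P c \<union> ?Q c. J y x) = (\<Sum>y\<in>?P c. J y x) + ?r * J (mat2 0 c 1 0) x" if c: "c \<noteq> 0" for c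
    proof -
      have "(\<Sum>y\<in>?Q c. J y x) = (\<Sum>a\<in>units. J (mat2 0 a (c / a) 0) x)"
        by (subst sum.reindex) (auto simp: inj_on_def)
      also have "\<dots> = (\<Sum>a\<in>(units :: 'a set). J (mat2 0 c 1 0) x)"
        by (rule sum.cong[OF refl], rule J_cong) (use c x in auto)
      finally show ?thesis using PQ[of c] by (simp add: sum.union_disjoint card_units)
    qed
    have 1: "?A x = ?r * A"
      unfolding A_def by (simp only: sum_distrib_left mult.assoc)
    have "?B x
        = (\<Sum>c\<in>units. ?r * (v c * (\<Sum>y\<in>?P c. J y x)) + ?r * (?r * (v c * J (mat2 0 c 1 0) x)))"
      by (rule sum.cong[OF refl]) (simp add: Qs algebra_simps)
    then have 2: "?B x = ?r * A + ?r * (?r * B)"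
      unfolding A_def B_def by (simp only: sum.distrib sum_distrib_left)
    have alg: "of_int 2 * ((w * X + w * (w * Y)) / (w * (2 * w))) - w * X / (w * w) = Y" if "w \<noteq> 0" for w X Y :: complex
      using that by (simp add: field_simps)
    show "of_int 2 * (?B x / (?r * ?n))
      - ?A x / (?r * ?r)
      = (\<Sum>c\<in>units. v c * J (mat2 0 c 1 0) x)"
      unfolding 1 2 B_def[symmetric] of_nat_mult of_nat_numeral by (rule alg[OF r])
  qed
qed

lemma perm_if_virt_rational:
  fixes f :: "'a :: {field,finite} mat \<Rightarrow> complex"
  assumes f: "virt GL2 f" and rat: "\<And>x. x \<in> carrier GL2 \<Longrightarrow> f x \<in> \<rat>"
  shows "perm GL2 f"
proof -
  obtain t0 n0 :: 'a where "irreducible_quadratic t0 n0" by (rule irreducible_quadratic_exists)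
  then interpret irreducible_quadratic t0 n0 .
  obtain v1 where v1: "\<forall>k c. coprime k (Coset.order (GL2 :: 'a mat monoid)) \<longrightarrow> c \<noteq> 0 \<longrightarrow> v1 (c ^ k) = v1 c"
    and p1: "perm GL2 (\<lambda>x. f x * (GL2.perm_char split_torus x / 2) + (\<Sum>c\<in>units. v1 c * J (mat2 0 c 1 0) x))"
    using split.half_torus[OF f rat] by blast
  obtain v2 where v2: "\<forall>k c. coprime k (Coset.order (GL2 :: 'a mat monoid)) \<longrightarrow> c \<noteq> 0 \<longrightarrow> v2 (c ^ k) = v2 c"
    and p2: "perm GL2 (\<lambda>x. f x * (GL2.perm_char nonsplit_torus x / 2) + (\<Sum>c\<in>units. v2 c * J (mat2 0 c 1 0) x))"
    using nonsplit.half_torus[OF f rat] by blast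
  define v where "v c = v1 c + v2 c" for c
  let ?Y = "\<lambda>x. \<Sum>c\<in>units. v c * J (mat2 0 c 1 0) x"
  let ?C = "\<lambda>x. f x * ((\<Sum>d\<in>units. J (sc d) x - J (mat2 d 1 0 d) x) / (of_nat CARD('a) * of_nat (CARD('a) - 1)))"
  have "perm GL2 (\<lambda>x. (f x * (GL2.perm_char split_torus x / 2) + (\<Sum>c\<in>units. v1 c * J (mat2 0 c 1 0) x))
      + (f x * (GL2.perm_char nonsplit_torus x / 2) + (\<Sum>c\<in>units. v2 c * J (mat2 0 c 1 0) x)) - ?C x)"
    by (intro spanned_diff spanned_add perm_characters_carrier p1 p2 perm_central_unipotent[OF f rat])
  then have fY: "perm GL2 (\<lambda>x. f x + ?Y x)"
  proof (rule spanned_cong)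
    fix x :: "'a mat" assume x: "x \<in> carrier GL2"
    let ?a = "GL2.perm_char split_torus x / 2" and ?b = "GL2.perm_char nonsplit_torus x / 2"
    let ?c = "(\<Sum>d\<in>units. J (sc d) x - J (mat2 d 1 0 d) x) / (of_nat CARD('a) * of_nat (CARD('a) - 1))"
    have Y: "?Y x = (\<Sum>c\<in>units. v1 c * J (mat2 0 c 1 0) x) + (\<Sum>c\<in>units. v2 c * J (mat2 0 c 1 0) x)"
      unfolding v_def distrib_right by (rule sum.distrib)
    have w: "f x * (?a + ?b - ?c) = f x" unfolding torus_weights[OF x] by (rule mult_1_right)
    have alg: "X * a + s1 + (X * b + s2) - X * c = X * (a + b - c) + (s1 + s2)" for X a b c s1 s2 :: complex
      by (simp add: algebra_simps)
    show "(f x * ?a + (\<Sum>c\<in>units. v1 c * J (mat2 0 c 1 0) x))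
      + (f x * ?b + (\<Sum>c\<in>units. v2 c * J (mat2 0 c 1 0) x)) - f x * ?c = f x + ?Y x"
      unfolding Y alg w ..
  qed
  \<comment> \<open>Here the hypothesis on \<open>f\<close> feeds back: as a virtual permutation
    character minus \<open>f\<close>, the error is a virtual character, which is the integrality
    required by \<open>perm_trace_zero\<close>.\<close>
  have "virt GL2 (\<lambda>x. (f x + ?Y x) - f x)"
    by (intro spanned_diff characters_carrier f spanned_mono[OF perm_characters_characters[OF GL_group] fY])
  then have "virt GL2 ?Y" by simp
  then have "perm GL2 ?Y" using v1 v2 by (intro perm_trace_zero) (simp_all add: v_def)
  then have "perm GL2 (\<lambda>x. (f x + ?Y x) - ?Y x)" by (intro spanned_diff perm_characters_carrier fY)
  then show ?thesis by simp
qed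

theorem theorem5p1:
  fixes p n :: nat
  assumes "prime p" and "n \<ge> 1" and "CARD('a::{field,finite}) = p ^ n"
  shows "trivial_group (C_hat (GL TYPE('a) 2))"
  by (rule trivial_C_hatI[OF GL_group perm_if_virt_rational])

end
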